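(* Let $g$ be a strongly additive function with $0\le g(p)\le M$ for all primes $p$ (for some constant $M$) and $B(g;x)\to\infty$. Suppose there is a distribution function $\Psi\neq\delta_0$ with $\Psi(\alpha)-\Psi(0)=1$ for some $\alpha>0$, such that \[ \frac{1}{B(g;x)^2}\sum_{\substack{p\le x\\ g(p)\le t}}\frac{g(p)^2}{p}=\Psi(t)+O\Big(\frac{1}{B(g;x)^2}\Big) \] uniformly in $t\in\mathbb{R}$. Then \[ \frac{1}{x}\,\#\Big\{n\le x:\ \frac{g(n)-\mu(g;x)}{B(g;x)}\ge\Delta\Big\}\ \sim\ \mathbb{P}\big(\mathcal{Z}_\Psi(B(g;x)^2)\ge\Delta\,B(g;x)\big) \] uniformly in $1\le\Delta\le o(B(g;x))$.
   Context: A function $g:\mathbb{N}\to\mathbb{R}$ is strongly additive if $g(mn)=g(m)+g(n)$ whenever $\gcd(m,n)=1$ and $g(p^k)=g(p)$ for all primes $p$, $k\ge1$. Sums over $p$ are over primes; $\mu(g;x)=\sum_{p\le x}g(p)/p$, $B(g;x)^2=\sum_{p\le x}g(p)^2/p$. $\delta_0$ is the distribution function of the point mass at $0$. For a distribution function $\Psi$ with $\Psi(\alpha)-\Psi(0)=1$ for some $\alpha>0$, $\{\mathcal{Z}_\Psi(u)\}_{u\ge0}$ is a family of real random variables whose laws are determined by $\mathbb{E}[e^{\mathrm{i}t\mathcal{Z}_\Psi(u)}]=\exp\big(u\int_0^\infty\frac{e^{\mathrm{i}tx}-\mathrm{i}tx-1}{x^2}\,\mathrm{d}\Psi(x)\big)$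 for each real $u\ge0$. "Uniformly in $1\le\Delta\le o(B)$" means: for every function $\epsilon(x)\to0$, the ratio of the two sides tends to $1$ as $x\to\infty$ uniformly over $1\le\Delta\le\epsilon(x)B(g;x)$. *)

theory Defs
  imports "HOL-Probability.Probability" "HOL-Computational_Algebra.Primes"
begin

text \<open>The arithmetic functions of interest live on the positive integers; the value at \<open>0\<close>
  is left unconstrained.\<close>

definition strongly_additive :: "(nat \<Rightarrow> real) \<Rightarrow> bool" where
  "strongly_additive g \<longleftrightarrow>
     (\<forall>m n. m > 0 \<longrightarrow> n > 0 \<longrightarrow> coprime m n \<longrightarrow> g (m * n) = g m + g n) \<and>
     (\<forall>p k. prime p \<longrightarrow> k \<ge> 1 \<longrightarrow> g (p ^ k) = g p)"

definition mu :: "(nat \<Rightarrow> real) \<Rightarrow> real \<Rightarrow> real" where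
  "mu g x = (\<Sum>p | prime p \<and> real p \<le> x. g p / real p)"

definition B :: "(nat \<Rightarrow> real) \<Rightarrow> real \<Rightarrow> real" where
  "B g x = sqrt (\<Sum>p | prime p \<and> real p \<le> x. (g p)\<^sup>2 / real p)"

definition distribution_function :: "(real \<Rightarrow> real) \<Rightarrow> bool" where
  "distribution_function \<Psi> \<longleftrightarrow>
     mono \<Psi> \<and> (\<forall>a. continuous (at_right a) \<Psi>) \<and>
     (\<Psi> \<longlongrightarrow> 0) at_bot \<and> (\<Psi> \<longlongrightarrow> 1) at_top"

lemma distribution_function_iff_cdf:
  "distribution_function \<Psi> \<longleftrightarrow> (\<exists>N. real_distribution N \<and> \<Psi> = cdf N)"
proof
  assume D: "distribution_function \<Psi>"
  have *: "\<And>x y. x \<le> y \<Longrightarrow> \<Psi> x \<le> \<Psi> y" "\<And>a. continuous (at_right a) \<Psi>"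
    "(\<Psi> \<longlongrightarrow> 0) at_bot" "(\<Psi> \<longlongrightarrow> 1) at_top"
    using D by (auto simp: distribution_function_def mono_def)
  have "real_distribution (interval_measure \<Psi>)"
    using * by (intro real_distribution_interval_measure) auto
  moreover have "cdf (interval_measure \<Psi>) = \<Psi>"
    using * by (intro cdf_interval_measure) auto
  ultimately show "\<exists>N. real_distribution N \<and> \<Psi> = cdf N" by metis
next
  assume "\<exists>N. real_distribution N \<and> \<Psi> = cdf N"
  then obtain N where "real_distribution N" and Psi: "\<Psi> = cdf N" by blast
  then interpret real_distribution N by simp
  show "distribution_function \<Psi>"
    unfolding distribution_function_def Psi mono_def
    using cdf_nondecreasing cdf_is_right_cont cdf_lim_at_bot cdf_lim_at_top_prob by blast
qed

text \<open>The Lebesgue-Stieltjes integral \<open>\<integral>\<^sub>0\<^sup>\<infinity> \<dots> d\<Psi>\<close>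
  is taken over the open half-line. Where it is used, \<open>\<Psi> \<alpha> - \<Psi> 0 = 1\<close> forces all
  the mass into the interval from \<open>0\<close> (exclusive) to \<open>\<alpha>\<close>, so the endpoint does not
  matter.\<close>

definition Z_exponent :: "(real \<Rightarrow> real) \<Rightarrow> real \<Rightarrow> complex" where
  "Z_exponent \<Psi> t =
     (LINT x:{0<..}|interval_measure \<Psi>.
        (exp (\<i> * of_real t * of_real x) - \<i> * of_real t * of_real x - 1) / (of_real x)\<^sup>2)"

definition is_Z_family :: "(real \<Rightarrow> real) \<Rightarrow> 'a measure \<Rightarrow> (real \<Rightarrow> 'a \<Rightarrow> real) \<Rightarrow> bool" where
  "is_Z_family \<Psi> P Z \<longleftrightarrow>
     prob_space P \<and>
     (\<forall>u\<ge>0. Z u \<in> borel_measurable P \<and>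
        (\<forall>t. char (distr P borel (Z u)) t = exp (of_real u * Z_exponent \<Psi> t)))"

end

(*
  Write E(z) for the exponential moment at z of the limit law with u = B(x)^2, that is, exp(u L(z)) with
  L(z) = sum_j m_j z^(j+2)/(j+2)! and m_j the moments of Psi.

  Arithmetic input.  If f is strongly multiplicative with |f(p) - 1| <= rho for all primes p and
  rho is small, then the mean of f over n <= x is G_x (1 + O(rho) + o(1)), where G_x is the product
  over p <= x of 1 + (f(p) - 1)/p.  Let E_y(X) be the error for the function that ignores primes
  above y.  Removing the largest prime gives the Buchstab-type recursion
  E_p(X) = E_{p-1}(X) + (f(p) - 1) E_{p-1}(X/p), and the bound
  E_y(X) = O(X |G_y| sqrt((1 + ln y)/(1 + ln X))) reproduces itself with a gain of a factor
  O(rho), using nothing about primes beyond Chebyshev's upper bound.  For f(n) = exp(z g(n)) this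
  shows that the exponential moment of g - mu is E(z)(1 + o(1)) uniformly for complex z -> 0; the
  hypothesis on Psi enters through the moments.

  Probabilistic input.  Tilting both laws by exp(sigma w), with the saddle point L'(sigma) = Delta/B,
  reduces both tails to the integral of exp(-v), v >= 0, under the tilted law of
  v = sigma (w - Delta B).  The characteristic functions of the tilted laws are close to the Gaussian
  one of variance D^2 = (sigma B)^2 on compact sets only, so a Fejer-type kernel with compactly
  supported Fourier transform is put in front, after which Levy's continuity theorem gives the
  same limit for both laws, also when D tends to infinity.
*)
theory Submission
  imports Defs "HOL-Real_Asymp.Real_Asymp"
begin

section \<open>Chebyshev bounds\<close>

text \<open>Uniformity in \<Delta> is obtained by contradiction along sequences on which 1 /
  \<Delta> converges to some \<kappa> in [0, 1]. Bounded \<Delta> and \<Delta> tending to infinity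
  are then treated together, \<kappa> = 0 being the latter case. Since \<Delta> = o(B), the saddle
  point is at most 2 \<Delta> / B and tends to 0. Near z = 0 the values exp (z g(p)) are uniformly
  close to 1 because g(p) <= M, and this is why a mean value theorem with relative error O(rho) is
  strong enough. Relative errors are essential throughout. With D = sigma B, the integrals under the
  tilted laws have size 1/D, so an absolute error in the characteristic functions would swamp them
  for large D; their comparison therefore carries a Gaussian factor in the frequency. Both tails,
  multiplied by one and the same explicit factor, tend to the positive number
  \<open>gaussian_limit \<kappa>\<close>, so their quotient tends to 1.\<close>

lemma binomial_odd_le: "(2*m+1) choose m \<le> (4::nat)^m"
proof -
  have "(\<Sum>k\<in>{m,m+1}. (2*m+1) choose k) \<le> (\<Sum>k\<le>2*m+1. (2*m+1) choose k)"
    by (rule sum_mono2) auto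
  also have "\<dots> = 2 * 4^m" by (simp only: choose_row_sum) (simp add: power_mult)
  finally have "(2*m+1 choose m) + (2*m+1 choose (m+1)) \<le> 2 * 4^m" by simp
  moreover have "(2*m+1 choose (m+1)) = (2*m+1 choose m)"
    using binomial_symmetric[of m "2*m+1"] by simp
  ultimately show ?thesis by simp
qed

lemma prod_primes_dvd:
  fixes n :: nat
  assumes "finite A" "\<And>p. p \<in> A \<Longrightarrow> prime p" "\<And>p. p \<in> A \<Longrightarrow> p dvd n"
  shows "\<Prod>A dvd n"
  using assms
proof (induction A rule: finite_induct)
  case (insert p A)
  have "coprime p (\<Prod>A)"
    using insert by (intro prod_coprime_right primes_coprime) auto
  then show ?case using insert by (simp add: divides_mult)
qed auto

text \<open>Erdos's induction. An even n > 2 is not prime and reduces to n - 1. For n = 2 m + 1 the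
  primes in (m + 1, n] divide the binomial coefficient n over m, which is at most 4^m, and the
  primes up to m + 1 are covered by induction.\<close>

lemma primorial_le: "(\<Prod>p | prime p \<and> p \<le> n. p) \<le> (4::nat)^n"
proof (induction n rule: less_induct)
  case (less n)
  have "n \<le> 1 \<or> n = 2 \<or> (n > 2 \<and> even n) \<or> (\<exists>m\<ge>1. n = 2*m+1)"
    by presburger
  then consider "n \<le> 1" | "n = 2" | "n > 2" "even n" | m where "m \<ge> 1" "n = 2*m+1"
    by blast
  then show ?case
  proof cases
    case 1
    have "\<not> (prime p \<and> p \<le> n)" for p :: nat using 1 prime_ge_2_nat[of p] by linarith
    then have *: "{p::nat. prime p \<and> p \<le> n} = {}" by blast
    show ?thesis unfolding * by simp
  next
    case 2
    have "prime p \<and> p \<le> 2 \<longleftrightarrow> p = 2" for p :: nat using prime_ge_2_nat[of p] two_is_prime_nat by (auto intro: antisym)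
    then have "{p::nat. prime p \<and> p \<le> n} = {2}" using 2 by auto
    then show ?thesis using 2 by simp
  next
    case 3
    have "\<not> prime n" using 3 primes_dvd_imp_eq[of 2 n] by auto
    moreover have "p \<le> n - 1 \<longleftrightarrow> p \<le> n \<and> p \<noteq> n" for p using 3 by linarith
    ultimately have "{p::nat. prime p \<and> p \<le> n} = {p. prime p \<and> p \<le> n - 1}"
      by auto
    then have "(\<Prod>p | prime p \<and> p \<le> n. p) \<le> 4^(n-1)" using less[of "n-1"] 3 by simp
    also have "\<dots> \<le> 4^n" by (rule power_increasing) auto
    finally show ?thesis .
  next
    case (4 m)
    have split: "{p::nat. prime p \<and> p \<le> n} = {p. prime p \<and> p \<le> m+1} \<union> {p. prime p \<and> m+1 < p \<and> p \<le> n}"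
      using 4 by auto
    have "(\<Prod>p | prime p \<and> m+1 < p \<and> p \<le> n. p) dvd (n choose m)"
    proof (rule prod_primes_dvd)
      fix p assume "p \<in> {p. prime p \<and> m+1 < p \<and> p \<le> n}"
      then have p: "prime p" "m+1 < p" "p \<le> n" by auto
      have "fact m * fact (m+1) * (n choose m) = fact n"
        using binomial_fact_lemma[of m n] 4 by simp
      then have "p dvd fact m * fact (m+1) * (n choose m)"
        using p by (simp add: prime_dvd_fact_iff)
      moreover have "\<not> p dvd fact m" "\<not> p dvd fact (m+1)"
        using p by (simp_all add: prime_dvd_fact_iff del: fact_Suc)
      ultimately show "p dvd (n choose m)" using p by (simp add: prime_dvd_mult_iff del: fact_Suc)
    qed auto
    then have "(\<Prod>p | prime p \<and> m+1 < p \<and> p \<le> n. p) \<le> (n choose m)"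
      using 4 by (intro dvd_imp_le) auto
    also have "\<dots> \<le> 4^m" using binomial_odd_le 4 by simp
    finally have 1: "(\<Prod>p | prime p \<and> m+1 < p \<and> p \<le> n. p) \<le> 4^m" .
    have "(\<Prod>p | prime p \<and> p \<le> n. p) = (\<Prod>p | prime p \<and> p \<le> m+1. p) * (\<Prod>p | prime p \<and> m+1 < p \<and> p \<le> n. p)"
      unfolding split by (rule prod.union_disjoint) auto
    also have "\<dots> \<le> 4^(m+1) * 4^m"
      using 1 less[of "m+1"] 4 by (intro mult_mono) auto
    also have "\<dots> = 4^n" using 4 by (simp add: mult_2 power_add)
    finally show ?thesis .
  qed
qed

lemma theta_le:
  assumes "x \<ge> 0"
  shows "(\<Sum>p | prime p \<and> real p \<le> x. ln (real p)) \<le> x * ln 4"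
proof -
  let ?n = "nat \<lfloor>x\<rfloor>"
  have "{p. prime p \<and> real p \<le> x} = {p. prime p \<and> p \<le> ?n}"
    using assms by (simp add: le_nat_iff le_floor_iff)
  then have "(\<Sum>p | prime p \<and> real p \<le> x. ln (real p)) = ln (real (\<Prod>p | prime p \<and> p \<le> ?n. p))"
    by (subst ln_prod[symmetric]) (auto simp: prime_gt_0_nat)
  also have "\<dots> \<le> ln (real (4 ^ ?n))"
    using primorial_le[of ?n] by (subst ln_le_cancel_iff) (auto intro!: prod_pos prime_gt_0_nat simp flip: of_nat_prod)
  also have "\<dots> = real ?n * ln 4" by (simp add: ln_realpow)
  also have "\<dots> \<le> x * ln 4" using assms by (intro mult_right_mono) auto
  finally show ?thesis .
qed

section \<open>Sums over primes, one multiplicative block at a time\<close>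

definition primes_in :: "real \<Rightarrow> real \<Rightarrow> nat set" where
  "primes_in a b = {p. prime p \<and> a < real p \<and> real p \<le> b}"

lemma finite_primes_in [simp, intro]: "finite (primes_in a b)"
  by (rule finite_subset[of _ "{..nat \<lfloor>b\<rfloor>}"]) (auto simp: primes_in_def le_nat_iff le_floor_iff)

lemma primes_in_mono: "a' \<le> a \<Longrightarrow> b \<le> b' \<Longrightarrow> primes_in a b \<subseteq> primes_in a' b'"
  by (auto simp: primes_in_def)

lemma primes_in_split: "a \<le> b \<Longrightarrow> b \<le> c \<Longrightarrow> primes_in a c = primes_in a b \<union> primes_in b c"
  by (auto simp: primes_in_def)

lemma sum_primes_in_split:
  assumes "a \<le> b" "b \<le> c"
  shows "(\<Sum>p\<in>primes_in a c. f p) = (\<Sum>p\<in>primes_in a b. f p) + (\<Sum>p\<in>primes_in b c. f p)"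
proof -
  have "primes_in a b \<inter> primes_in b c = {}" by (auto simp: primes_in_def)
  then show ?thesis
    unfolding primes_in_split[OF assms] by (intro sum.union_disjoint finite_primes_in)
qed

text \<open>The shift by 1 keeps \<open>ell x\<close> at least 1 for x >= 1, so quotients, roots and
  logarithms of it are harmless down to x = 1. Dividing x by \<open>exp 1\<close> lowers it by
  exactly 1.\<close>

abbreviation (input) ell :: "real \<Rightarrow> real" where "ell x \<equiv> 1 + ln x"

lemma exp_1_less: "exp (1::real) < 272/100"
  using e_less_272 by simp

text \<open>On a block of ratio \<open>exp 1\<close> both p and ln p are essentially constant, so
  1/p is at most a constant times ln p / (b * ell b), and Chebyshev's bound for the sum of ln p
  finishes. The 5 comes from ln p >= max (ln b - 1) (2/3), the 20 from 5 * exp 1 * ln 4 <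
  20.\<close>

lemma sum_recip_primes_block:
  assumes "b \<ge> 1"
  shows "(\<Sum>p\<in>primes_in (b / exp 1) b. 1 / real p) \<le> 20 / ell b"
proof -
  have l: "ln b \<ge> 0" using assms by simp
  have "1 / real p \<le> 5 * exp 1 / (b * ell b) * ln (real p)" if "p \<in> primes_in (b / exp 1) b" for p
  proof -
    have p: "prime p" "b / exp 1 < p" using that by (auto simp: primes_in_def)
    have lb: "ell b > 0" using l by linarith
    have p2: "p \<ge> 2" using p prime_ge_2_nat by blast
    have "ln (b / exp 1) \<le> ln p" using p assms by (subst ln_le_cancel_iff) (auto simp: field_simps intro: prime_gt_0_nat)
    then have 1: "ln b - 1 \<le> ln p" using assms by (simp add: ln_div)
    have "ln 2 \<le> ln (real p)" using p2 by simp
    then have 2: "2/3 \<le> ln (real p)" using ln2_ge_two_thirds by linarith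
    have 3: "ell b \<le> 5 * ln p" using 1 2 by (cases "ln b \<ge> 3/2") linarith+
    have "b \<le> exp 1 * p" using p(2) by (simp add: field_simps)
    then have "b * ell b \<le> (exp 1 * p) * (5 * ln p)" using 3 l assms by (intro mult_mono) auto
    moreover have "b * ell b > 0" using lb assms by (intro mult_pos_pos) auto
    ultimately have "1 / real p \<le> (5 * exp 1 * ln p) / (b * ell b)"
      using p2 by (simp add: field_simps)
    then show ?thesis by simp
  qed
  then have "(\<Sum>p\<in>primes_in (b / exp 1) b. 1 / real p) \<le> (\<Sum>p\<in>primes_in (b / exp 1) b. 5 * exp 1 / (b * ell b) * ln (real p))"
    by (rule sum_mono)
  also have "\<dots> \<le> (\<Sum>p\<in>primes_in 0 b. 5 * exp 1 / (b * ell b) * ln (real p))"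
  proof (rule sum_mono2[OF finite_primes_in primes_in_mono])
    fix p assume "p \<in> primes_in 0 b - primes_in (b / exp 1) b"
    then have "ln (real p) \<ge> 0" using prime_ge_1_nat[of p] by (auto simp: primes_in_def)
    moreover have "5 * exp 1 / (b * ell b) \<ge> 0" using assms l by simp
    ultimately show "5 * exp 1 / (b * ell b) * ln (real p) \<ge> 0" by (rule mult_nonneg_nonneg[rotated])
  qed (use assms in auto)
  also have "\<dots> = 5 * exp 1 / (b * ell b) * (\<Sum>p | prime p \<and> real p \<le> b. ln (real p))"
    by (subst sum_distrib_left) (auto intro!: sum.cong simp: primes_in_def dest: prime_gt_0_nat)
  also have "\<dots> \<le> 5 * exp 1 / (b * ell b) * (b * ln 4)"
    using theta_le[of b] assms l by (intro mult_left_mono) auto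
  also have "\<dots> = 5 * exp 1 * ln 4 / ell b" using assms by simp
  also have "\<dots> \<le> 20 / ell b"
  proof (rule divide_right_mono)
    have "ln (4::real) = 2 * ln 2" using ln_realpow[of 2 2] by simp
    then have "ln (4::real) \<le> 2 * (25/36)" using ln2_le_25_over_36 by simp
    then have "exp 1 * ln (4::real) \<le> 272/100 * (2 * (25/36))" using exp_1_less by (intro mult_mono) auto
    then show "5 * exp 1 * ln 4 \<le> (20::real)" by simp
  qed (use l in auto)
  finally show ?thesis .
qed

lemma div_exp_le: "0 < b \<Longrightarrow> b / exp 1 \<le> (b::real)"
  using exp_gt_one[of "1::real"] by (simp add: divide_le_eq)

text \<open>Takes the place of partial summation: a sum over primes up to b is the sum up to
  \<open>b / exp 1\<close> plus one block, so a bound in terms of \<open>ell b\<close> is verified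
  through its increment when \<open>ell b\<close> drops by 1. The base case is a range no longer
  than one block.\<close>

lemma real_block_induct [consumes 2, case_names base step]:
  fixes a b :: real
  assumes "0 < a" "a \<le> b"
    and base: "\<And>b. a \<le> b \<Longrightarrow> b \<le> a * exp 1 \<Longrightarrow> Q b"
    and step: "\<And>b. a * exp 1 < b \<Longrightarrow> Q (b / exp 1) \<Longrightarrow> Q b"
  shows "Q b"
proof -
  have "a \<le> b \<Longrightarrow> b \<le> a * exp (real (Suc n)) \<Longrightarrow> Q b" for n b
  proof (induction n arbitrary: b)
    case 0 then show ?case using base by simp
  next
    case (Suc n)
    show ?case
    proof (cases "b \<le> a * exp 1")
      case False
      have "exp (real (Suc (Suc n))) = exp 1 * exp (real (Suc n))" by (simp flip: exp_add)
      then have "b / exp 1 \<le> a * exp (real (Suc n))" using Suc.prems(2)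
        by (simp only: pos_divide_le_eq[OF exp_gt_zero] mult.assoc mult.commute[of _ "exp 1"] mult.left_commute[of _ "exp 1"])
      moreover have "a \<le> b / exp 1" using False by (simp add: pos_le_divide_eq)
      ultimately have "Q (b / exp 1)" by (intro Suc.IH)
      then show ?thesis using False by (metis step not_le)
    qed (use Suc base in auto)
  qed
  moreover have "b \<le> a * exp (real (Suc (nat \<lceil>ln (b/a)\<rceil>)))"
  proof -
    have "ln (b/a) \<le> real (Suc (nat \<lceil>ln (b/a)\<rceil>))" by linarith
    then have "exp (ln (b/a)) \<le> exp (real (Suc (nat \<lceil>ln (b/a)\<rceil>)))" by (simp only: exp_le_cancel_iff)
    then have "a * exp (ln (b/a)) \<le> a * exp (real (Suc (nat \<lceil>ln (b/a)\<rceil>)))"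
      using assms(1) by (intro mult_left_mono) auto
    moreover have "a * exp (ln (b/a)) = b" using assms(1,2) by simp
    ultimately show ?thesis by simp
  qed
  ultimately show ?thesis using assms by blast
qed

lemma ln_block_step: "x > 1 \<Longrightarrow> 1 / x \<le> ln x - ln (x - 1 :: real)"
  using ln_one_minus_pos_upper_bound[of "1/x"] ln_div[of "x-1" x]
  by (simp add: diff_divide_distrib)

text \<open>The block ending at b contributes at most 20 / ell b, which is dominated by 20 times the
  increment ln (ell b) - ln (ell b - 1). The summand 1 pays for the incomplete block at the
  bottom.\<close>

lemma sum_recip_primes_le:
  assumes "1 \<le> a" "a \<le> b"
  shows "(\<Sum>p\<in>primes_in a b. 1 / real p) \<le> 20 * (1 + ln (ell b / ell a))"
proof -
  have la: "ln a \<ge> 0" using assms by simp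
  have "0 < a" using assms by simp
  from this \<open>a \<le> b\<close> show ?thesis
  proof (induction rule: real_block_induct)
    case (base b)
    have lb: "ln b \<ge> ln a" using base assms by simp
    have "(\<Sum>p\<in>primes_in a b. 1 / real p) \<le> (\<Sum>p\<in>primes_in (b / exp 1) b. 1 / real p)"
      using base by (intro sum_mono2 primes_in_mono) (auto simp: field_simps)
    also have "\<dots> \<le> 20 / ell b" using base assms by (intro sum_recip_primes_block) auto
    also have "\<dots> \<le> 20 * 1" using lb la by (simp add: field_simps)
    also have "\<dots> \<le> 20 * (1 + ln (ell b / ell a))" using lb la by (intro mult_left_mono) (auto)
    finally show ?case .
  next
    case (step b)
    have ab: "a \<le> b / exp 1" using step by (simp add: field_simps)
    have b0: "b > 0" using step \<open>0 < a\<close> by (meson exp_gt_zero less_trans mult_pos_pos)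
    have b1: "b / exp 1 \<le> b" "b > 0" using div_exp_le[of b] b0 by auto
    have lb: "ln b > 1 + ln a"
    proof -
      have "ln (a * exp 1) < ln b" using step b1 assms by (subst ln_less_cancel_iff) auto
      then show ?thesis using assms by (simp add: ln_mult)
    qed
    have e: "ell (b / exp 1) = ell b - 1" using b1 by (simp add: ln_div)
    have "(\<Sum>p\<in>primes_in a b. 1 / real p) = (\<Sum>p\<in>primes_in a (b/exp 1). 1 / real p) + (\<Sum>p\<in>primes_in (b/exp 1) b. 1 / real p)"
      using ab b1 by (intro sum_primes_in_split)
    also have "\<dots> \<le> 20 * (1 + ln (ell (b/exp 1) / ell a)) + 20 / ell b"
      using step ab b1 assms by (intro add_mono sum_recip_primes_block) auto
    also have "\<dots> \<le> 20 * (1 + ln (ell b / ell a))"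
      unfolding e using lb la ln_block_step[of "ell b"] by (simp add: ln_div)
    finally show ?case .
  qed
qed

lemma powr_block_step:
  fixes c \<gamma> :: real
  assumes "c > 1" "0 < \<gamma>" "\<gamma> \<le> 1"
  shows "\<gamma> * c powr (\<gamma> - 1) \<le> c powr \<gamma> - (c - 1) powr \<gamma>"
proof -
  have "\<exists>z. c - 1 < z \<and> z < c \<and> c powr \<gamma> - (c - 1) powr \<gamma> = (c - (c - 1)) * (\<gamma> * z powr (\<gamma> - 1))"
    using assms by (intro MVT2) (auto intro!: derivative_eq_intros)
  then obtain z where z: "c - 1 < z" "z < c" "c powr \<gamma> - (c - 1) powr \<gamma> = \<gamma> * z powr (\<gamma> - 1)" by auto
  have "c powr (\<gamma> - 1) \<le> z powr (\<gamma> - 1)" using z assms by (intro powr_mono2') auto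
  then show ?thesis using z assms by simp
qed

text \<open>The same telescoping with the increment of \<open>ell b powr \<gamma>\<close> instead of
  that of the logarithm; the loss 1 / \<gamma> is the constant of integrating u powr (\<gamma> -
  1).\<close>

lemma sum_primes_ell_powr_le:
  assumes "1 \<le> b" "0 < \<gamma>" "\<gamma> \<le> 1"
  shows "(\<Sum>p\<in>primes_in 1 b. ell p powr \<gamma> / real p) \<le> 20 / \<gamma> * ell b powr \<gamma>"
proof -
  have block: "(\<Sum>p\<in>primes_in (b / exp 1) b. ell p powr \<gamma> / real p) \<le> 20 * ell b powr (\<gamma> - 1)" if "b \<ge> 1" for b :: real
  proof -
    have "(\<Sum>p\<in>primes_in (b / exp 1) b. ell p powr \<gamma> / real p) \<le> (\<Sum>p\<in>primes_in (b / exp 1) b. ell b powr \<gamma> * (1 / real p))"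
    proof (rule sum_mono)
      fix p assume "p \<in> primes_in (b / exp 1) b"
      then have "prime p" "real p \<le> b" by (auto simp: primes_in_def)
      then have "ell p powr \<gamma> \<le> ell b powr \<gamma>"
        using assms prime_ge_1_nat[of p] by (intro powr_mono2) (auto)
      then show "ell p powr \<gamma> / real p \<le> ell b powr \<gamma> * (1 / real p)" by (simp add: divide_right_mono)
    qed
    also have "\<dots> = ell b powr \<gamma> * (\<Sum>p\<in>primes_in (b / exp 1) b. 1 / real p)" by (simp add: sum_distrib_left)
    also have "\<dots> \<le> ell b powr \<gamma> * (20 / ell b)" using that by (intro mult_left_mono sum_recip_primes_block) auto
    also have "\<dots> = 20 * ell b powr (\<gamma> - 1)" using that ln_ge_zero[of b] by (simp add: powr_diff)
    finally show ?thesis .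
  qed
  have "(0::real) < 1" by simp
  from this \<open>1 \<le> b\<close> show ?thesis
  proof (induction rule: real_block_induct)
    case (base b)
    have lb: "ln b \<ge> 0" using base by simp
    have "(\<Sum>p\<in>primes_in 1 b. ell p powr \<gamma> / real p) \<le> (\<Sum>p\<in>primes_in (b / exp 1) b. ell p powr \<gamma> / real p)"
      using base by (intro sum_mono2 primes_in_mono) (auto simp: field_simps)
    also have "\<dots> \<le> 20 * ell b powr (\<gamma> - 1)" using block base by simp
    also have "\<dots> \<le> 20 / \<gamma> * ell b powr \<gamma>"
      using assms lb by (intro mult_mono powr_mono) (auto simp: field_simps)
    finally show ?case .
  next
    case (step b)
    have b0: "b > 1" using step exp_gt_one[of "1::real"] by linarith
    have b1: "b / exp 1 \<le> b" "b > 0" "1 \<le> b / exp 1" "b > 1"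
      using div_exp_le[of b] b0 step by (auto simp: le_divide_eq)
    have lb: "ln b > 1"
      using step b1 by (subst ln_exp[symmetric], subst ln_less_cancel_iff) auto
    have e: "ell (b / exp 1) = ell b - 1" using b1 by (simp add: ln_div)
    have "(\<Sum>p\<in>primes_in 1 b. ell p powr \<gamma> / real p) = (\<Sum>p\<in>primes_in 1 (b/exp 1). ell p powr \<gamma> / real p) + (\<Sum>p\<in>primes_in (b/exp 1) b. ell p powr \<gamma> / real p)"
      using b1 by (intro sum_primes_in_split)
    also have "\<dots> \<le> 20 / \<gamma> * ell (b/exp 1) powr \<gamma> + 20 * ell b powr (\<gamma> - 1)"
      using step b1 block by (intro add_mono) auto
    also have "\<dots> \<le> 20 / \<gamma> * ell b powr \<gamma>"
    proof -
      have "\<gamma> * ell b powr (\<gamma> - 1) \<le> ell b powr \<gamma> - (ell b - 1) powr \<gamma>"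
        using lb assms by (intro powr_block_step) auto
      then have "20 / \<gamma> * (\<gamma> * ell b powr (\<gamma> - 1)) \<le> 20 / \<gamma> * (ell b powr \<gamma> - (ell b - 1) powr \<gamma>)"
        using assms by (intro mult_left_mono) auto
      also have "20 / \<gamma> * (\<gamma> * ell b powr (\<gamma> - 1)) = 20 * ell b powr (\<gamma> - 1)" using assms by simp
      finally show ?thesis unfolding e by (simp add: right_diff_distrib)
    qed
    finally show ?case .
  qed
qed

text \<open>Increment of the potential 100 * sqrt L that telescopes the sum over large primes; 2/5
  is the block constant 40 divided by 100.\<close>

lemma sqrt_block_step:
  assumes "L \<ge> (2::real)"
  shows "40 / sqrt (L - 1) + 100 * sqrt (L - 1) \<le> 100 * sqrt L"
proof -
  define a where "a = sqrt (L - 1)"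
  have a: "a \<ge> 1" "a^2 = L - 1" using assms by (auto simp: a_def)
  have "sqrt L \<ge> a + 2/5 / a"
  proof (rule real_le_rsqrt)
    have "a \<noteq> 0" using a by auto
    then have "(a + 2/5/a)^2 = a^2 + 4/5 + 4/25 / a^2" by (simp add: power2_eq_square field_simps)
    also have "4/25 / a^2 \<le> 4/25 / 1" using a one_le_power[of a 2] by (intro divide_left_mono) auto
    also have "a^2 + 4/5 + 4/25 / 1 \<le> a^2 + (1::real)" by simp
    finally show "(a + 2/5/a)^2 \<le> L" using a by simp
  qed
  then show ?thesis unfolding a_def by (simp add: field_simps)
qed

text \<open>Here X / p can be small, so \<open>ell (X / p)\<close> alone gives no saving; the saving
  is that each block of primes above sqrt X has weight O(1 / ell X). Sorted by the size of X / p,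
  the blocks contribute like the sum of j powr (-1/2) over j up to ell X, divided by ell X, hence
  O(1 / sqrt (ell X)).\<close>

lemma sum_primes_top_le:
  assumes "X \<ge> 1"
  shows "(\<Sum>p\<in>primes_in (sqrt X) X. 1 / (real p * sqrt (ell (X / p)))) \<le> 100 / sqrt (ell X)"
proof -
  have lX: "ln X \<ge> 0" using assms by simp
  have sX: "1 \<le> sqrt X" "sqrt X \<le> X" using assms by (auto intro: real_le_lsqrt simp: self_le_power)
  have block: "(\<Sum>p\<in>primes_in (c / exp 1) c. 1 / real p) \<le> 40 / ell X" if "sqrt X \<le> c" for c
  proof -
    have "ln (sqrt X) \<le> ln c" using that sX by (subst ln_le_cancel_iff) linarith+
    then have "ell X \<le> 2 * ell c" using assms by (simp add: ln_sqrt)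
    moreover from this have "ell c > 0" using lX by argo
    ultimately have "20 / ell c \<le> 40 / ell X" using lX by (simp add: field_simps)
    then show ?thesis using sum_recip_primes_block[of c] that sX by simp
  qed
  \<comment> \<open>Induction on d, the lower end X / d of the range moving down from X; d = sqrt X
    gives the whole range.\<close>
  have main: "sqrt X \<le> X / d \<Longrightarrow> (\<Sum>p\<in>primes_in (X/d) X. 1 / (real p * sqrt (ell (X / p)))) \<le> 100 * sqrt (ell d) / ell X"
    if "1 \<le> d" for d
  proof -
    have "(0::real) < 1" by simp
    from this \<open>1 \<le> d\<close> show "sqrt X \<le> X / d \<Longrightarrow> ?thesis"
    proof (induction rule: real_block_induct)
      case (base d)
      have ld: "ln d \<ge> 0" using base by simp
      have "(\<Sum>p\<in>primes_in (X/d) X. 1 / (real p * sqrt (ell (X / p)))) \<le> (\<Sum>p\<in>primes_in (X/d) X. 1 / real p)"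
      proof (rule sum_mono)
        fix p assume "p \<in> primes_in (X/d) X"
        then have "prime p" "real p \<le> X" by (auto simp: primes_in_def)
        then have "X / p \<ge> 1" using prime_gt_0_nat[of p] by simp
        then have "sqrt (ell (X/p)) \<ge> 1" by simp
        then have "real p * 1 \<le> real p * sqrt (ell (X/p))" by (intro mult_left_mono) auto
        then show "1 / (real p * sqrt (ell (X / p))) \<le> 1 / real p"
          using prime_gt_0_nat[OF \<open>prime p\<close>] by (intro divide_left_mono) auto
      qed
      also have "\<dots> \<le> (\<Sum>p\<in>primes_in (X/exp 1) X. 1 / real p)"
        using base assms by (intro sum_mono2 primes_in_mono) (auto simp: field_simps)
      also have "\<dots> \<le> 40 / ell X" using block sX by simp
      also have "\<dots> \<le> 100 * sqrt (ell d) / ell X"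
      proof -
        have "sqrt (ell d) \<ge> 1" using ld by simp
        then have "40 \<le> 100 * sqrt (ell d)" by linarith
        then show ?thesis using lX by (intro divide_right_mono) auto
      qed
      finally show ?case .
    next
      case (step d)
      have d0: "d > 1" using step exp_gt_one[of "1::real"] by linarith
      have d: "1 \<le> d / exp 1" "d > 0" "d / exp 1 \<le> d"
        using div_exp_le[of d] d0 step by (auto simp: le_divide_eq)
      have le1: "X / d \<le> X / (d / exp 1)" using d assms by (simp add: field_simps)
      have le2: "X / (d / exp 1) \<le> X" using d assms by (auto simp: field_simps)
      have ld: "ln d > 1" using step d by (subst ln_exp[symmetric], subst ln_less_cancel_iff) auto
      have e: "ell (d / exp 1) = ell d - 1" using d by (simp add: ln_div)
      have "(\<Sum>p\<in>primes_in (X/d) (X / (d / exp 1)). 1 / (real p * sqrt (ell (X / p)))) \<le>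
            (\<Sum>p\<in>primes_in (X/d) (X / (d / exp 1)). 1 / sqrt (ell d - 1) * (1 / real p))"
      proof (rule sum_mono)
        fix p assume "p \<in> primes_in (X/d) (X / (d / exp 1))"
        then have p: "prime p" "real p \<le> X / (d / exp 1)" by (auto simp: primes_in_def)
        have p0: "real p > 0" using p prime_gt_0_nat by simp
        have "d / exp 1 \<le> X / p" using p p0 d by (simp add: field_simps)
        then have "ln (d / exp 1) \<le> ln (X / p)" using d p0 assms by (subst ln_le_cancel_iff) auto
        then have "ell (d / exp 1) \<le> ell (X/p)" by simp
        then have "sqrt (ell d - 1) \<le> sqrt (ell (X/p))" unfolding e by simp
        then have "real p * sqrt (ell d - 1) \<le> real p * sqrt (ell (X/p))" by (intro mult_left_mono) auto
        then have "1 / (real p * sqrt (ell (X / p))) \<le> 1 / (real p * sqrt (ell d - 1))"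
        proof (rule divide_left_mono)
          have "0 < real p * sqrt (ell d - 1)" using p0 ld by simp
          then show "0 < real p * sqrt (ell (X / p)) * (real p * sqrt (ell d - 1))"
            using \<open>real p * sqrt (ell d - 1) \<le> real p * sqrt (ell (X/p))\<close> by (metis mult_pos_pos less_le_trans)
        qed (use \<open>real p * sqrt (ell d - 1) \<le> real p * sqrt (ell (X/p))\<close> in simp_all)
        then show "1 / (real p * sqrt (ell (X / p))) \<le> 1 / sqrt (ell d - 1) * (1 / real p)" by (simp add: mult.commute)
      qed
      also have "\<dots> = 1 / sqrt (ell d - 1) * (\<Sum>p\<in>primes_in (X/d) (X / (d / exp 1)). 1 / real p)"
        by (simp add: sum_distrib_left)
      also have "X / d = (X / (d / exp 1)) / exp 1" by simp
      also have "1 / sqrt (ell d - 1) * (\<Sum>p\<in>primes_in ((X / (d / exp 1)) / exp 1) (X / (d / exp 1)). 1 / real p)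
        \<le> 1 / sqrt (ell d - 1) * (40 / ell X)"
        using step le1 ld by (intro mult_left_mono block) auto
      finally have 1: "(\<Sum>p\<in>primes_in (X/d) (X / (d / exp 1)). 1 / (real p * sqrt (ell (X / p)))) \<le> 40 / sqrt (ell d - 1) / ell X"
        by simp
      have "(\<Sum>p\<in>primes_in (X/d) X. 1 / (real p * sqrt (ell (X / p)))) =
         (\<Sum>p\<in>primes_in (X/d) (X / (d / exp 1)). 1 / (real p * sqrt (ell (X / p)))) +
         (\<Sum>p\<in>primes_in (X / (d / exp 1)) X. 1 / (real p * sqrt (ell (X / p))))"
        using le1 le2 by (intro sum_primes_in_split)
      also have "\<dots> \<le> 40 / sqrt (ell d - 1) / ell X + 100 * sqrt (ell (d / exp 1)) / ell X"
        using 1 step le1 by (intro add_mono) auto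
      also have "\<dots> = (40 / sqrt (ell d - 1) + 100 * sqrt (ell d - 1)) / ell X"
        unfolding e by (simp add: add_divide_distrib)
      also have "\<dots> \<le> 100 * sqrt (ell d) / ell X"
        using ld lX sqrt_block_step[of "ell d"] by (intro divide_right_mono) auto
      finally show ?case .
    qed
  qed
  have "(\<Sum>p\<in>primes_in (sqrt X) X. 1 / (real p * sqrt (ell (X / p)))) \<le> 100 * sqrt (ell (sqrt X)) / ell X"
    using main[of "sqrt X"] sX by (simp add: real_div_sqrt)
  also have "\<dots> \<le> 100 * sqrt (ell X) / ell X"
    using lX assms by (intro divide_right_mono mult_left_mono) (auto simp: ln_sqrt)
  also have "\<dots> = 100 / sqrt (ell X)"
  proof -
    have "sqrt (ell X) > 0" "ell X = sqrt (ell X) * sqrt (ell X)" using lX by simp_all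
    then show ?thesis by (metis divide_divide_eq_left' less_irrefl nonzero_mult_div_cancel_right)
  qed
  finally show ?thesis .
qed

section \<open>Mean values of multiplicative functions close to one\<close>

text \<open>This sum appears when the error bound is inserted into the recursion. For p <= sqrt X,
  \<open>ell (X / p)\<close> is at least half of \<open>ell X\<close>, and the power sum with
  exponent 1/4 applies, with constant 120 = 3/2 * 20 * 4 where (3/2)^2 >= 2. For p > sqrt X,
  \<open>ell p\<close> is replaced by \<open>ell y\<close>, and the sum over large primes
  contributes 100.\<close>

lemma sum_primes_weighted_le:
  assumes "1 \<le> y" "y \<le> X"
  shows "(\<Sum>p\<in>primes_in 1 y. ell p powr (1/4) / (real p * sqrt (ell (X / p)))) \<le> 220 * ell y powr (1/4) / sqrt (ell X)"
proof -
  have X: "X \<ge> 1" "ln X \<ge> 0" and ly: "ln y \<ge> 0" using assms by auto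
  let ?t = "\<lambda>p::nat. ell p powr (1/4) / (real p * sqrt (ell (X / p)))"
  let ?A = "{p\<in>primes_in 1 y. real p \<le> sqrt X}" and ?B = "{p\<in>primes_in 1 y. \<not> real p \<le> sqrt X}"
  have "(\<Sum>p\<in>?A. ?t p) \<le> (\<Sum>p\<in>?A. 3/2 / sqrt (ell X) * (ell p powr (1/4) / real p))"
  proof (rule sum_mono)
    fix p assume "p \<in> ?A"
    then have p: "1 < real p" "real p \<le> sqrt X" by (auto simp: primes_in_def)
    have "sqrt X = X / sqrt X" using X by (simp add: real_div_sqrt)
    also have "\<dots> \<le> X / p" using p X by (intro divide_left_mono) auto
    finally have le: "sqrt X \<le> X / p" .
    have "ln (sqrt X) \<le> ln (X / p)" using le X p by (subst ln_le_cancel_iff) auto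
    then have "ell X \<le> 2 * ell (X/p)" using X by (simp add: ln_sqrt)
    also have "\<dots> \<le> (3/2)^2 * ell (X/p)"
    proof (rule mult_right_mono)
      show "0 \<le> ell (X/p)" using \<open>ell X \<le> 2 * ell (X/p)\<close> X(2) by argo
    qed (simp add: power2_eq_square)
    finally have "sqrt (ell X) \<le> sqrt ((3/2)^2 * ell (X/p))" by (simp only: real_sqrt_le_iff)
    also have "\<dots> = 3/2 * sqrt (ell (X/p))" by (subst real_sqrt_mult) simp
    finally have 1: "sqrt (ell X) \<le> 3/2 * sqrt (ell (X/p))" .
    moreover have 2: "sqrt (ell X) > 0" using X(2) by simp
    ultimately have 3: "sqrt (ell (X/p)) > 0" by linarith
    have "1 / sqrt (ell (X/p)) \<le> 3/2 / sqrt (ell X)" using 1 2 3 by (simp add: field_simps)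
    then have "(ell p powr (1/4) / real p) * (1 / sqrt (ell (X/p))) \<le> (ell p powr (1/4) / real p) * (3/2 / sqrt (ell X))"
      by (intro mult_left_mono) auto
    then show "?t p \<le> 3/2 / sqrt (ell X) * (ell p powr (1/4) / real p)" by (simp add: mult.commute)
  qed
  also have "\<dots> \<le> (\<Sum>p\<in>primes_in 1 y. 3/2 / sqrt (ell X) * (ell p powr (1/4) / real p))"
    using X by (intro sum_mono2) auto
  also have "\<dots> = 3/2 / sqrt (ell X) * (\<Sum>p\<in>primes_in 1 y. ell p powr (1/4) / real p)"
    by (simp add: sum_distrib_left)
  also have "\<dots> \<le> 3/2 / sqrt (ell X) * (20 / (1/4) * ell y powr (1/4))"
    using assms X by (intro mult_left_mono sum_primes_ell_powr_le) auto
  also have "\<dots> = 120 * ell y powr (1/4) / sqrt (ell X)" by simp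
  finally have A: "(\<Sum>p\<in>?A. ?t p) \<le> 120 * ell y powr (1/4) / sqrt (ell X)" .
  have "(\<Sum>p\<in>?B. ?t p) \<le> (\<Sum>p\<in>?B. ell y powr (1/4) * (1 / (real p * sqrt (ell (X / p)))))"
  proof (rule sum_mono)
    fix p assume "p \<in> ?B"
    then have p: "1 < real p" "real p \<le> y" by (auto simp: primes_in_def)
    have "1 \<le> X / p" using p assms by simp
    then have 0: "ln (X / p) \<ge> 0" by simp
    have "ell p powr (1/4) \<le> ell y powr (1/4)" using p by (intro powr_mono2) auto
    then have "ell p powr (1/4) * (1 / (real p * sqrt (ell (X / p)))) \<le> ell y powr (1/4) * (1 / (real p * sqrt (ell (X / p))))"
      using 0 by (intro mult_right_mono) auto
    then show "?t p \<le> ell y powr (1/4) * (1 / (real p * sqrt (ell (X / p))))" by simp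
  qed
  also have "\<dots> \<le> (\<Sum>p\<in>primes_in (sqrt X) X. ell y powr (1/4) * (1 / (real p * sqrt (ell (X / p)))))"
  proof (rule sum_mono2[OF finite_primes_in])
    fix p assume "p \<in> primes_in (sqrt X) X - ?B"
    then have "prime p" "real p \<le> X" by (auto simp: primes_in_def)
    then have "X / p \<ge> 1" using prime_gt_0_nat[of p] by simp
    then have "ln (X / p) \<ge> 0" by simp
    then show "0 \<le> ell y powr (1/4) * (1 / (real p * sqrt (ell (X / p))))" by simp
  qed (use assms in \<open>auto simp: primes_in_def\<close>)
  also have "\<dots> = ell y powr (1/4) * (\<Sum>p\<in>primes_in (sqrt X) X. 1 / (real p * sqrt (ell (X / p))))"
    by (simp add: sum_distrib_left)
  also have "\<dots> \<le> ell y powr (1/4) * (100 / sqrt (ell X))"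
    using X by (intro mult_left_mono sum_primes_top_le) auto
  finally have B: "(\<Sum>p\<in>?B. ?t p) \<le> 100 * ell y powr (1/4) / sqrt (ell X)" by (simp add: mult.commute)
  have "primes_in 1 y = ?A \<union> ?B" by blast
  moreover have "(\<Sum>p\<in>?A \<union> ?B. ?t p) = (\<Sum>p\<in>?A. ?t p) + (\<Sum>p\<in>?B. ?t p)"
    by (rule sum.union_disjoint) auto
  ultimately have "(\<Sum>p\<in>primes_in 1 y. ?t p) = (\<Sum>p\<in>?A. ?t p) + (\<Sum>p\<in>?B. ?t p)" by simp
  also have "\<dots> \<le> 120 * ell y powr (1/4) / sqrt (ell X) + 100 * ell y powr (1/4) / sqrt (ell X)"
    by (intro add_mono A B)
  finally show ?thesis by (simp flip: add_divide_distrib)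
qed

text \<open>Value at n of the strongly multiplicative function that agrees with f at primes up to y
  and equals 1 at larger primes: multiplicities do not enter.\<close>

definition smooth_part :: "(nat \<Rightarrow> complex) \<Rightarrow> nat \<Rightarrow> nat \<Rightarrow> complex" where
  "smooth_part f y n = (\<Prod>p | prime p \<and> p dvd n \<and> p \<le> y. f p)"

definition smooth_sum :: "(nat \<Rightarrow> complex) \<Rightarrow> nat \<Rightarrow> real \<Rightarrow> complex" where
  "smooth_sum f y X = (\<Sum>n | 1 \<le> n \<and> real n \<le> X. smooth_part f y n)"

definition euler_prod :: "(nat \<Rightarrow> complex) \<Rightarrow> nat \<Rightarrow> complex" where
  "euler_prod f y = (\<Prod>p | prime p \<and> p \<le> y. 1 + (f p - 1) / of_nat p)"

definition mean_error :: "(nat \<Rightarrow> complex) \<Rightarrow> nat \<Rightarrow> real \<Rightarrow> complex" where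
  "mean_error f y X = smooth_sum f y X - of_real X * euler_prod f y"

section \<open>Recursion over the largest prime\<close>

lemma finite_nat_le_real [simp, intro]: "finite {n::nat. 1 \<le> n \<and> real n \<le> X}"
  by (rule finite_subset[of _ "{..nat \<lfloor>X\<rfloor>}"]) (auto simp: le_nat_iff le_floor_iff)

lemma primes_le_Suc:
  "{p. prime p \<and> P p \<and> p \<le> Suc y} =
    (if prime (Suc y) \<and> P (Suc y) then insert (Suc y) {p. prime p \<and> P p \<and> p \<le> y} else {p. prime p \<and> P p \<and> p \<le> y})"
  by (auto simp: le_Suc_eq)

lemma smooth_part_Suc:
  "smooth_part f (Suc y) n = (if prime (Suc y) \<and> Suc y dvd n then f (Suc y) else 1) * smooth_part f y n"
  unfolding smooth_part_def primes_le_Suc[of "\<lambda>p. p dvd n"] by auto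

lemma euler_prod_Suc:
  "euler_prod f (Suc y) = (if prime (Suc y) then 1 + (f (Suc y) - 1) / of_nat (Suc y) else 1) * euler_prod f y"
  unfolding euler_prod_def using primes_le_Suc[of "\<lambda>p. True" y] by auto

lemma smooth_part_mult_prime:
  assumes "prime p" "y < p"
  shows "smooth_part f y (p * m) = smooth_part f y m"
proof -
  have "q dvd p * m \<longleftrightarrow> q dvd m" if "prime q" "q \<le> y" for q
    using assms that by (auto simp: prime_dvd_mult_iff dest: primes_dvd_imp_eq)
  then have "{q. prime q \<and> q dvd p * m \<and> q \<le> y} = {q. prime q \<and> q dvd m \<and> q \<le> y}" by blast
  then show ?thesis unfolding smooth_part_def by simp
qed

text \<open>Raising y to a prime p changes the term at n only if p divides n, and then by the factor
  f p. Writing n = p m leaves all m <= X / p, multiples of p included, because the smooth part up to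
  y does not see p; so a single extra term suffices and no powers of p occur.\<close>

lemma smooth_sum_Suc:
  assumes "prime (Suc y)"
  shows "smooth_sum f (Suc y) X = smooth_sum f y X + (f (Suc y) - 1) * smooth_sum f y (X / Suc y)"
proof -
  let ?A = "{n::nat. 1 \<le> n \<and> real n \<le> X}" and ?p = "Suc y"
  have "smooth_sum f ?p X = (\<Sum>n\<in>?A. smooth_part f y n + (if ?p dvd n then (f ?p - 1) * smooth_part f y n else 0))"
    unfolding smooth_sum_def using assms by (intro sum.cong) (auto simp: smooth_part_Suc algebra_simps)
  also have "\<dots> = smooth_sum f y X + (\<Sum>n\<in>{n\<in>?A. ?p dvd n}. (f ?p - 1) * smooth_part f y n)"
    by (simp only: sum.distrib smooth_sum_def sum.inter_filter[OF finite_nat_le_real])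
  also have "(\<Sum>n\<in>{n\<in>?A. ?p dvd n}. (f ?p - 1) * smooth_part f y n) =
      (\<Sum>m | 1 \<le> m \<and> real m \<le> X / ?p. (f ?p - 1) * smooth_part f y (?p * m))"
  proof (rule sum.reindex_bij_witness[of _ "\<lambda>m. ?p * m" "\<lambda>n. n div ?p"])
    fix n assume n: "n \<in> {n\<in>?A. ?p dvd n}"
    then obtain m where m: "n = ?p * m" by blast
    show "?p * (n div ?p) = n" using m by (simp del: mult_Suc)
    have "real ?p * real m \<le> X" using n m by (simp del: of_nat_Suc flip: of_nat_mult)
    then have "real m \<le> X / ?p" by (simp add: field_simps)
    then show "n div ?p \<in> {m. 1 \<le> m \<and> real m \<le> X / ?p}"
      using n m by (cases "m = 0") (auto simp del: of_nat_Suc mult_Suc)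
    show "(f ?p - 1) * smooth_part f y (?p * (n div ?p)) = (f ?p - 1) * smooth_part f y n" using m by (simp del: mult_Suc)
  next
    fix m assume m: "m \<in> {m. 1 \<le> m \<and> real m \<le> X / ?p}"
    then have "real m * real ?p \<le> X" by (simp add: field_simps)
    then have "real (?p * m) \<le> X" by (simp add: mult.commute algebra_simps)
    then show "?p * m \<in> {n\<in>?A. ?p dvd n}" using m by (auto simp del: mult_Suc of_nat_Suc of_nat_mult)
  qed (simp del: mult_Suc)
  also have "\<dots> = (f ?p - 1) * smooth_sum f y (X / ?p)"
    unfolding smooth_sum_def sum_distrib_left using assms
    by (intro sum.cong) (simp_all add: smooth_part_mult_prime del: mult_Suc)
  finally show ?thesis .
qed

text \<open>The main term X * \<open>euler_prod f y\<close> obeys the same recursion as the sum,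
  exactly: this is what the factor 1 + (f p - 1) / p achieves. Hence the difference obeys it too,
  with no new error.\<close>

lemma mean_error_Suc:
  "mean_error f (Suc y) X = mean_error f y X + (if prime (Suc y) then (f (Suc y) - 1) * mean_error f y (X / Suc y) else 0)"
proof (cases "prime (Suc y)")
  case True
  have "mean_error f (Suc y) X = smooth_sum f y X + (f (Suc y) - 1) * smooth_sum f y (X / Suc y)
     - of_real X * ((1 + (f (Suc y) - 1) / of_nat (Suc y)) * euler_prod f y)"
    unfolding mean_error_def euler_prod_Suc smooth_sum_Suc[OF True] using True by simp
  also have "\<dots> = mean_error f y X + (f (Suc y) - 1) * mean_error f y (X / Suc y)"
    unfolding mean_error_def by (simp add: ring_distribs del: of_nat_Suc)
  finally show ?thesis using True by simp
next
  case False
  then have "smooth_sum f (Suc y) X = smooth_sum f y X" unfolding smooth_sum_def by (simp add: smooth_part_Suc)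
  then show ?thesis using False by (simp add: mean_error_def euler_prod_Suc)
qed

lemma mean_error_Buchstab:
  "mean_error f y X = mean_error f 1 X + (\<Sum>p\<in>primes_in 1 (real y). (f p - 1) * mean_error f (p - 1) (X / p))"
  if "y \<ge> 1"
  using that
proof (induction y rule: dec_induct)
  case base
  have "primes_in 1 1 = {}" by (auto simp: primes_in_def)
  then show ?case by simp
next
  case (step y)
  have "primes_in 1 (real (Suc y)) = (if prime (Suc y) then insert (Suc y) (primes_in 1 (real y)) else primes_in 1 (real y))"
  proof -
    have *: "primes_in 1 (real z) = {p. prime p \<and> 1 < p \<and> p \<le> z}" for z
      by (simp only: primes_in_def of_nat_le_iff) simp
    show ?thesis unfolding * primes_le_Suc[of "\<lambda>p. 1 < p" y] using step by simp
  qed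
  moreover have "Suc y \<notin> primes_in 1 (real y)" by (auto simp: primes_in_def)
  ultimately show ?case using step by (simp add: mean_error_Suc del: of_nat_Suc)
qed

section \<open>Error bound for functions close to one at all primes\<close>

lemma card_nat_le_real: "X \<ge> 0 \<Longrightarrow> card {n::nat. 1 \<le> n \<and> real n \<le> X} = nat \<lfloor>X\<rfloor>"
proof -
  assume "X \<ge> 0"
  then have "{n::nat. 1 \<le> n \<and> real n \<le> X} = {1..nat \<lfloor>X\<rfloor>}" by (auto simp: le_nat_iff le_floor_iff)
  then show ?thesis by simp
qed

lemma no_primes_le_1: "{p::nat. prime p \<and> p \<le> 1} = {}" "{p::nat. prime p \<and> p dvd n \<and> p \<le> 1} = {}"
proof -
  have "\<not> (prime p \<and> p \<le> 1)" for p :: nat using prime_ge_2_nat[of p] by linarith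
  then show "{p::nat. prime p \<and> p \<le> 1} = {}" "{p::nat. prime p \<and> p dvd n \<and> p \<le> 1} = {}" by blast+
qed

lemma norm_mean_error_1: "X \<ge> 0 \<Longrightarrow> norm (mean_error f 1 X) \<le> 1"
proof -
  assume X: "X \<ge> 0"
  have "mean_error f 1 X = of_real (real (nat \<lfloor>X\<rfloor>) - X)"
    unfolding mean_error_def smooth_sum_def euler_prod_def smooth_part_def no_primes_le_1
    using card_nat_le_real[OF X] by simp
  then have "norm (mean_error f 1 X) = \<bar>real (nat \<lfloor>X\<rfloor>) - X\<bar>" by (simp only: norm_of_real)
  then show ?thesis using X by linarith
qed

text \<open>The bound 1 / 10000 secures two things: 7480 * \<rho> <= 1, which closes the induction
  for the error, and 40 * \<rho> <= 1/4, which lets the Euler product fall at most like a fourth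
  root of a ratio of logarithms.\<close>

locale near_one =
  fixes f :: "nat \<Rightarrow> complex" and \<rho> :: real
  assumes rho: "0 \<le> \<rho>" "\<rho> \<le> 1 / 10000"
    and near: "\<And>p. prime p \<Longrightarrow> norm (f p - 1) \<le> \<rho>"
begin

abbreviation "G \<equiv> euler_prod f"

text \<open>The exponents make the shape reproduce itself. In the recursion the root gives
  \<open>ell p powr (1/2)\<close> and the comparison of Euler products costs
  \<open>(ell y / ell p) powr (1/4)\<close>; the surviving positive exponent 1/4 makes the sum over
  p of size \<open>ell y powr (1/4)\<close>, and together these restore
  \<open>ell y powr (1/2)\<close>.\<close>

definition U :: "nat \<Rightarrow> real \<Rightarrow> real" where
  "U y X = X * norm (G y) * sqrt (ell y / ell X)"

text \<open>Each factor beyond y' has modulus at least 1 - \<rho> / p >= exp (- 2 \<rho> / p), and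
  the sum of 1 / p over the range is at most 20 * (1 + ln R), R being the ratio of logarithms. The
  factor 2 absorbs exp (1/4).\<close>

lemma euler_prod_ratio:
  assumes "1 \<le> y'" "y' \<le> y"
  shows "norm (G y') \<le> 2 * norm (G y) * (ell y / ell y') powr (1/4)"
proof -
  define R where "R = ell y / ell y'"
  have R: "R > 0" using assms unfolding R_def by (intro divide_pos_pos add_pos_nonneg) auto
  have eq: "{p. prime p \<and> p \<le> y} = {p. prime p \<and> p \<le> y'} \<union> primes_in (real y') (real y)"
    using assms by (auto simp: primes_in_def)
  have "G y = G y' * (\<Prod>p\<in>primes_in (real y') (real y). 1 + (f p - 1) / of_nat p)"
    unfolding euler_prod_def eq by (rule prod.union_disjoint) (auto simp: primes_in_def)
  then have n: "norm (G y) = norm (G y') * (\<Prod>p\<in>primes_in (real y') (real y). norm (1 + (f p - 1) / of_nat p))"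
    by (simp add: norm_mult prod_norm)
  have "(\<Prod>p\<in>primes_in (real y') (real y). exp (- 2 * \<rho> * (1 / real p))) \<le> (\<Prod>p\<in>primes_in (real y') (real y). norm (1 + (f p - 1) / of_nat p))"
  proof (rule prod_mono)
    fix p assume "p \<in> primes_in (real y') (real y)"
    then have p: "prime p" by (auto simp: primes_in_def)
    have p1: "real p \<ge> 1" using prime_ge_1_nat[OF p] by simp
    define x where "x = \<rho> / p"
    have x: "0 \<le> x" "x \<le> 1/2" using rho p1 by (auto simp: x_def field_simps)
    have "1 \<le> (1 - x) * (1 + 2 * x)" using x mult_nonneg_nonneg[of x "1 - 2*x"] by (simp add: algebra_simps)
    also have "\<dots> \<le> (1 - x) * exp (2 * x)" using x exp_ge_add_one_self[of "2*x"] by (intro mult_left_mono) auto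
    finally have "exp (- 2 * x) \<le> 1 - x" by (simp add: exp_minus field_simps)
    also have "norm ((f p - 1) / of_nat p) \<le> x" using near[OF p] p1 by (simp add: x_def norm_divide divide_right_mono)
    then have "1 - x \<le> norm (1 + (f p - 1) / of_nat p)"
      using norm_diff_ineq[of 1 "(f p - 1) / of_nat p"] by simp
    finally show "0 \<le> exp (- 2 * \<rho> * (1 / real p)) \<and> exp (- 2 * \<rho> * (1 / real p)) \<le> norm (1 + (f p - 1) / of_nat p)"
      by (simp add: x_def)
  qed
  also have "(\<Prod>p\<in>primes_in (real y') (real y). exp (- 2 * \<rho> * (1 / real p))) = exp (- 2 * \<rho> * (\<Sum>p\<in>primes_in (real y') (real y). 1 / real p))"
    by (simp only: exp_sum[OF finite_primes_in] sum_distrib_left)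
  finally have 1: "exp (- 2 * \<rho> * (\<Sum>p\<in>primes_in (real y') (real y). 1 / real p)) \<le> (\<Prod>p\<in>primes_in (real y') (real y). norm (1 + (f p - 1) / of_nat p))" .
  have s0: "(\<Sum>p\<in>primes_in (real y') (real y). 1 / real p) \<ge> 0" by (intro sum_nonneg) auto
  have s1: "(\<Sum>p\<in>primes_in (real y') (real y). 1 / real p) \<le> 20 * (1 + ln R)"
    unfolding R_def using assms by (intro sum_recip_primes_le) auto
  have "2 * \<rho> * (\<Sum>p\<in>primes_in (real y') (real y). 1 / real p) \<le> 2 * (1/10000) * (20 * (1 + ln R))"
    using rho s0 s1 by (intro mult_mono) auto
  also have "\<dots> \<le> 1/4 * (1 + ln R)" using s0 s1 by simp
  finally have "exp (- (1/4 * (1 + ln R))) \<le> exp (- 2 * \<rho> * (\<Sum>p\<in>primes_in (real y') (real y). 1 / real p))" by simp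
  also have "exp (- (1/4 * (1 + ln R))) = exp (-1/4) / R powr (1/4)"
  proof -
    have "R powr (1/4) = exp (1/4 * ln R)" using R by (simp add: powr_def)
    moreover have "- (1/4 * (1 + ln R)) = -1/4 - 1/4 * ln R" by (simp add: field_simps)
    ultimately show ?thesis by (simp only: exp_diff)
  qed
  finally have "exp (-1/4) / R powr (1/4) \<le> (\<Prod>p\<in>primes_in (real y') (real y). norm (1 + (f p - 1) / of_nat p))"
    using 1 by simp
  moreover have "1/2 \<le> exp (-1/4 :: real)" using exp_ge_add_one_self[of "-1/4::real"] by simp
  then have "1/2 / R powr (1/4) \<le> exp (-1/4) / R powr (1/4)" by (intro divide_right_mono) auto
  ultimately have "1/2 / R powr (1/4) \<le> (\<Prod>p\<in>primes_in (real y') (real y). norm (1 + (f p - 1) / of_nat p))" by linarith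
  then have "norm (G y') * (1/2 / R powr (1/4)) \<le> norm (G y)" unfolding n by (intro mult_left_mono) auto
  moreover have "R powr (1/4) > 0" using R by simp
  ultimately have "norm (G y') \<le> 2 * norm (G y) * R powr (1/4)" by (simp add: field_simps)
  then show ?thesis unfolding R_def .
qed

lemma euler_prod_lower:
  assumes "1 \<le> y" shows "1 \<le> 2 * norm (G y) * ell y powr (1/4)"
proof -
  have "G 1 = 1" unfolding euler_prod_def no_primes_le_1 by simp
  then show ?thesis using euler_prod_ratio[of 1 y] assms by simp
qed

lemma euler_prod_nonzero: "1 \<le> y \<Longrightarrow> G y \<noteq> 0"
  using euler_prod_lower[of y] by auto

lemma ell_le: "X \<ge> 1 \<Longrightarrow> ell X \<le> X" for X :: real
  using ln_add_one_self_le_self[of "X - 1"] by simp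

text \<open>Allows the error 1 of the starting value y = 1 to be absorbed into
  \<open>U\<close>.\<close>

lemma U_lower:
  assumes "1 \<le> y" "1 \<le> X" shows "1 \<le> 2 * U y X"
proof -
  have ly: "ell y \<ge> 1" and lX: "ell X \<ge> 1" using assms by auto
  have "ell y powr (1/4) \<le> ell y powr (1/2)" using ly by (intro powr_mono) auto
  then have 1: "ell y powr (1/4) \<le> sqrt (ell y)" using ly by (simp add: powr_half_sqrt)
  have "sqrt (ell X) \<le> ell X" using lX by (intro real_le_lsqrt) (auto intro: self_le_power)
  then have 2: "sqrt (ell X) \<le> X" using ell_le[OF assms(2)] by linarith
  have 3: "sqrt (ell X) > 0" using lX by simp
  have "1 \<le> 2 * norm (G y) * ell y powr (1/4)" using euler_prod_lower assms by blast
  also have "\<dots> \<le> 2 * norm (G y) * sqrt (ell y)" using 1 by (intro mult_left_mono) auto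
  finally have "1 * 1 \<le> (2 * norm (G y) * sqrt (ell y)) * (X / sqrt (ell X))"
    using 2 3 by (intro mult_mono) auto
  then show ?thesis unfolding U_def real_sqrt_divide by (simp add: mult_ac)
qed

text \<open>One round of the recursion turns the constant 17 of the induction hypothesis into 7480 *
  \<rho>: 34 = 17 * 2 with the 2 from the ratio of Euler products, and 7480 = 34 * 220.\<close>

lemma norm_mean_error_step:
  assumes y: "1 \<le> y" "real y \<le> X"
    and IH: "\<And>y' X. 1 \<le> y' \<Longrightarrow> y' < y \<Longrightarrow> 1 \<le> X \<Longrightarrow> norm (mean_error f y' X) \<le> 17 * U y' X"
  shows "norm (mean_error f y X) \<le> 1 + 7480 * \<rho> * U y X"
proof -
  have X: "X \<ge> 1" using y by linarith
  have "norm (mean_error f y X) \<le> norm (mean_error f 1 X) + norm (\<Sum>p\<in>primes_in 1 (real y). (f p - 1) * mean_error f (p - 1) (X / p))"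
    unfolding mean_error_Buchstab[OF y(1)] by (rule norm_triangle_ineq)
  also have "\<dots> \<le> 1 + (\<Sum>p\<in>primes_in 1 (real y). norm ((f p - 1) * mean_error f (p - 1) (X / p)))"
    using norm_mean_error_1[of X f] X by (intro add_mono norm_sum) auto
  also have "(\<Sum>p\<in>primes_in 1 (real y). norm ((f p - 1) * mean_error f (p - 1) (X / p))) \<le>
     (\<Sum>p\<in>primes_in 1 (real y). 34 * \<rho> * X * norm (G y) * ell y powr (1/4) * (ell p powr (1/4) / (real p * sqrt (ell (X / p)))))"
  proof (rule sum_mono)
    fix p assume "p \<in> primes_in 1 (real y)"
    then have p: "prime p" "p \<le> y" "p > 1" by (auto simp: primes_in_def)
    have Xp: "X / p \<ge> 1" using p y by (simp add: field_simps)
    define L where "L = ell (p - 1)"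
    have L: "L \<ge> 1" using p by (simp add: L_def)
    have Lp: "L \<le> ell p" using p by (simp add: L_def)
    have lXp: "ell (X / p) \<ge> 1" using Xp by simp
    have ly: "ell y \<ge> 1" using y by simp
    have "norm (mean_error f (p - 1) (X / p)) \<le> 17 * U (p - 1) (X / p)" using p Xp by (intro IH) auto
    also have "\<dots> = 17 * (X / p * sqrt (L / ell (X/p))) * norm (G (p - 1))" by (simp add: U_def L_def)
    also have "\<dots> \<le> 17 * (X / p * sqrt (L / ell (X/p))) * (2 * norm (G y) * (ell y / L) powr (1/4))"
      unfolding L_def using p y X by (intro mult_left_mono euler_prod_ratio) auto
    also have "\<dots> = 34 * X * norm (G y) * ell y powr (1/4) * ((sqrt L / L powr (1/4)) / (p * sqrt (ell (X/p))))"
      using L ly by (simp add: real_sqrt_divide powr_divide mult_ac)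
    also have "sqrt L / L powr (1/4) = L powr (1/4)"
      using L by (simp add: powr_half_sqrt[symmetric] powr_diff[symmetric])
    also have "34 * X * norm (G y) * ell y powr (1/4) * (L powr (1/4) / (p * sqrt (ell (X/p)))) \<le>
       34 * X * norm (G y) * ell y powr (1/4) * (ell p powr (1/4) / (p * sqrt (ell (X/p))))"
      using L Lp X lXp by (intro mult_left_mono divide_right_mono powr_mono2 mult_nonneg_nonneg) auto
    finally have "norm (mean_error f (p - 1) (X / p)) \<le> 34 * X * norm (G y) * ell y powr (1/4) * (ell p powr (1/4) / (p * sqrt (ell (X/p))))" .
    then have "norm (f p - 1) * norm (mean_error f (p - 1) (X / p)) \<le> \<rho> * (34 * X * norm (G y) * ell y powr (1/4) * (ell p powr (1/4) / (p * sqrt (ell (X/p)))))"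
      using near[OF p(1)] rho by (intro mult_mono) auto
    then show "norm ((f p - 1) * mean_error f (p - 1) (X / p)) \<le> 34 * \<rho> * X * norm (G y) * ell y powr (1/4) * (ell p powr (1/4) / (real p * sqrt (ell (X / p))))"
      by (simp add: norm_mult mult_ac)
  qed
  also have "\<dots> = 34 * \<rho> * X * norm (G y) * ell y powr (1/4) * (\<Sum>p\<in>primes_in 1 (real y). ell p powr (1/4) / (real p * sqrt (ell (X / p))))"
    by (simp only: sum_distrib_left)
  also have "\<dots> \<le> 34 * \<rho> * X * norm (G y) * ell y powr (1/4) * (220 * ell y powr (1/4) / sqrt (ell X))"
    using y X rho by (intro mult_left_mono sum_primes_weighted_le) auto
  also have "\<dots> = 7480 * \<rho> * (X * norm (G y) * ((ell y powr (1/4) * ell y powr (1/4)) / sqrt (ell X)))" by simp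
  also have "ell y powr (1/4) * ell y powr (1/4) = sqrt (ell y)"
    using y by (simp flip: powr_add add: powr_half_sqrt)
  finally show ?thesis by (simp add: U_def real_sqrt_divide)
qed

lemma smooth_sum_large:
  assumes "X \<ge> 1" "X < y"
  shows "smooth_sum f y X = smooth_sum f (nat \<lfloor>X\<rfloor>) X"
  unfolding smooth_sum_def
proof (rule sum.cong)
  fix n assume "n \<in> {n::nat. 1 \<le> n \<and> real n \<le> X}"
  then have n: "1 \<le> n" "real n \<le> X" by auto
  have "p \<le> y \<and> p \<le> nat \<lfloor>X\<rfloor>" if "p dvd n" for p
  proof -
    have "p \<le> n" using that n by (intro dvd_imp_le) auto
    then have "real p \<le> X" using n by linarith
    then show ?thesis using assms by (auto simp: le_nat_iff le_floor_iff)
  qed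
  then show "smooth_part f y n = smooth_part f (nat \<lfloor>X\<rfloor>) n"
    unfolding smooth_part_def by (intro prod.cong) auto
qed auto

lemma ell_floor:
  assumes "X \<ge> 1" shows "ell X \<le> 2 * ell (nat \<lfloor>X\<rfloor>)"
proof -
  have "real (nat \<lfloor>X\<rfloor>) = of_int \<lfloor>X\<rfloor>" "\<lfloor>X\<rfloor> \<ge> 1" using assms by simp_all
  then have 1: "real (nat \<lfloor>X\<rfloor>) \<ge> 1" "X \<le> 2 * real (nat \<lfloor>X\<rfloor>)" by linarith+
  have "ln X \<le> ln (2 * real (nat \<lfloor>X\<rfloor>))" using 1 assms by (subst ln_le_cancel_iff) linarith+
  also have "\<dots> = ln 2 + ln (real (nat \<lfloor>X\<rfloor>))" using 1 by (subst ln_mult) auto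
  finally have "ln X \<le> ln 2 + ln (real (nat \<lfloor>X\<rfloor>))" .
  moreover have "ln 2 \<le> (1::real)" using ln2_le_25_over_36 by simp
  moreover have "ln (real (nat \<lfloor>X\<rfloor>)) \<ge> 0" using 1 by simp
  ultimately show ?thesis by argo
qed

text \<open>Strong induction on y for all X at once, since the recursion calls the bound at p - 1
  and X / p, where p - 1 may exceed X / p. For y <= X one round gives 1 + U <= 3 U. For y > X the
  sum equals the one for y = floor X, and only the main terms differ: 4 * 2 * 2 from the Euler
  product at floor X and 1 from \<open>G y\<close> make 17.\<close>

lemma norm_mean_error_le:
  assumes "1 \<le> y" "1 \<le> X"
  shows "norm (mean_error f y X) \<le> 17 * U y X"
  using assms
proof (induction y arbitrary: X rule: less_induct)
  case (less y)
  have small: "norm (mean_error f y' X) \<le> 3 * U y' X" if y': "1 \<le> y'" "y' \<le> y" "real y' \<le> X" "1 \<le> X" for y' X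
  proof -
    have U: "1 \<le> 2 * U y' X" using y' by (intro U_lower)
    have "norm (mean_error f y' X) \<le> 1 + 7480 * \<rho> * U y' X" using y' less by (intro norm_mean_error_step) auto
    also have "7480 * \<rho> * U y' X \<le> 1 * U y' X" using rho U by (intro mult_right_mono) auto
    finally show ?thesis using U by simp
  qed
  show ?case
  proof (cases "real y \<le> X")
    case True
    then have "norm (mean_error f y X) \<le> 3 * U y X" using small less by blast
    then show ?thesis using U_lower[of y X] less by simp
  next
    case False
    define m where "m = nat \<lfloor>X\<rfloor>"
    have m: "1 \<le> m" "m \<le> y" "real m \<le> X" using less False unfolding m_def by linarith+
    have lm: "ell m \<ge> 1" and lmX: "ell m \<le> ell X" and lX: "ell X \<ge> 1" and lXy: "ell X \<le> ell y"
      using m less False by auto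
    have "U m X \<le> X * norm (G m) * 1"
      unfolding U_def using lm lmX lX less by (intro mult_left_mono) auto
    then have 1: "norm (mean_error f m X) \<le> 3 * (X * norm (G m))" using small[of m X] m less by simp
    have "mean_error f y X = mean_error f m X + of_real X * G m - of_real X * G y"
      using smooth_sum_large[of X y] less False by (simp add: mean_error_def m_def)
    also have "norm \<dots> \<le> norm (mean_error f m X) + norm (of_real X * G m) + norm (of_real X * G y)"
      by (intro order_trans[OF norm_triangle_ineq4] add_mono norm_triangle_ineq order_refl)
    also have "\<dots> \<le> 4 * X * norm (G m) + X * norm (G y)" using 1 less by (simp add: norm_mult)
    also have "norm (G m) \<le> 2 * norm (G y) * (ell y / ell m) powr (1/4)" using m by (intro euler_prod_ratio) auto
    also have "(ell y / ell m) powr (1/4) \<le> (2 * (ell y / ell X)) powr (1/4)"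
    proof (rule powr_mono2)
      have "ell y * ell X \<le> ell y * (2 * ell m)" using ell_floor[of X] less lXy lX by (intro mult_left_mono) (auto simp: m_def)
      then show "ell y / ell m \<le> 2 * (ell y / ell X)" using lm lX by (simp add: field_simps)
      show "0 \<le> ell y / ell m" using lm lX lXy by (intro divide_nonneg_nonneg) linarith+
    qed simp
    also have "\<dots> \<le> (2 * (ell y / ell X)) powr (1/2)"
    proof (rule powr_mono)
      have "1 \<le> ell y / ell X" using lX lXy by simp
      then show "1 \<le> 2 * (ell y / ell X)" by linarith
    qed simp
    also have "\<dots> = sqrt 2 * sqrt (ell y / ell X)"
      using lX lXy by (subst powr_half_sqrt) (simp, rule real_sqrt_mult)
    also have "sqrt 2 \<le> (2::real)" by (rule real_le_lsqrt) auto
    finally have "norm (mean_error f y X) \<le> 4 * X * (2 * norm (G y) * (2 * sqrt (ell y / ell X))) + X * norm (G y)"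
      using less lX lXy by (simp add: mult_left_mono mult_right_mono)
    also have "X * norm (G y) \<le> U y X"
    proof -
      have "1 \<le> sqrt (ell y / ell X)" using lX lXy by simp
      then have "X * norm (G y) * 1 \<le> X * norm (G y) * sqrt (ell y / ell X)" using less by (intro mult_left_mono) auto
      then show ?thesis by (simp add: U_def)
    qed
    also have "4 * X * (2 * norm (G y) * (2 * sqrt (ell y / ell X))) + U y X = 17 * U y X" by (simp add: U_def)
    finally show ?thesis by simp
  qed
qed

text \<open>The constant 17 of the induction is not small; one last round of the recursion at y =
  floor X restores the factor \<rho>.\<close>

lemma mean_value_estimate:
  assumes "1 \<le> X"
  shows "norm (smooth_sum f (nat \<lfloor>X\<rfloor>) X - of_real X * G (nat \<lfloor>X\<rfloor>)) \<le> 1 + 7480 * \<rho> * X * norm (G (nat \<lfloor>X\<rfloor>))"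
proof -
  define m where "m = nat \<lfloor>X\<rfloor>"
  have m: "1 \<le> m" "real m \<le> X" using assms unfolding m_def by linarith+
  have lm: "ell m \<ge> 1" and lmX: "ell m \<le> ell X" and lX: "ell X \<ge> 1" using m assms by auto
  have "U m X \<le> X * norm (G m) * 1"
    unfolding U_def using lm lmX lX assms by (intro mult_left_mono) auto
  then have "7480 * \<rho> * U m X \<le> 7480 * \<rho> * (X * norm (G m))" using rho by (intro mult_left_mono) auto
  moreover have "norm (mean_error f m X) \<le> 1 + 7480 * \<rho> * U m X"
    using m norm_mean_error_le by (intro norm_mean_error_step) auto
  ultimately show ?thesis unfolding m_def[symmetric] mean_error_def by (simp add: mult.assoc)
qed

end

section \<open>Exponential moments of strongly additive functions\<close>

lemma strongly_additive_eq_sum: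
  assumes g: "strongly_additive g" and "n \<ge> 1"
  shows "g n = (\<Sum>p | prime p \<and> p dvd n. g p)"
  using \<open>n \<ge> 1\<close>
proof (induction n rule: less_induct)
  case (less n)
  show ?case
  proof (cases "n = 1")
    case True
    have "g (1 * 1) = g 1 + g 1" using g unfolding strongly_additive_def by (metis coprime_1_left zero_less_one)
    moreover have "{p::nat. prime p \<and> p dvd 1} = {}" by auto
    ultimately show ?thesis using True by simp
  next
    case False
    then obtain p where p: "prime p" "p dvd n" using prime_factor_nat by blast
    obtain m where m: "n = p ^ multiplicity p n * m" "\<not> p dvd m"
      using multiplicity_decompose'[of n p] less p by (metis not_prime_unit not_one_le_zero)
    define k where "k = multiplicity p n"
    have k: "k \<ge> 1" using p m less by (cases k) (auto simp: k_def)
    have m0: "m \<ge> 1" using m less by (cases m) auto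
    have "1 < p ^ k" using k p(1) prime_gt_1_nat by (intro one_less_power) auto
    then have mn: "m < n" using m m0 unfolding k_def by (metis less_le_trans mult_less_cancel2 mult_1 zero_less_one order_less_le_trans)
    have cop: "coprime (p ^ k) m" using p m by (simp add: prime_imp_coprime)
    have "g n = g (p ^ k) + g m"
      using g cop m m0 p k unfolding strongly_additive_def k_def
      by (metis less_le_trans zero_less_one prime_gt_0_nat zero_less_power)
    also have "g (p ^ k) = g p" using g p k unfolding strongly_additive_def by blast
    also have "g m = (\<Sum>p | prime p \<and> p dvd m. g p)" using less mn m0 by blast
    also have "g p + \<dots> = (\<Sum>q\<in>insert p {p. prime p \<and> p dvd m}. g q)"
      using m m0 by (subst sum.insert) (auto intro: finite_subset[of _ "{..m}"] dest: dvd_imp_le)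
    also have "insert p {p. prime p \<and> p dvd m} = {q. prime q \<and> q dvd n}"
    proof -
      have "q dvd n \<longleftrightarrow> q = p \<or> q dvd m" if "prime q" for q
        using that p k by (subst m(1)) (auto simp: prime_dvd_mult_iff prime_dvd_power_iff k_def[symmetric] dest: primes_dvd_imp_eq)
      then show ?thesis using p by auto
    qed
    finally show ?thesis .
  qed
qed

lemma norm_exp_minus_1_le: "norm (exp w - 1) \<le> exp (norm w) * norm w" for w :: complex
  using Taylor_exp_field[of w 0] by simp

lemma norm_one_plus_times_exp_le:
  fixes a :: complex
  assumes "norm a \<le> 1/2"
  shows "norm ((1 + a) * exp (- a) - 1) \<le> 3 * norm a ^ 2"
proof -
  have "(1 + a) * exp (- a) - 1 = - (exp (-a) * (exp a - (\<Sum>i\<le>1. a ^ i / fact i)))"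
    by (simp add: algebra_simps exp_minus)
  also have "norm \<dots> \<le> exp (norm a) * (exp (norm a) * norm a ^ Suc 1 / fact 1)"
    unfolding norm_minus_cancel norm_mult
    using norm_exp[of "-a"] by (intro mult_mono Taylor_exp_field) auto
  also have "\<dots> = exp (2 * norm a) * norm a ^ 2" by (simp add: power2_eq_square mult_exp_exp flip: mult.assoc)
  also have "exp (2 * norm a) \<le> exp 1" using assms by simp
  also have "exp 1 \<le> (3::real)" using e_less_272 by simp
  finally show ?thesis by (simp add: mult_right_mono)
qed

lemma sum_inverse_squares_le: "(\<Sum>n=1..N. 1 / (real n)\<^sup>2) \<le> 2"
proof -
  have "N \<ge> 1 \<Longrightarrow> (\<Sum>n=1..N. 1 / (real n)\<^sup>2) \<le> 2 - 1 / real N"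
  proof (induction N rule: dec_induct)
    case (step n)
    have "1 / (real (Suc n))\<^sup>2 \<le> 1 / real n - 1 / real (Suc n)"
      using step by (simp add: divide_simps power2_eq_square)
    then show ?case using step by simp
  qed simp
  then show ?thesis by (cases "N \<ge> 1") (auto intro: order_trans)
qed

text \<open>Passes from the Euler product to the exponential of its prime sum. The factors differ
  from each other by a relative O(\<rho>^2 / p^2), which is summable over p, so the total is
  O(\<rho>^2), and for \<rho> <= 1/10 this is below \<rho>.\<close>

lemma norm_euler_prod_exp_le:
  fixes h :: "nat \<Rightarrow> complex"
  assumes "0 \<le> \<rho>" "\<rho> \<le> 1/10" "\<And>p. prime p \<Longrightarrow> norm (h p) \<le> \<rho>"
  shows "norm ((\<Prod>p | prime p \<and> p \<le> N. 1 + h p / of_nat p) * exp (- (\<Sum>p | prime p \<and> p \<le> N. h p / of_nat p)) - 1) \<le> \<rho>"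
proof -
  let ?P = "{p. prime p \<and> p \<le> N}"
  define b where "b = (\<lambda>p. (1 + h p / of_nat p) * exp (- (h p / of_nat p)) - 1)"
  have b: "norm (b p) \<le> 3 * \<rho>\<^sup>2 * (1 / (real p)\<^sup>2)" if "p \<in> ?P" for p
  proof -
    have p: "prime p" "real p \<ge> 1" using that prime_ge_1_nat[of p] by auto
    have 1: "norm (h p / of_nat p) \<le> \<rho> / p" using assms p by (simp add: norm_divide divide_right_mono)
    also have "\<rho> / p \<le> \<rho> / 1" using assms p by (intro divide_left_mono) auto
    finally have "norm (h p / of_nat p) \<le> 1/2" using assms by simp
    then have "norm (b p) \<le> 3 * norm (h p / of_nat p) ^ 2" unfolding b_def by (rule norm_one_plus_times_exp_le)
    also have "\<dots> \<le> 3 * (\<rho> / p) ^ 2" using 1 by (intro mult_left_mono power_mono) auto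
    finally show ?thesis by (simp add: power_divide)
  qed
  have "(\<Prod>p\<in>?P. 1 + h p / of_nat p) * exp (- (\<Sum>p\<in>?P. h p / of_nat p)) = (\<Prod>p\<in>?P. 1 + b p)"
    by (simp add: exp_sum prod.distrib b_def flip: sum_negf)
  then have "norm ((\<Prod>p\<in>?P. 1 + h p / of_nat p) * exp (- (\<Sum>p\<in>?P. h p / of_nat p)) - 1) \<le> (\<Prod>p\<in>?P. 1 + norm (b p)) - 1"
    using norm_prod_minus1_le_prod_minus1[of b ?P] by simp
  also have "(\<Prod>p\<in>?P. 1 + norm (b p)) \<le> (\<Prod>p\<in>?P. exp (norm (b p)))" by (intro prod_mono) auto
  also have "\<dots> = exp (\<Sum>p\<in>?P. norm (b p))" by (simp add: exp_sum)
  also have "(\<Sum>p\<in>?P. norm (b p)) \<le> (\<Sum>p\<in>?P. 3 * \<rho>\<^sup>2 * (1 / (real p)\<^sup>2))" by (intro sum_mono b)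
  also have "\<dots> \<le> (\<Sum>p=1..N. 3 * \<rho>\<^sup>2 * (1 / (real p)\<^sup>2))" by (intro sum_mono2) (auto dest: prime_ge_1_nat)
  also have "\<dots> = 3 * \<rho>\<^sup>2 * (\<Sum>p=1..N. 1 / (real p)\<^sup>2)" by (simp only: sum_distrib_left)
  also have "\<dots> \<le> 3 * \<rho>\<^sup>2 * 2" by (intro mult_left_mono sum_inverse_squares_le) auto
  also have "\<dots> \<le> 6 * ((1/10) * \<rho>)" using assms mult_right_mono[of \<rho> "1/10" \<rho>] by (simp add: power2_eq_square)
  also have "exp (6 * ((1/10) * \<rho>)) - 1 \<le> \<rho>"
  proof -
    have "(6/10 * \<rho>)\<^sup>2 \<le> 4/10 * \<rho>"
    proof -
      have "\<rho> * \<rho> \<le> 1/10 * \<rho>" using assms by (intro mult_right_mono) auto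
      then show ?thesis using assms by (simp add: power2_eq_square)
    qed
    moreover have "exp (6/10 * \<rho>) \<le> 1 + 6/10 * \<rho> + (6/10 * \<rho>)\<^sup>2" using assms by (intro exp_bound) auto
    ultimately show ?thesis by simp
  qed
  finally show ?thesis by simp
qed

text \<open>Divided by x, not by the number of terms, to match the mean value estimate; the quotient
  x / floor x is put back when this becomes the moment of a probability law.\<close>

definition tilted_mean :: "(nat \<Rightarrow> real) \<Rightarrow> real \<Rightarrow> complex \<Rightarrow> complex" where
  "tilted_mean g x z = (\<Sum>n | 1 \<le> n \<and> real n \<le> x. exp (z * of_real (g n - mu g x))) / of_real x"

text \<open>Logarithm of the exponential moment of the sum over p of g(p) times independent centred
  Poisson variables of parameter 1/p, which model g - mu.\<close>

definition prime_cumulant :: "(nat \<Rightarrow> real) \<Rightarrow> real \<Rightarrow> complex \<Rightarrow> complex" where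
  "prime_cumulant g x z = (\<Sum>p | prime p \<and> real p \<le> x. (exp (z * of_real (g p)) - 1 - z * of_real (g p)) / of_nat p)"

lemma primes_le_real_eq: "0 \<le> x \<Longrightarrow> {p. prime p \<and> real p \<le> x} = {p. prime p \<and> p \<le> nat \<lfloor>x\<rfloor>}"
  by (simp add: le_nat_iff le_floor_iff)

lemma smooth_part_exp:
  assumes g: "strongly_additive g" and n: "1 \<le> n" "n \<le> y"
  shows "smooth_part (\<lambda>n. exp (z * of_real (g n))) y n = exp (z * of_real (g n))"
proof -
  have "{p. prime p \<and> p dvd n \<and> p \<le> y} = {p. prime p \<and> p dvd n}"
    using n by (auto dest: dvd_imp_le)
  moreover have "finite {p. prime p \<and> p dvd n}"
    using n by (auto intro: finite_subset[of _ "{..n}"] dest: dvd_imp_le)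
  ultimately show ?thesis
    unfolding smooth_part_def strongly_additive_eq_sum[OF g n(1)]
    by (simp add: exp_sum sum_distrib_left)
qed

text \<open>Two relative errors multiply: \<open>e1\<close> of the mean against the Euler product,
  \<open>e2\<close> of the Euler product against the exponential. The term with (1 + ln x) / x is
  the absolute error 1 divided by x times the Euler product, whose modulus is at least 1 / (2 * ell
  x). The constant 15000 exceeds 2 * 7480 + 1.\<close>

lemma tilted_mean_bound:
  assumes g: "strongly_additive g" and x: "x \<ge> 1" and rho: "0 \<le> \<rho>" "\<rho> \<le> 1/10000"
    and near: "\<And>p. prime p \<Longrightarrow> norm (exp (z * of_real (g p)) - 1) \<le> \<rho>"
  shows "norm (tilted_mean g x z / exp (prime_cumulant g x z) - 1) \<le> 15000 * \<rho> + 4 * (1 + ln x) / x"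
proof -
  define f where "f = (\<lambda>n. exp (z * of_real (g n)))"
  interpret near_one f \<rho> using rho near by unfold_locales (auto simp: f_def)
  define m where "m = nat \<lfloor>x\<rfloor>"
  have m: "1 \<le> m" "real m \<le> x" using x unfolding m_def by linarith+
  define G0 where "G0 = G m"
  define a where "a = (\<Sum>p | prime p \<and> p \<le> m. (f p - 1) / of_nat p)"
  have G0: "G0 \<noteq> 0" unfolding G0_def using euler_prod_nonzero m by blast
  have S: "smooth_sum f m x = (\<Sum>n | 1 \<le> n \<and> real n \<le> x. f n)"
    unfolding smooth_sum_def f_def using x
    by (intro sum.cong smooth_part_exp[OF g]) (auto simp: m_def le_nat_iff le_floor_iff)
  define e1 where "e1 = smooth_sum f m x / (of_real x * G0) - 1"
  define e2 where "e2 = G0 * exp (- a) - 1"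
  have e2: "norm e2 \<le> \<rho>"
    unfolding e2_def G0_def euler_prod_def a_def using rho near
    by (intro norm_euler_prod_exp_le) (auto simp: f_def)
  have "1 \<le> 2 * norm G0 * ell m powr (1/4)" unfolding G0_def using m euler_prod_lower by blast
  also have "ell m powr (1/4) \<le> ell x powr 1"
  proof -
    have "ell m powr (1/4) \<le> ell m powr 1" using m by (intro powr_mono) auto
    also have "\<dots> \<le> ell x powr 1" using m by (intro powr_mono2) auto
    finally show ?thesis .
  qed
  also have "\<dots> = ell x" using x by simp
  finally have "1 \<le> 2 * norm G0 * ell x" by (simp add: mult_left_mono)
  then have inv: "1 / (x * norm G0) \<le> 2 * ell x / x"
    using x G0 by (simp add: divide_simps mult_ac)
  have "norm (smooth_sum f m x - of_real x * G0) \<le> 1 + 7480 * \<rho> * x * norm G0"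
    unfolding G0_def m_def using x by (rule mean_value_estimate)
  moreover have "e1 = (smooth_sum f m x - of_real x * G0) / (of_real x * G0)"
    using G0 x unfolding e1_def by (simp add: diff_divide_distrib)
  ultimately have "norm e1 \<le> (1 + 7480 * \<rho> * x * norm G0) / (x * norm G0)"
    using x by (simp add: norm_divide norm_mult divide_right_mono)
  also have "\<dots> = 1 / (x * norm G0) + 7480 * \<rho>" using x G0 by (simp add: add_divide_distrib)
  finally have e1: "norm e1 \<le> 2 * ell x / x + 7480 * \<rho>" using inv by linarith
  have set: "{p. prime p \<and> real p \<le> x} = {p. prime p \<and> p \<le> m}" using primes_le_real_eq x by (simp add: m_def)
  have pc: "exp (prime_cumulant g x z) = exp a * exp (- z * of_real (mu g x))"
    unfolding prime_cumulant_def mu_def set a_def f_def mult_exp_exp of_real_sum sum_distrib_left sum.distrib[symmetric]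
    by (intro arg_cong[where f = exp] sum.cong) (auto simp: diff_divide_distrib)
  have tm: "tilted_mean g x z = smooth_sum f m x * exp (- z * of_real (mu g x)) / of_real x"
  proof -
    have "exp (z * of_real (g n - mu g x)) = f n * exp (- z * of_real (mu g x))" for n
      unfolding f_def mult_exp_exp by (simp add: algebra_simps)
    then show ?thesis unfolding tilted_mean_def S sum_distrib_right by simp
  qed
  have "tilted_mean g x z / exp (prime_cumulant g x z) = (1 + e1) * (1 + e2)"
    unfolding tm pc e1_def e2_def using G0 x by (simp add: exp_minus field_simps)
  then have "tilted_mean g x z / exp (prime_cumulant g x z) - 1 = e1 + e2 + e1 * e2" by (simp add: algebra_simps)
  also have "norm \<dots> \<le> norm e1 + norm e2 + norm e1 * norm e2"
    by (intro order_trans[OF norm_triangle_ineq] add_mono norm_triangle_ineq) (simp add: norm_mult)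
  also have "\<dots> \<le> norm e1 + norm e2 + norm e1 * 1" using e2 rho by (intro add_left_mono mult_left_mono) auto
  also have "\<dots> \<le> 15000 * \<rho> + 2 * (2 * ell x / x)" using e1 e2 rho by linarith
  also have "2 * (2 * ell x / x) = 4 * (1 + ln x) / x" by simp
  finally show ?thesis .
qed

text \<open>The radius d does not depend on x: g p <= M keeps the modulus of z * g p below \<rho> /
  3, and then exp (z * g p) - 1 is below \<rho> because exp 1 < 3.\<close>

lemma tilted_mean_asymp:
  assumes g: "strongly_additive g" and M: "\<And>p. prime p \<Longrightarrow> 0 \<le> g p \<and> g p \<le> M" and "e > 0"
  shows "\<exists>d>0. \<forall>\<^sub>F x in at_top. \<forall>z. norm z \<le> d \<longrightarrow> norm (tilted_mean g x z / exp (prime_cumulant g x z) - 1) \<le> e"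
proof -
  have M0: "M \<ge> 0" using M[of 2] two_is_prime_nat by linarith
  define \<rho> where "\<rho> = min (1/10000) (e / 30000)"
  have rho: "0 < \<rho>" "\<rho> \<le> 1/10000" "15000 * \<rho> \<le> e / 2" using \<open>e > 0\<close> by (auto simp: \<rho>_def)
  define d where "d = \<rho> / (3 * (M + 1))"
  have d: "d > 0" using rho M0 by (simp add: d_def)
  have near: "norm (exp (z * of_real (g p)) - 1) \<le> \<rho>" if "norm z \<le> d" "prime p" for z :: complex and p
  proof -
    have "norm (z * of_real (g p)) \<le> d * (M + 1)"
      using that M[OF that(2)] d by (simp add: norm_mult) (intro mult_mono, auto)
    also have "\<dots> = \<rho> / 3" using M0 unfolding d_def by (simp add: divide_simps)
    finally have w: "norm (z * of_real (g p)) \<le> \<rho> / 3" .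
    have "norm (exp (z * of_real (g p)) - 1) \<le> exp (norm (z * of_real (g p))) * norm (z * of_real (g p))"
      by (rule norm_exp_minus_1_le)
    also have "\<dots> \<le> exp 1 * (\<rho> / 3)" using w rho by (intro mult_mono) auto
    also have "\<dots> \<le> 3 * (\<rho> / 3)" using rho e_less_272 by (intro mult_right_mono) auto
    finally show ?thesis by simp
  qed
  have "((\<lambda>x::real. 4 * (1 + ln x) / x) \<longlongrightarrow> 0) at_top" by real_asymp
  then have "\<forall>\<^sub>F x in at_top. 4 * (1 + ln x) / x < e / 2" using \<open>e > 0\<close> by (intro order_tendstoD) auto
  then have "\<forall>\<^sub>F x in at_top. \<forall>z. norm z \<le> d \<longrightarrow> norm (tilted_mean g x z / exp (prime_cumulant g x z) - 1) \<le> e"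
    using eventually_ge_at_top[of 1]
  proof eventually_elim
    case (elim x)
    show ?case
    proof (intro allI impI)
      fix z :: complex assume "norm z \<le> d"
      then have "norm (tilted_mean g x z / exp (prime_cumulant g x z) - 1) \<le> 15000 * \<rho> + 4 * (1 + ln x) / x"
        using g rho near elim by (intro tilted_mean_bound) auto
      then show "norm (tilted_mean g x z / exp (prime_cumulant g x z) - 1) \<le> e" using elim rho by linarith
    qed
  qed
  then show ?thesis using d by blast
qed

section \<open>Cumulant series\<close>

text \<open>The exponent of the limit law and its finite approximants are both of the form
  \<open>cumulant 2 m z = (\<Sum>j. m j * z ^ (j + 2) / fact (j + 2))\<close>, where \<open>m j\<close> is the \<open>j\<close>-th moment of a
  probability measure on a bounded interval.\<close>

definition cumulant_coeff :: "nat \<Rightarrow> (nat \<Rightarrow> real) \<Rightarrow> nat \<Rightarrow> complex" where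
  "cumulant_coeff k m n = (if n < k then 0 else of_real (m (n - k)) / fact n)"

definition cumulant :: "nat \<Rightarrow> (nat \<Rightarrow> real) \<Rightarrow> complex \<Rightarrow> complex" where
  "cumulant k m z = (\<Sum>n. cumulant_coeff k m n * z ^ n)"

text \<open>Just the data that the series estimates use, so that they apply alike to point masses,
  to averages over primes and to \<Psi>. The condition \<open>m 0 = 1\<close> normalises the second
  derivative of \<open>cumulant 2 m\<close> at 0 to 1.\<close>

locale moment_seq =
  fixes m :: "nat \<Rightarrow> real" and A :: real
  assumes A: "1 \<le> A" and m_bound: "\<And>j. \<bar>m j\<bar> \<le> A ^ j" and m_0: "m 0 = 1"
begin

lemma m_shift_bound: "\<bar>m (n - k)\<bar> \<le> A ^ n"
  using m_bound[of "n - k"] power_increasing[of "n - k" n A] A by linarith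

lemma coeff_bound: "norm (cumulant_coeff k m n * z ^ n) \<le> (A * norm z) ^ n / fact n"
proof -
  have "norm (of_real (m (n - k)) / fact n * z ^ n) = \<bar>m (n - k)\<bar> * norm z ^ n / fact n"
    by (simp add: norm_mult norm_divide norm_power)
  also have "\<dots> \<le> A ^ n * norm z ^ n / fact n"
    by (intro divide_right_mono mult_right_mono m_shift_bound) auto
  finally show ?thesis using A by (auto simp: power_mult_distrib cumulant_coeff_def)
qed

lemma summable_coeff: "summable (\<lambda>n. cumulant_coeff k m n * z ^ n)"
proof (rule summable_comparison_test')
  show "summable (\<lambda>n. (A * norm z) ^ n / fact n)" using summable_exp[of "A * norm z"] by (simp add: field_simps)
  show "norm (cumulant_coeff k m n * z ^ n) \<le> (A * norm z) ^ n / fact n" if "n \<ge> 0" for n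
    by (rule coeff_bound)
qed

text \<open>The first parameter counts how often the moment generating function
  \<open>cumulant 0 m\<close> has been integrated from 0: 2 gives the exponent of the law, 1 the
  left side of the saddle point equation, 0 the curvature.\<close>

lemma DERIV_cumulant: "(cumulant (Suc k) m has_field_derivative cumulant k m z) (at z)"
proof -
  have "diffs (cumulant_coeff (Suc k) m) = cumulant_coeff k m"
    by (rule ext) (auto simp: diffs_def fact_Suc cumulant_coeff_def simp del: of_nat_Suc)
  moreover have "((\<lambda>z. \<Sum>n. cumulant_coeff (Suc k) m n * z ^ n) has_field_derivative
     (\<Sum>n. diffs (cumulant_coeff (Suc k) m) n * z ^ n)) (at z)"
    by (rule termdiffs_strong_converges_everywhere) (rule summable_coeff)
  ultimately show ?thesis unfolding cumulant_def[abs_def] by simp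
qed

lemma DERIV_cumulant2: "(cumulant 2 m has_field_derivative cumulant 1 m z) (at z)"
  using DERIV_cumulant[of 1] by (simp only: Suc_1)
lemma DERIV_cumulant1: "(cumulant 1 m has_field_derivative cumulant 0 m z) (at z)"
  using DERIV_cumulant[of 0] by simp

lemma cumulant_zero: "k > 0 \<Longrightarrow> cumulant k m 0 = 0"
  unfolding cumulant_def powser_zero by (simp add: cumulant_coeff_def)

lemma norm_cumulant0_minus_1:
  assumes "norm z \<le> 1" shows "norm (cumulant 0 m z - 1) \<le> A * exp A * norm z"
proof -
  let ?c = "\<lambda>n. cumulant_coeff 0 m n * z ^ n"
  have s: "summable ?c" by (rule summable_coeff)
  have "cumulant 0 m z - 1 = (\<Sum>n. ?c (Suc n))"
    unfolding cumulant_def using suminf_split_head[OF s] m_0 by (simp add: cumulant_coeff_def)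
  also have "norm \<dots> \<le> (\<Sum>n. A * norm z * (A ^ n / fact n))"
  proof (rule norm_suminf_le)
    fix n
    have "norm (?c (Suc n)) \<le> (A * norm z) ^ Suc n / fact (Suc n)" by (rule coeff_bound)
    also have "\<dots> = A * norm z * ((A * norm z) ^ n / fact (Suc n))" by simp
    also have "\<dots> \<le> A * norm z * (A ^ n / fact n)"
    proof (rule mult_left_mono)
      have "(A * norm z) ^ n \<le> A ^ n" using A assms by (intro power_mono) (auto simp: mult_left_le)
      moreover have "fact n \<le> (fact (Suc n) :: real)" by (rule fact_mono) simp
      ultimately show "(A * norm z) ^ n / fact (Suc n) \<le> A ^ n / fact n" using A by (intro frac_le) auto
    qed (use A in simp)
    finally show "norm (?c (Suc n)) \<le> A * norm z * (A ^ n / fact n)" .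
  next
    show "summable (\<lambda>n. A * norm z * (A ^ n / fact n))"
      using summable_exp[of A] by (intro summable_mult) (simp add: field_simps)
  qed
  also have "\<dots> = A * norm z * exp A"
    using summable_exp[of A] by (subst suminf_mult) (simp_all add: field_simps exp_def scaleR_conv_of_real)
  finally show ?thesis by (simp add: mult_ac)
qed

lemma cumulant1_Taylor:
  assumes "r \<le> 1" "norm w \<le> r" "norm z \<le> r"
  shows "norm (cumulant 1 m z - cumulant 1 m w - (z - w)) \<le> A * exp A * r * norm (z - w)"
proof -
  define f where "f = (\<lambda>i x. if i = (0::nat) then cumulant 1 m x - x else cumulant 0 m x - 1)"
  have "norm (f 0 z - (\<Sum>i\<le>0. f i w * (z - w) ^ i / fact i)) \<le> (A * exp A * r) * norm (z - w) ^ Suc 0 / fact 0"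
  proof (rule complex_Taylor[where S = "cball 0 r"])
    fix i x assume "i \<le> (0::nat)"
    then show "(f i has_field_derivative f (Suc i) x) (at x within cball 0 r)"
      unfolding f_def by (simp del: One_nat_def)
        (intro DERIV_diff has_field_derivative_at_within[OF DERIV_cumulant1] DERIV_ident)
  next
    fix x :: complex assume "x \<in> cball 0 r"
    then show "norm (f (Suc 0) x) \<le> A * exp A * r"
      using norm_cumulant0_minus_1[of x] assms A mult_left_mono[of "norm x" r "A * exp A"]
      by (auto simp: f_def intro: order_trans)
  qed (use assms in auto)
  then show ?thesis by (simp add: f_def algebra_simps)
qed

text \<open>Taylor's theorem is applied to the cumulant minus z^2 / 2, whose second derivative is
  O(r) on the disc of radius r. The remainder is thus a small multiple of the quadratic term itself,
  which later lets the Gaussian decay absorb it.\<close>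

lemma cumulant2_Taylor:
  assumes "r \<le> 1" "norm w \<le> r" "norm z \<le> r"
  shows "norm (cumulant 2 m z - cumulant 2 m w - cumulant 1 m w * (z - w) - (z - w)\<^sup>2 / 2) \<le> A * exp A * r * norm (z - w) ^ 2"
proof -
  define f where "f = (\<lambda>i x. if i = (0::nat) then cumulant 2 m x - x\<^sup>2 / 2 else if i = 1 then cumulant 1 m x - x else cumulant 0 m x - 1)"
  have "norm (f 0 z - (\<Sum>i\<le>1. f i w * (z - w) ^ i / fact i)) \<le> (A * exp A * r) * norm (z - w) ^ Suc 1 / fact 1"
  proof (rule complex_Taylor[where S = "cball 0 r"])
    fix i x assume "i \<le> (1::nat)"
    then consider "i = 0" | "i = 1" by linarith
    then show "(f i has_field_derivative f (Suc i) x) (at x within cball 0 r)"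
    proof cases
      case 1
      have "((\<lambda>x. cumulant 2 m x - x\<^sup>2 / 2) has_field_derivative cumulant 1 m x - x) (at x within cball 0 r)"
        by (intro DERIV_diff has_field_derivative_at_within[OF DERIV_cumulant2]) (auto intro!: derivative_eq_intros)
      then show ?thesis using 1 by (simp add: f_def)
    next
      case 2
      have "((\<lambda>x. cumulant 1 m x - x) has_field_derivative cumulant 0 m x - 1) (at x within cball 0 r)"
        by (intro DERIV_diff has_field_derivative_at_within[OF DERIV_cumulant1] DERIV_ident)
      then show ?thesis using 2 by (simp add: f_def)
    qed
  next
    fix x :: complex assume "x \<in> cball 0 r"
    then show "norm (f (Suc 1) x) \<le> A * exp A * r"
      using norm_cumulant0_minus_1[of x] assms A mult_left_mono[of "norm x" r "A * exp A"]
      by (auto simp: f_def intro: order_trans)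
  qed (use assms in auto)
  moreover have "f 0 z - (\<Sum>i\<le>1. f i w * (z - w) ^ i / fact i) =
     cumulant 2 m z - cumulant 2 m w - cumulant 1 m w * (z - w) - (z - w)\<^sup>2 / 2"
    by (simp add: f_def power2_eq_square algebra_simps add_divide_distrib diff_divide_distrib)
  ultimately show ?thesis by (simp add: numeral_2_eq_2)
qed

lemma cumulant1_real: "cumulant 1 m (of_real s) = of_real (Re (cumulant 1 m (of_real s)))"
proof -
  have "cumulant 1 m (of_real s) = (\<Sum>n. of_real ((if n < 1 then 0 else m (n - 1) / fact n) * s ^ n))"
    unfolding cumulant_def by (intro suminf_cong) (auto simp: cumulant_coeff_def)
  also have "\<dots> = of_real (\<Sum>n. (if n < 1 then 0 else m (n - 1) / fact n) * s ^ n)"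
  proof (rule suminf_of_real[symmetric])
    have "summable (\<lambda>n. complex_of_real ((if n < 1 then 0 else m (n - 1) / fact n) * s ^ n))"
      using summable_coeff[of 1 "of_real s"] by (rule summable_cong[THEN iffD1, rotated]) (auto simp: cumulant_coeff_def)
    then show "summable (\<lambda>n. (if n < 1 then 0 else m (n - 1) / fact n) * s ^ n)" by (simp only: summable_of_real_iff)
  qed
  finally show ?thesis by (metis Re_complex_of_real)
qed

text \<open>Intermediate value theorem on [0, 2 s]: the derivative of the cumulant vanishes at 0,
  and at 2 s it is at least 2 s - 4 A exp A s^2 >= s.\<close>

lemma saddle_point_exists:
  assumes "0 < s" "2 * s \<le> 1" "4 * (A * exp A) * s \<le> 1"
  shows "\<exists>\<sigma>. 0 \<le> \<sigma> \<and> \<sigma> \<le> 2 * s \<and> cumulant 1 m (of_real \<sigma>) = of_real s"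
proof -
  define K where "K = A * exp A"
  have K: "K > 0" using A by (simp add: K_def)
  define f where "f = (\<lambda>x. Re (cumulant 1 m (of_real x)))"
  have "isCont (cumulant 1 m) z" for z using DERIV_cumulant1 DERIV_isCont by blast
  then have "continuous_on UNIV (cumulant 1 m)" by (simp add: continuous_on_eq_continuous_at)
  then have "continuous_on {0..2 * s} (\<lambda>x. cumulant 1 m (of_real x))"
    by (rule continuous_on_compose2) (auto intro!: continuous_intros)
  then have cont: "continuous_on {0..2 * s} f" unfolding f_def by (rule continuous_on_Re)
  have "norm (cumulant 1 m (of_real (2 * s)) - of_real (2 * s)) \<le> K * (2 * s) * (2 * s)"
    using cumulant1_Taylor[of "2 * s" 0 "of_real (2 * s)"] assms cumulant_zero[of 1] unfolding K_def by simp
  then have "\<bar>f (2 * s) - 2 * s\<bar> \<le> K * (2 * s) * (2 * s)"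
    unfolding f_def using abs_Re_le_cmod[of "cumulant 1 m (of_real (2 * s)) - of_real (2 * s)"] by simp
  moreover have "K * (2 * s) * (2 * s) = (4 * K * s) * s" by simp
  moreover have "(4 * K * s) * s \<le> 1 * s" using assms by (intro mult_right_mono) (auto simp: K_def)
  ultimately have "s \<le> f (2 * s)" by linarith
  moreover have "f 0 \<le> s" using assms cumulant_zero[of 1] by (simp add: f_def)
  ultimately obtain x where "0 \<le> x" "x \<le> 2 * s" "f x = s"
    using IVT'[of f 0 s "2 * s"] cont assms by auto
  then show ?thesis using cumulant1_real[of x] unfolding f_def by metis
qed

end

text \<open>Both series start at z^2, and their z^2 terms agree since both zeroth moments are 1, so
  the difference is of order z^3. This is why an error O(1 / B^2) in the distribution function is
  admissible: multiplied by B^2 it leaves O(z^3), which vanishes as z tends to 0.\<close>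

lemma cumulant_diff_bound:
  assumes m: "moment_seq m A" and m': "moment_seq m' A"
    and diff: "\<And>j. \<bar>m j - m' j\<bar> \<le> A ^ j * e"
    and z: "norm z \<le> R" and R: "R \<ge> 1"
  shows "norm (cumulant 2 m z - cumulant 2 m' z) \<le> exp (A * R) * e * norm z ^ 3"
proof -
  interpret m: moment_seq m A by fact
  interpret m': moment_seq m' A by fact
  have A: "A \<ge> 1" by (rule m.A)
  have e: "e \<ge> 0" using diff[of 0] by simp
  let ?c = "\<lambda>n. cumulant_coeff 2 m n * z ^ n"
  let ?c' = "\<lambda>n. cumulant_coeff 2 m' n * z ^ n"
  have "cumulant 2 m z - cumulant 2 m' z = (\<Sum>n. ?c n - ?c' n)"
    unfolding cumulant_def by (rule suminf_diff[OF m.summable_coeff m'.summable_coeff])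
  also have "norm \<dots> \<le> (\<Sum>n. e * norm z ^ 3 * ((A * R) ^ n / fact n))"
  proof (rule norm_suminf_le)
    fix n
    consider "n < 2" | "n = 2" | "n \<ge> (3::nat)" by linarith
    then show "norm (?c n - ?c' n) \<le> e * norm z ^ 3 * ((A * R) ^ n / fact n)"
    proof cases
      case 3
      have "norm (?c n - ?c' n) = \<bar>m (n-2) - m' (n-2)\<bar> * norm z ^ n / fact n"
        using 3 by (simp add: cumulant_coeff_def norm_mult norm_power norm_divide flip: left_diff_distrib diff_divide_distrib of_real_diff)
      also have "\<dots> \<le> (A ^ n * e) * (norm z ^ 3 * R ^ n) / fact n"
      proof (intro divide_right_mono mult_mono)
        have "A ^ (n-2) \<le> A ^ n" using A by (intro power_increasing) auto
        then have "A ^ (n-2) * e \<le> A ^ n * e" using e by (intro mult_right_mono)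
        then show "\<bar>m (n-2) - m' (n-2)\<bar> \<le> A ^ n * e" using diff[of "n-2"] by linarith
        have "norm z ^ n = norm z ^ 3 * norm z ^ (n - 3)" using 3 by (simp flip: power_add)
        also have "norm z ^ (n - 3) \<le> R ^ (n - 3)" using z by (intro power_mono) auto
        also have "\<dots> \<le> R ^ n" using R by (intro power_increasing) auto
        finally show "norm z ^ n \<le> norm z ^ 3 * R ^ n" by (simp add: mult_left_mono)
      qed (use A e in auto)
      finally show ?thesis by (simp add: mult_ac power_mult_distrib)
    qed (use A R e m.m_0 m'.m_0 in \<open>auto simp: cumulant_coeff_def\<close>)
  next
    show "summable (\<lambda>n. e * norm z ^ 3 * ((A * R) ^ n / fact n))"
      using summable_exp[of "A * R"] by (intro summable_mult) (simp add: field_simps)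
  qed
  also have "\<dots> = e * norm z ^ 3 * exp (A * R)"
    using summable_exp[of "A * R"] by (subst suminf_mult) (simp_all add: field_simps exp_def scaleR_conv_of_real)
  finally show ?thesis by (simp add: mult_ac)
qed

section \<open>From distribution functions to moments\<close>

lemma layer_cake_power:
  assumes "0 \<le> y" "y \<le> A"
  shows "y ^ Suc k = (LINT t|lborel. indicator {0..A} t * (real (Suc k) * t ^ k) * (if t < y then 1 else 0 :: real))"
proof -
  have "(LINT t|lborel. indicator {0..A} t * (real (Suc k) * t ^ k) * (if t < y then 1 else 0 :: real)) =
      (LINT t|lborel. real (Suc k) * (t ^ k * indicator {0..y} t))"
  proof (rule integral_cong_AE)
    show "AE t in lborel. indicator {0..A} t * (real (Suc k) * t ^ k) * (if t < y then 1 else 0 :: real)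
       = real (Suc k) * (t ^ k * indicator {0..y} t)"
      using AE_lborel_singleton[of y] by eventually_elim (use assms in \<open>auto simp: indicator_def\<close>)
  qed measurable
  also have "\<dots> = y ^ Suc k" using integral_power[of 0 y k] assms by (simp del: of_nat_Suc)
  finally show ?thesis by simp
qed

text \<open>Writing a power of y as an integral over t < y and exchanging integrals, both moments
  become integrals of the same nonnegative weight, of total mass A^j on [0, A], against 1 minus a
  distribution function. A uniform bound between distribution functions thus passes to the
  moments.\<close>

lemma moment_diff_le:
  fixes N :: "real measure" and w a :: "nat \<Rightarrow> real"
  assumes "real_distribution N" and AE: "AE y in N. 0 < y \<and> y \<le> A" and "A \<ge> 0"
    and P: "finite P" "(\<Sum>p\<in>P. w p) = 1" "\<And>p. p \<in> P \<Longrightarrow> 0 \<le> a p \<and> a p \<le> A"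
    and diff: "\<And>t. \<bar>(\<Sum>p | p \<in> P \<and> a p \<le> t. w p) - cdf N t\<bar> \<le> e"
  shows "\<bar>(\<Sum>p\<in>P. w p * a p ^ j) - (LINT y|N. y ^ j)\<bar> \<le> A ^ j * e"
proof -
  interpret N: real_distribution N by fact
  interpret F: pair_sigma_finite N lborel ..
  have e: "e \<ge> 0" using diff[of 0] by linarith
  show ?thesis
  proof (cases j)
    case 0
    then show ?thesis using P e N.prob_space by simp
  next
    case (Suc k)
    define c where "c = (\<lambda>t. indicator {0..A} t * (real (Suc k) * t ^ k))"
    have [measurable]: "c \<in> borel_measurable borel" unfolding c_def by measurable
    have c_bound: "\<bar>c t\<bar> \<le> real (Suc k) * A ^ k" for t
      using \<open>A \<ge> 0\<close> unfolding c_def by (auto simp: indicator_def abs_mult power_mono intro!: mult_left_mono)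
    have c_nn: "c t \<ge> 0" for t unfolding c_def by (auto simp: indicator_def)
    have c_int: "integrable lborel c"
    proof (rule integrableI_bounded_set[where A="{0..A}" and B="real (Suc k) * A ^ k"])
      show "AE x in lborel. x \<notin> {0..A} \<longrightarrow> c x = 0" by (auto simp: c_def)
    qed (use c_bound \<open>A \<ge> 0\<close> in auto)
    have c_total: "(LINT t|lborel. c t) = A ^ Suc k"
    proof -
      have "(LINT t|lborel. c t) = (LINT t|lborel. real (Suc k) * (t ^ k * indicator {0..A} t))"
        by (intro Bochner_Integration.integral_cong) (auto simp: c_def)
      then show ?thesis using integral_power[of 0 A k] \<open>A \<ge> 0\<close> by (simp del: of_nat_Suc)
    qed
    define f where "f = (\<lambda>y t. c t * (if t < y then 1 else 0 :: real))"
    have f_int: "integrable (N \<Otimes>\<^sub>M lborel) (case_prod f)"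
    proof (rule integrableI_bounded_set[where A="space N \<times> {0..A}" and B="real (Suc k) * A ^ k"])
      show "case_prod f \<in> borel_measurable (N \<Otimes>\<^sub>M lborel)" unfolding f_def by measurable
      show "emeasure (N \<Otimes>\<^sub>M lborel) (space N \<times> {0..A}) < \<infinity>"
        using \<open>A \<ge> 0\<close> N.emeasure_space_1 by (subst lborel.emeasure_pair_measure_Times) auto
      show "AE x in N \<Otimes>\<^sub>M lborel. x \<in> space N \<times> {0..A} \<longrightarrow> norm (case_prod f x) \<le> real (Suc k) * A ^ k"
        using c_bound order_trans[OF abs_ge_zero c_bound] by (auto simp: f_def split_beta abs_mult simp del: of_nat_Suc)
      show "AE x in N \<Otimes>\<^sub>M lborel. x \<notin> space N \<times> {0..A} \<longrightarrow> case_prod f x = 0"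
        by (intro AE_I2) (auto simp: f_def c_def split_beta mem_Times_iff indicator_def)
    qed auto
    have cdf: "(LINT y|N. f y t) = c t * (1 - cdf N t)" for t
    proof -
      have "(LINT y|N. f y t) = c t * (LINT y|N. indicator {t<..} y)"
        unfolding f_def by (subst integral_mult_right_zero[symmetric]) (auto intro!: Bochner_Integration.integral_cong simp: indicator_def)
      also have "(LINT y|N. indicator {t<..} y) = N.prob {t<..}" by simp
      also have "{t<..} = space N - {..t}" by auto
      also have "N.prob \<dots> = 1 - cdf N t" unfolding cdf_def by (intro N.prob_compl) auto
      finally show ?thesis .
    qed
    have "(LINT y|N. y ^ Suc k) = (LINT y|N. LINT t|lborel. f y t)"
    proof (rule integral_cong_AE)
      show "AE y in N. y ^ Suc k = (LINT t|lborel. f y t)"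
        using AE by eventually_elim (use layer_cake_power in \<open>auto simp: f_def c_def\<close>)
      show "(\<lambda>y. LINT t|lborel. f y t) \<in> borel_measurable N" unfolding f_def by measurable
    qed measurable
    also have "\<dots> = (LINT t|lborel. LINT y|N. f y t)" using F.Fubini_integral[OF f_int] by simp
    finally have 1: "(LINT y|N. y ^ Suc k) = (LINT t|lborel. c t * (1 - cdf N t))" unfolding cdf .
    have int1: "integrable lborel (\<lambda>t. c t * (1 - cdf N t))"
      using F.integrable_snd[OF f_int] unfolding cdf .
    define S where "S = (\<lambda>t. \<Sum>p | p \<in> P \<and> a p \<le> t. w p)"
    have intp: "integrable lborel (\<lambda>t. c t * (if t < a p then 1 else 0 :: real))" for p
      by (rule Bochner_Integration.integrable_bound[OF c_int]) (auto simp: abs_mult)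
    have sumS: "(\<Sum>p\<in>P. w p * (c t * (if t < a p then 1 else 0))) = c t * (1 - S t)" for t
    proof -
      have "(\<Sum>p\<in>P. w p * (c t * (if t < a p then 1 else 0))) = c t * (\<Sum>p\<in>P. w p - (if a p \<le> t then w p else 0))"
        unfolding sum_distrib_left by (intro sum.cong) auto
      also have "(\<Sum>p\<in>P. w p - (if a p \<le> t then w p else 0)) = 1 - S t"
        unfolding S_def sum_subtractf P(2) using P(1) by (simp add: sum.inter_filter[symmetric])
      finally show ?thesis .
    qed
    have 2: "(\<Sum>p\<in>P. w p * a p ^ Suc k) = (LINT t|lborel. c t * (1 - S t))"
    proof -
      have "(\<Sum>p\<in>P. w p * a p ^ Suc k) = (\<Sum>p\<in>P. w p * (LINT t|lborel. c t * (if t < a p then 1 else 0)))"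
        using P(3) layer_cake_power[of _ A k] by (intro sum.cong) (auto simp: c_def)
      also have "\<dots> = (LINT t|lborel. (\<Sum>p\<in>P. w p * (c t * (if t < a p then 1 else 0))))"
        using intp by (subst Bochner_Integration.integral_sum) auto
      finally show ?thesis unfolding sumS .
    qed
    have "integrable lborel (\<lambda>t. \<Sum>p\<in>P. w p * (c t * (if t < a p then 1 else 0)))"
      using intp by (intro Bochner_Integration.integrable_sum integrable_mult_right) auto
    then have int2: "integrable lborel (\<lambda>t. c t * (1 - S t))" unfolding sumS .
    have "(\<Sum>p\<in>P. w p * a p ^ Suc k) - (LINT y|N. y ^ Suc k) = (LINT t|lborel. c t * (1 - S t) - c t * (1 - cdf N t))"
      unfolding 1 2 using int1 int2 by simp
    also have "\<bar>\<dots>\<bar> \<le> (LINT t|lborel. c t * e)"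
    proof (rule integral_abs_bound_integral)
      show "integrable lborel (\<lambda>t. c t * (1 - S t) - c t * (1 - cdf N t))" using int1 int2 by simp
      show "integrable lborel (\<lambda>t. c t * e)" using c_int by simp
      fix t
      have "\<bar>c t * (1 - S t) - c t * (1 - cdf N t)\<bar> = c t * \<bar>S t - cdf N t\<bar>"
        using c_nn[of t] by (simp add: abs_mult abs_minus_commute flip: right_diff_distrib)
      also have "\<dots> \<le> c t * e" using c_nn diff[of t] by (intro mult_left_mono) (auto simp: S_def)
      finally show "\<bar>c t * (1 - S t) - c t * (1 - cdf N t)\<bar> \<le> c t * e" .
    qed
    also have "\<dots> = A ^ Suc k * e" using c_total by simp
    finally show ?thesis using Suc by simp
  qed
qed

section \<open>Cumulants of point masses and of averages over primes\<close>

lemma moment_seq_point: "moment_seq (\<lambda>j. x ^ j) (max 1 \<bar>x\<bar>)"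
proof
  fix j show "\<bar>x ^ j\<bar> \<le> max 1 \<bar>x\<bar> ^ j" by (simp add: power_abs power_mono)
qed auto

text \<open>Multiplied by x^2 rather than divided, so that it covers x = 0, a value that g p may
  take.\<close>

lemma cumulant_point: "cumulant 2 (\<lambda>j. x ^ j) z * of_real x ^ 2 = exp (z * of_real x) - 1 - z * of_real x"
proof -
  interpret moment_seq "\<lambda>j. x ^ j" "max 1 \<bar>x\<bar>" by (rule moment_seq_point)
  let ?w = "z * of_real x" let ?c = "\<lambda>n. cumulant_coeff 2 (\<lambda>j. x ^ j) n * z ^ n"
  have "cumulant 2 (\<lambda>j. x ^ j) z = (\<Sum>n. ?c (n + 2))"
    unfolding cumulant_def using suminf_split_initial_segment[OF summable_coeff, where k = 2]
    by (simp add: numeral_2_eq_2 cumulant_coeff_def)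
  then have "cumulant 2 (\<lambda>j. x ^ j) z * of_real x ^ 2 = (\<Sum>n. ?c (n + 2) * of_real x ^ 2)"
    by (simp only: suminf_mult2[OF summable_ignore_initial_segment[OF summable_coeff]])
  also have "\<dots> = (\<Sum>n. ?w ^ (n + 2) /\<^sub>R fact (n + 2))"
    by (intro suminf_cong) (simp add: cumulant_coeff_def scaleR_conv_of_real power_mult_distrib power_add power2_eq_square divide_inverse)
  also have "\<dots> = exp ?w - (\<Sum>n<2. ?w ^ n /\<^sub>R fact n)"
    unfolding exp_def using suminf_minus_initial_segment[OF summable_exp_generic] by blast
  finally show ?thesis by (simp add: numeral_2_eq_2)
qed

lemma cumulant_sum:
  assumes "finite P" "\<And>p. p \<in> P \<Longrightarrow> moment_seq (m p) (A p)"
  shows "cumulant k (\<lambda>j. \<Sum>p\<in>P. w p * m p j) z = (\<Sum>p\<in>P. of_real (w p) * cumulant k (m p) z)"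
proof -
  have "cumulant k (\<lambda>j. \<Sum>p\<in>P. w p * m p j) z = (\<Sum>n. \<Sum>p\<in>P. of_real (w p) * (cumulant_coeff k (m p) n * z ^ n))"
    unfolding cumulant_def
    by (intro suminf_cong) (auto simp: cumulant_coeff_def sum_divide_distrib sum_distrib_right sum_distrib_left mult_ac intro!: sum.cong)
  also have "\<dots> = (\<Sum>p\<in>P. \<Sum>n. of_real (w p) * (cumulant_coeff k (m p) n * z ^ n))"
    using assms by (intro suminf_sum summable_mult moment_seq.summable_coeff)
  also have "\<dots> = (\<Sum>p\<in>P. of_real (w p) * cumulant k (m p) z)"
    unfolding cumulant_def using assms by (intro sum.cong suminf_mult moment_seq.summable_coeff) auto
  finally show ?thesis .
qed

text \<open>Moments of the measure with mass (g p)^2 / (p * B^2) at g p; its distribution function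
  is the left side of the hypothesis on \<Psi>.\<close>

definition prime_moment :: "(nat \<Rightarrow> real) \<Rightarrow> real \<Rightarrow> nat \<Rightarrow> real" where
  "prime_moment g x j = (\<Sum>p | prime p \<and> real p \<le> x. (g p)\<^sup>2 / real p / (B g x)\<^sup>2 * g p ^ j)"

lemma finite_primes_le_real [simp, intro]: "finite {p. prime p \<and> real p \<le> x}"
  by (rule finite_subset[OF _ finite_nat_le_real[of x]]) (auto dest: prime_ge_1_nat)

lemma B_squared: "(B g x)\<^sup>2 = (\<Sum>p | prime p \<and> real p \<le> x. (g p)\<^sup>2 / real p)"
  unfolding B_def by (intro real_sqrt_pow2 sum_nonneg) auto

lemma prime_cumulant_eq:
  assumes "B g x > 0"
  shows "prime_cumulant g x z = of_real ((B g x)\<^sup>2) * cumulant 2 (prime_moment g x) z"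
proof -
  have "of_real ((B g x)\<^sup>2) * cumulant 2 (prime_moment g x) z =
     of_real ((B g x)\<^sup>2) * (\<Sum>p | prime p \<and> real p \<le> x. of_real ((g p)\<^sup>2 / real p / (B g x)\<^sup>2) * cumulant 2 (\<lambda>j. g p ^ j) z)"
    unfolding prime_moment_def using moment_seq_point by (subst cumulant_sum[OF finite_primes_le_real]) auto
  also have "\<dots> = (\<Sum>p | prime p \<and> real p \<le> x. (cumulant 2 (\<lambda>j. g p ^ j) z * of_real (g p) ^ 2) / of_nat p)"
    unfolding sum_distrib_left using assms by (intro sum.cong) (auto simp: field_simps)
  also have "\<dots> = prime_cumulant g x z" unfolding prime_cumulant_def cumulant_point ..
  finally show ?thesis by simp
qed

section \<open>The measure with distribution function \<Psi> and its cumulants\<close>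

locale limit_law =
  fixes \<Psi> :: "real \<Rightarrow> real" and \<alpha> :: real
  assumes df: "distribution_function \<Psi>" and alpha: "\<alpha> > 0" and mass: "\<Psi> \<alpha> - \<Psi> 0 = 1"
begin

abbreviation "N \<equiv> interval_measure \<Psi>"

lemma real_distribution_N: "real_distribution N" and cdf_N: "cdf N = \<Psi>"
proof -
  have *: "\<And>x y. x \<le> y \<Longrightarrow> \<Psi> x \<le> \<Psi> y" "\<And>a. continuous (at_right a) \<Psi>"
    "(\<Psi> \<longlongrightarrow> 0) at_bot" "(\<Psi> \<longlongrightarrow> 1) at_top"
    using df by (auto simp: distribution_function_def mono_def)
  show "real_distribution N" using * by (intro real_distribution_interval_measure) auto
  show "cdf N = \<Psi>" using * by (intro cdf_interval_measure) auto
qed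

sublocale N: real_distribution N by (rule real_distribution_N)

lemma AE_N: "AE y in N. 0 < y \<and> y \<le> \<alpha>"
proof -
  have "N.prob {0<..\<alpha>} = 1" using N.cdf_diff_eq[OF alpha] mass by (simp add: cdf_N)
  then have "AE y in N. y \<in> {0<..\<alpha>}" by (intro N.AE_prob_1)
  then show ?thesis by auto
qed

definition law_moment :: "nat \<Rightarrow> real" where "law_moment j = (LINT y|N. y ^ j)"

lemma integrable_power_N: "integrable N (\<lambda>y. y ^ j)"
proof (rule N.integrable_const_bound[where B="\<alpha> ^ j"])
  show "AE y in N. norm (y ^ j) \<le> \<alpha> ^ j"
    using AE_N by eventually_elim (auto simp: power_abs intro!: power_mono)
qed simp

lemma moment_seq_law:
  assumes "A \<ge> 1" "A \<ge> \<alpha>" shows "moment_seq law_moment A"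
proof
  fix j
  have "\<bar>law_moment j\<bar> \<le> (LINT y|N. \<bar>y ^ j\<bar>)"
    unfolding law_moment_def using integral_norm_bound[of N "\<lambda>y. y ^ j"] by simp
  also have "\<dots> \<le> (LINT y|N. A ^ j)"
  proof (rule integral_mono_AE)
    show "AE y in N. \<bar>y ^ j\<bar> \<le> A ^ j" using AE_N
      by eventually_elim (use assms in \<open>auto simp: power_abs intro!: power_mono\<close>)
  qed (use integrable_power_N in auto)
  finally show "\<bar>law_moment j\<bar> \<le> A ^ j" using N.prob_space by simp
  show "law_moment 0 = 1" unfolding law_moment_def using N.prob_space by simp
qed (use assms in auto)

text \<open>The integrand is expanded in powers of z = i t and integrated term by term, dominated by
  the series of (A * norm z)^n / n!. Almost surely 0 < x <= \<alpha>, so the indicator is 1 and the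
  division by x^2 is a true one.\<close>

lemma Z_exponent_eq: "Z_exponent \<Psi> t = cumulant 2 law_moment (\<i> * of_real t)"
proof -
  define z where "z = \<i> * complex_of_real t"
  define A where "A = max 1 \<alpha>"
  define f where "f = (\<lambda>n (x::real). cumulant_coeff 2 (\<lambda>j. x ^ j) n * z ^ n)"
  have A: "A \<ge> 1" "A \<ge> \<alpha>" by (auto simp: A_def)
  have f_meas [measurable]: "f n \<in> borel_measurable borel" for n
    unfolding f_def cumulant_coeff_def by (cases "n < 2") simp_all
  have bound: "AE x in N. norm (f n x) \<le> (A * norm z) ^ n / fact n" for n
    using AE_N
  proof eventually_elim
    case (elim x)
    interpret moment_seq "\<lambda>j. x ^ j" A
      using elim A by unfold_locales (auto simp: power_abs intro!: power_mono)
    show ?case unfolding f_def by (rule coeff_bound)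
  qed
  have s: "summable (\<lambda>n. (A * norm z) ^ n / fact n)" using summable_exp[of "A * norm z"] by (simp add: field_simps)
  have int: "integrable N (f n)" for n
    using bound by (intro N.integrable_const_bound[where B="(A * norm z) ^ n / fact n"]) auto
  have "Z_exponent \<Psi> t = (LINT x|N. (\<Sum>n. f n x))"
    unfolding Z_exponent_def set_lebesgue_integral_def
  proof (rule integral_cong_AE)
    show "AE x in N. indicator {0<..} x *\<^sub>R ((exp (\<i> * of_real t * of_real x) - \<i> * of_real t * of_real x - 1) / (of_real x)\<^sup>2) = (\<Sum>n. f n x)"
      using AE_N
    proof eventually_elim
      case (elim x)
      then have "cumulant 2 (\<lambda>j. x ^ j) z = (exp (z * of_real x) - 1 - z * of_real x) / of_real x ^ 2"
        unfolding cumulant_point[symmetric] by simp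
      then show ?case using elim unfolding f_def cumulant_def z_def by (simp add: algebra_simps)
    qed
  qed measurable
  also have "\<dots> = (\<Sum>n. LINT x|N. f n x)"
  proof (rule integral_suminf[OF int])
    have "AE x in N. \<forall>n. norm (f n x) \<le> (A * norm z) ^ n / fact n" using bound by (simp add: AE_all_countable)
    then show "AE x in N. summable (\<lambda>n. norm (f n x))"
      by eventually_elim (rule summable_comparison_test'[OF s], auto)
    show "summable (\<lambda>n. LINT x|N. norm (f n x))"
    proof (rule summable_comparison_test'[OF s])
      fix n :: nat
      have "(LINT x|N. norm (f n x)) \<le> (LINT x|N. (A * norm z) ^ n / fact n)"
        using bound int by (intro integral_mono_AE) auto
      then show "norm (LINT x|N. norm (f n x)) \<le> (A * norm z) ^ n / fact n" using N.prob_space by simp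
    qed
  qed
  also have "\<dots> = cumulant 2 law_moment z"
    unfolding cumulant_def
  proof (rule suminf_cong)
    fix n
    show "(LINT x|N. f n x) = cumulant_coeff 2 law_moment n * z ^ n"
    proof (cases "n < 2")
      case False
      have "(LINT x|N. f n x) = (LINT x|N. of_real (x ^ (n - 2)) * (z ^ n / fact n))"
        using False by (intro Bochner_Integration.integral_cong) (auto simp: f_def cumulant_coeff_def)
      also have "\<dots> = of_real (law_moment (n - 2)) * (z ^ n / fact n)"
        unfolding law_moment_def by (subst integral_mult_left_zero) (simp only: integral_complex_of_real)
      finally show ?thesis using False by (simp add: cumulant_coeff_def)
    qed (simp add: f_def cumulant_coeff_def)
  qed
  finally show ?thesis unfolding z_def .
qed

lemma prime_cumulant_approx:
  assumes M: "\<And>p. prime p \<Longrightarrow> 0 \<le> g p \<and> g p \<le> M" and A: "A \<ge> 1" "A \<ge> \<alpha>" "A \<ge> M"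
    and B: "B g x > 0"
    and hyp: "\<And>t. \<bar>1 / (B g x)\<^sup>2 * (\<Sum>p | prime p \<and> real p \<le> x \<and> g p \<le> t. (g p)\<^sup>2 / real p) - \<Psi> t\<bar> \<le> C * (1 / (B g x)\<^sup>2)"
    and z: "norm z \<le> R" and R: "R \<ge> 1"
  shows "norm (prime_cumulant g x z - of_real ((B g x)\<^sup>2) * cumulant 2 law_moment z) \<le> exp (A * R) * C * norm z ^ 3"
    and "moment_seq (prime_moment g x) A"
proof -
  let ?P = "{p. prime p \<and> real p \<le> x}"
  have w: "(\<Sum>p\<in>?P. (g p)\<^sup>2 / real p / (B g x)\<^sup>2) = 1"
  proof -
    have "(\<Sum>p\<in>?P. (g p)\<^sup>2 / real p / (B g x)\<^sup>2) = (\<Sum>p\<in>?P. (g p)\<^sup>2 / real p) / (B g x)\<^sup>2"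
      by (rule sum_divide_distrib[symmetric])
    then show ?thesis using B unfolding B_squared[symmetric] by simp
  qed
  have diff: "\<bar>prime_moment g x j - law_moment j\<bar> \<le> A ^ j * (C * (1 / (B g x)\<^sup>2))" for j
    unfolding prime_moment_def law_moment_def
  proof (rule moment_diff_le[OF real_distribution_N _ _ finite_primes_le_real w])
    show "AE y in N. 0 < y \<and> y \<le> A" using AE_N by eventually_elim (use A in auto)
    fix t
    have "(\<Sum>p | p \<in> ?P \<and> g p \<le> t. (g p)\<^sup>2 / real p / (B g x)\<^sup>2) = 1 / (B g x)\<^sup>2 * (\<Sum>p | prime p \<and> real p \<le> x \<and> g p \<le> t. (g p)\<^sup>2 / real p)"
      unfolding sum_distrib_left by (intro sum.cong) auto
    then show "\<bar>(\<Sum>p | p \<in> ?P \<and> g p \<le> t. (g p)\<^sup>2 / real p / (B g x)\<^sup>2) - cdf N t\<bar> \<le> C * (1 / (B g x)\<^sup>2)"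
      using hyp[of t] by (simp add: cdf_N)
  next
    show "0 \<le> g p \<and> g p \<le> A" if "p \<in> ?P" for p using M[of p] that A by auto
  qed (use A in auto)
  show ms: "moment_seq (prime_moment g x) A"
  proof
    fix j
    have "\<bar>prime_moment g x j\<bar> \<le> (\<Sum>p\<in>?P. (g p)\<^sup>2 / real p / (B g x)\<^sup>2 * A ^ j)"
      unfolding prime_moment_def
    proof (intro order_trans[OF sum_abs] sum_mono)
      fix p assume "p \<in> ?P"
      then have gp: "0 \<le> g p" "g p \<le> A" using M[of p] A by auto
      have "(g p)\<^sup>2 / real p / (B g x)\<^sup>2 * g p ^ j \<le> (g p)\<^sup>2 / real p / (B g x)\<^sup>2 * A ^ j"
        using gp by (intro mult_left_mono power_mono) auto
      then show "\<bar>(g p)\<^sup>2 / real p / (B g x)\<^sup>2 * g p ^ j\<bar> \<le> (g p)\<^sup>2 / real p / (B g x)\<^sup>2 * A ^ j"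
        using gp by simp
    qed
    also have "\<dots> = A ^ j" using w by (simp only: mult_1 flip: sum_distrib_right)
    finally show "\<bar>prime_moment g x j\<bar> \<le> A ^ j" .
    show "prime_moment g x 0 = 1" unfolding prime_moment_def using w by simp
  qed (use A in auto)
  have "norm (prime_cumulant g x z - of_real ((B g x)\<^sup>2) * cumulant 2 law_moment z) =
     (B g x)\<^sup>2 * norm (cumulant 2 (prime_moment g x) z - cumulant 2 law_moment z)"
    unfolding prime_cumulant_eq[OF B] by (simp add: norm_mult norm_power flip: right_diff_distrib)
  also have "\<dots> \<le> (B g x)\<^sup>2 * (exp (A * R) * (C * (1 / (B g x)\<^sup>2)) * norm z ^ 3)"
    using diff z R by (intro mult_left_mono cumulant_diff_bound[OF ms moment_seq_law]) (use A in auto)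
  also have "\<dots> = exp (A * R) * C * norm z ^ 3" using B by simp
  finally show "norm (prime_cumulant g x z - of_real ((B g x)\<^sup>2) * cumulant 2 law_moment z) \<le> exp (A * R) * C * norm z ^ 3" .
qed

end

section \<open>Exponential moments of the limit law\<close>

lemma poisson_mgf:
  fixes w :: complex
  assumes "r > 0"
  shows "integrable (measure_pmf (poisson_pmf r)) (\<lambda>k. exp (w * of_nat k))"
    and "(LINT k|measure_pmf (poisson_pmf r). exp (w * of_nat k)) = exp (of_real r * (exp w - 1))"
proof -
  let ?f = "\<lambda>k. pmf (poisson_pmf r) k *\<^sub>R exp (w * of_nat k)"
  have f: "?f k = exp (- of_real r) * ((of_real r * exp w) ^ k /\<^sub>R fact k)" for k
    using assms by (simp add: scaleR_conv_of_real exp_of_nat_mult power_mult_distrib field_simps exp_of_real exp_minus)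
      (simp add: exp_of_nat2_mult)
  have s: "summable (\<lambda>k. norm (?f k))"
    unfolding f norm_mult by (intro summable_mult summable_norm_exp)
  have int: "integrable (count_space UNIV) ?f" using s by (simp add: integrable_count_space_nat_iff)
  then show "integrable (measure_pmf (poisson_pmf r)) (\<lambda>k. exp (w * of_nat k))"
    unfolding measure_pmf_eq_density by (subst integrable_density) auto
  have "(LINT k|measure_pmf (poisson_pmf r). exp (w * of_nat k)) = (LINT k|count_space UNIV. ?f k)"
    unfolding measure_pmf_eq_density by (subst integral_density) auto
  also have "\<dots> = (\<Sum>k. ?f k)" using int by (rule integral_count_space_nat)
  also have "\<dots> = exp (- of_real r) * exp (of_real r * exp w)"
    unfolding f by (simp only: suminf_mult[OF summable_exp_generic]) (simp only: exp_def)
  finally show "(LINT k|measure_pmf (poisson_pmf r). exp (w * of_nat k)) = exp (of_real r * (exp w - 1))"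
    by (simp add: mult_exp_exp algebra_simps)
qed

text \<open>Realised on a product space as the sum of a i times independent centred Poisson
  variables. This supplies approximating laws whose exponential moments are known at every complex
  z, hence on both the real and the imaginary axis.\<close>

lemma compound_poisson_exists:
  fixes r a :: "nat \<Rightarrow> real"
  assumes "finite I" "\<And>i. i \<in> I \<Longrightarrow> r i > 0"
  shows "\<exists>K. real_distribution K \<and> (\<forall>z::complex. integrable K (\<lambda>w. exp (z * of_real w)) \<and>
     (LINT w|K. exp (z * of_real w)) = exp (\<Sum>i\<in>I. of_real (r i) * (exp (z * of_real (a i)) - 1 - z * of_real (a i))))"
proof -
  define M where "M = (\<lambda>i. measure_pmf (poisson_pmf (r i)))"
  interpret product_prob_space M I
    unfolding M_def by unfold_locales
  define Y where "Y = (\<lambda>\<omega>. \<Sum>i\<in>I. a i * (real (\<omega> i) - r i))"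
  have comp [measurable]: "(\<lambda>\<omega>. h (\<omega> i)) \<in> borel_measurable (Pi\<^sub>M I M)" if "i \<in> I" for i and h :: "nat \<Rightarrow> real"
    by (rule measurable_compose[OF measurable_component_singleton[OF that]]) (simp add: M_def)
  have Y [measurable]: "Y \<in> borel_measurable (Pi\<^sub>M I M)"
    unfolding Y_def by (intro borel_measurable_sum borel_measurable_times borel_measurable_diff comp) auto
  define K where "K = distr (Pi\<^sub>M I M) borel Y"
  have K: "real_distribution K" unfolding K_def by (rule real_distribution_distr) simp
  have "integrable K (\<lambda>w. exp (z * of_real w)) \<and>
     (LINT w|K. exp (z * of_real w)) = exp (\<Sum>i\<in>I. of_real (r i) * (exp (z * of_real (a i)) - 1 - z * of_real (a i)))" for z :: complex
  proof -
    define f where "f = (\<lambda>i k. exp ((z * of_real (a i)) * of_nat k) * exp (- z * of_real (a i) * of_real (r i)))"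
    have eq: "exp (z * of_real (Y \<omega>)) = (\<Prod>i\<in>I. f i (\<omega> i))" for \<omega>
      unfolding Y_def f_def of_real_sum sum_distrib_left exp_sum[OF \<open>finite I\<close>] mult_exp_exp
      by (intro prod.cong arg_cong[where f=exp]) (auto simp: algebra_simps)
    have int: "integrable (M i) (f i)" if "i \<in> I" for i
      unfolding M_def f_def using that assms by (intro integrable_mult_left poisson_mgf) auto
    have val: "integral\<^sup>L (M i) (f i) = exp (of_real (r i) * (exp (z * of_real (a i)) - 1 - z * of_real (a i)))" if "i \<in> I" for i
    proof -
      have "integral\<^sup>L (M i) (f i) = exp (of_real (r i) * (exp (z * of_real (a i)) - 1)) * exp (- z * of_real (a i) * of_real (r i))"
        unfolding M_def f_def by (subst integral_mult_left_zero) (simp only: poisson_mgf(2)[OF assms(2)[OF that]])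
      then show ?thesis by (simp add: mult_exp_exp algebra_simps)
    qed
    have m: "(\<lambda>w. exp (z * complex_of_real w)) \<in> borel_measurable borel" by measurable
    have "integrable K (\<lambda>w. exp (z * of_real w))"
      unfolding K_def integrable_distr_eq[OF Y m] eq using int \<open>finite I\<close> by (intro product_integrable_prod)
    moreover have "(LINT w|K. exp (z * of_real w)) = (\<Prod>i\<in>I. integral\<^sup>L (M i) (f i))"
      unfolding K_def integral_distr[OF Y m] eq using int \<open>finite I\<close> by (intro product_integral_prod)
    ultimately show ?thesis using val \<open>finite I\<close> by (simp add: exp_sum)
  qed
  then show ?thesis using K by blast
qed

section \<open>Exponential moments under weak convergence\<close>

lemma norm_exp_of_real_times: "norm (exp (z * complex_of_real w)) = exp (Re z * w)"
  by simp

lemma abs_times_exp_le: "\<bar>w\<bar> * exp (s * w) \<le> exp ((s + 1) * w) + exp ((s - 1) * w)" for w s :: real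
proof -
  have "\<bar>w\<bar> \<le> exp \<bar>w\<bar>" using exp_ge_add_one_self[of "\<bar>w\<bar>"] by linarith
  also have "\<dots> \<le> exp w + exp (- w)" by (cases "w \<ge> 0") (auto simp: add_increasing add_increasing2)
  finally have "\<bar>w\<bar> * exp (s * w) \<le> (exp w + exp (- w)) * exp (s * w)" by (intro mult_right_mono) auto
  then show ?thesis by (simp add: algebra_simps mult_exp_exp)
qed

lemma norm_diff_triangle3: "norm (a - d) \<le> norm (a - b) + norm (b - c) + norm (d - c)"
  for a b c d :: "'a::real_normed_vector"
  using norm_triangle_ineq4[of "(a - b) + (b - c)" "d - c"] norm_triangle_ineq[of "a - b" "b - c"] by simp

text \<open>Weak convergence tests bounded functions only. Fatou's lemma along a Skorohod coupling
  makes the exponentials integrable for the limit, with the same bounds; the tails are then cut off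
  uniformly, since the modulus of w times exp (s w) is dominated by the exponentials at s + 1 and s
  - 1.\<close>

lemma weak_conv_exp_moment:
  assumes K: "\<And>n. real_distribution (K n)" and N: "real_distribution N" and conv: "weak_conv_m K N"
    and int: "\<And>n s. integrable (K n) (\<lambda>w. exp (s * w :: real))"
    and bd: "\<And>s. \<exists>C. \<forall>n. (LINT w|K n. exp (s * w)) \<le> C"
  shows "integrable N (\<lambda>w. exp (s * w :: real))"
    and "(\<lambda>n. LINT w|K n. exp (z * of_real w)) \<longlonglongrightarrow> (LINT w|N. exp (z * complex_of_real w))"
proof -
  interpret K: real_distribution "K n" for n by (rule K)
  interpret N: real_distribution N by (rule N)
  \<comment> \<open>The bound C is carried over to N as well, because the truncation estimate is
    applied to N with the constants of the sequence.\<close>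
  have *: "integrable N (\<lambda>w. exp (s * w)) \<and> (\<forall>C. (\<forall>n. (LINT w|K n. exp (s * w)) \<le> C) \<longrightarrow> (LINT w|N. exp (s * w)) \<le> C)" for s :: real
  proof -
    obtain C where C: "\<And>n. (LINT w|K n. exp (s * w)) \<le> C" using bd[of s] by blast
    obtain Om :: "real measure" and Y_seq Y where
      Om: "prob_space Om" and Yn [measurable]: "\<And>n. Y_seq n \<in> borel_measurable Om"
      and dn: "\<And>n. distr Om borel (Y_seq n) = K n"
      and Y [measurable]: "Y \<in> borel_measurable Om" and d: "distr Om borel Y = N"
      and lim: "\<And>x. x \<in> space Om \<Longrightarrow> (\<lambda>n. Y_seq n x) \<longlonglongrightarrow> Y x"
      using Skorohod[OF K N conv] by (metis measurable_lborel1 measurable_lborel2)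
    have le: "(\<integral>\<^sup>+w. ennreal (exp (s * w)) \<partial>N) \<le> ennreal C" if C: "\<And>n. (LINT w|K n. exp (s * w)) \<le> C" for C
    proof -
      have "(\<integral>\<^sup>+w. ennreal (exp (s * w)) \<partial>N) = (\<integral>\<^sup>+x. ennreal (exp (s * Y x)) \<partial>Om)"
        unfolding d[symmetric] by (subst nn_integral_distr) auto
      also have "\<dots> = (\<integral>\<^sup>+x. liminf (\<lambda>n. ennreal (exp (s * Y_seq n x))) \<partial>Om)"
      proof (rule nn_integral_cong)
        fix x assume "x \<in> space Om"
        then have "(\<lambda>n. ennreal (exp (s * Y_seq n x))) \<longlonglongrightarrow> ennreal (exp (s * Y x))"
          using lim by (intro tendsto_ennrealI tendsto_intros)
        then show "ennreal (exp (s * Y x)) = liminf (\<lambda>n. ennreal (exp (s * Y_seq n x)))"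
          by (rule lim_imp_Liminf[symmetric, OF trivial_limit_sequentially])
      qed
      also have "\<dots> \<le> liminf (\<lambda>n. \<integral>\<^sup>+x. ennreal (exp (s * Y_seq n x)) \<partial>Om)"
        by (rule nn_integral_liminf) measurable
      also have "\<dots> \<le> ennreal C"
      proof (rule Liminf_le)
        show "\<forall>\<^sub>F n in sequentially. (\<integral>\<^sup>+x. ennreal (exp (s * Y_seq n x)) \<partial>Om) \<le> ennreal C"
        proof (rule always_eventually, rule allI)
          fix n
          have "(\<integral>\<^sup>+x. ennreal (exp (s * Y_seq n x)) \<partial>Om) = (\<integral>\<^sup>+w. ennreal (exp (s * w)) \<partial>K n)"
            unfolding dn[symmetric] by (subst nn_integral_distr) auto
          also have "\<dots> = ennreal (LINT w|K n. exp (s * w))"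
            using int by (intro nn_integral_eq_integral) auto
          finally show "(\<integral>\<^sup>+x. ennreal (exp (s * Y_seq n x)) \<partial>Om) \<le> ennreal C" using C by (simp add: ennreal_leI)
        qed
      qed simp
      finally show ?thesis .
    qed
    have i: "integrable N (\<lambda>w. exp (s * w))"
      by (rule integrableI_bounded) (use le[OF C] in \<open>auto simp: less_top[symmetric] top_unique\<close>)
    have "(LINT w|N. exp (s * w)) \<le> C" if C: "\<And>n. (LINT w|K n. exp (s * w)) \<le> C" for C
    proof -
      have "0 \<le> (LINT w|K 0. exp (s * w))" by (rule Bochner_Integration.integral_nonneg) simp
      then have "C \<ge> 0" using C[of 0] by linarith
      have "ennreal (LINT w|N. exp (s * w)) \<le> ennreal C" using le[OF C] i by (subst nn_integral_eq_integral[symmetric]) auto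
      then show ?thesis using \<open>C \<ge> 0\<close> by simp
    qed
    then show ?thesis using i by blast
  qed
  then show "integrable N (\<lambda>w. exp (s * w))" by blast
  obtain C1 where C1: "\<And>n. (LINT w|K n. exp ((Re z + 1) * w)) \<le> C1" using bd by metis
  obtain C2 where C2: "\<And>n. (LINT w|K n. exp ((Re z - 1) * w)) \<le> C2" using bd by metis
  define C where "C = C1 + C2"
  \<comment> \<open>Tent function of radius R: it makes the integrand bounded and continuous, and 1
    - \<open>ps R w\<close> is at most \<bar>w\<bar> / R, which gives the tail bound C / R.\<close>
  define ps where "ps = (\<lambda>R w::real. max 0 (1 - \<bar>w\<bar> / R))"
  have trunc: "norm ((LINT w|L. exp (z * of_real w)) - (LINT w|L. exp (z * of_real w) * of_real (ps R w))) \<le> C / R"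
    if L: "real_distribution L" "\<And>s. integrable L (\<lambda>w. exp (s * w))" "(LINT w|L. exp ((Re z + 1) * w)) \<le> C1" "(LINT w|L. exp ((Re z - 1) * w)) \<le> C2" and R: "R > 0" for L R
  proof -
    interpret L: real_distribution L by fact
    have i1: "integrable L (\<lambda>w. exp (z * of_real w))"
      by (rule Bochner_Integration.integrable_bound[OF L(2)[of "Re z"]]) auto
    have i2: "integrable L (\<lambda>w. exp (z * of_real w) * of_real (ps R w))"
      by (rule Bochner_Integration.integrable_bound[OF L(2)[of "Re z"]]) (use R in \<open>auto simp: ps_def norm_mult intro!: mult_left_le\<close>)
    have "(LINT w|L. exp (z * of_real w)) - (LINT w|L. exp (z * of_real w) * of_real (ps R w)) =
        (LINT w|L. exp (z * of_real w) * of_real (1 - ps R w))"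
      using i1 i2 by (subst Bochner_Integration.integral_diff[symmetric]) (auto simp: algebra_simps)
    also have "norm \<dots> \<le> (LINT w|L. (exp ((Re z + 1) * w) + exp ((Re z - 1) * w)) / R)"
    proof (rule Bochner_Integration.integral_norm_bound_integral)
      show "integrable L (\<lambda>w. exp (z * of_real w) * of_real (1 - ps R w))"
        using Bochner_Integration.integrable_diff[OF i1 i2] by (simp add: algebra_simps)
      show "integrable L (\<lambda>w. (exp ((Re z + 1) * w) + exp ((Re z - 1) * w)) / R)" using L(2) by auto
      fix w :: real
      have "1 - ps R w \<ge> 0" "1 - ps R w \<le> \<bar>w\<bar> / R" using R by (auto simp: ps_def)
      then have "norm (exp (z * of_real w) * of_real (1 - ps R w)) \<le> exp (Re z * w) * (\<bar>w\<bar> / R)"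
        unfolding norm_mult norm_exp_of_real_times norm_of_real by (intro mult_left_mono) auto
      also have "\<dots> = \<bar>w\<bar> * exp (Re z * w) / R" by simp
      also have "\<dots> \<le> (exp ((Re z + 1) * w) + exp ((Re z - 1) * w)) / R"
        using abs_times_exp_le R by (intro divide_right_mono) auto
      finally show "norm (exp (z * of_real w) * of_real (1 - ps R w)) \<le> (exp ((Re z + 1) * w) + exp ((Re z - 1) * w)) / R" .
    qed
    also have "\<dots> \<le> C / R" unfolding C_def using L R by (auto intro!: divide_right_mono)
    finally show ?thesis .
  qed
  have nn: "0 \<le> (LINT w|K 0. exp (s * w))" for s :: real
    by (rule Bochner_Integration.integral_nonneg) simp
  then have C0: "C \<ge> 0" unfolding C_def using C1[of 0] C2[of 0] by (meson add_nonneg_nonneg order_trans)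
  show "(\<lambda>n. LINT w|K n. exp (z * of_real w)) \<longlonglongrightarrow> (LINT w|N. exp (z * complex_of_real w))"
  proof (rule LIMSEQ_I)
    fix e :: real assume "e > 0"
    define R where "R = 3 * (C + 1) / e"
    have R: "R > 0" using \<open>e > 0\<close> C0 by (simp add: R_def)
    have "e / 3 * R = C + 1" using \<open>e > 0\<close> by (simp add: R_def)
    then have CR: "C / R < e / 3" using R by (simp add: pos_divide_less_eq)
    define h where "h = (\<lambda>w. exp (z * complex_of_real w) * of_real (ps R w))"
    have h_bd: "norm (h w) \<le> exp (\<bar>Re z\<bar> * R)" for w
    proof (cases "\<bar>w\<bar> \<le> R")
      case True
      have "Re z * w \<le> \<bar>Re z\<bar> * \<bar>w\<bar>" by (metis abs_ge_self abs_mult)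
      also have "\<dots> \<le> \<bar>Re z\<bar> * R" using True by (intro mult_left_mono) auto
      finally have "Re z * w \<le> \<bar>Re z\<bar> * R" .
      then have "exp (Re z * w) * \<bar>ps R w\<bar> \<le> exp (\<bar>Re z\<bar> * R) * 1"
        using R by (intro mult_mono) (auto simp: ps_def)
      then show ?thesis unfolding h_def norm_mult norm_exp_of_real_times norm_of_real by simp
    next
      case False
      then have "ps R w = 0" using R by (auto simp: ps_def)
      then show ?thesis by (simp add: h_def)
    qed
    have h_cont: "isCont h w" for w
    proof -
      have "continuous_on UNIV h" unfolding h_def ps_def using R by (intro continuous_intros) auto
      then show ?thesis by (simp add: continuous_on_eq_continuous_at)
    qed
    have "(\<lambda>n. LINT w|K n. h w) \<longlonglongrightarrow> (LINT w|N. h w)"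
      by (rule weak_conv_imp_integral_bdd_continuous_conv[OF K N conv h_cont h_bd])
    then obtain n0 where n0: "\<And>n. n \<ge> n0 \<Longrightarrow> norm ((LINT w|K n. h w) - (LINT w|N. h w)) < e / 3"
      using LIMSEQ_D[of _ _ "e/3"] \<open>e > 0\<close> by (metis divide_pos_pos zero_less_numeral)
    have "norm ((LINT w|K n. exp (z * of_real w)) - (LINT w|N. exp (z * complex_of_real w))) < e" if "n \<ge> n0" for n
    proof -
      have 1: "norm ((LINT w|K n. exp (z * of_real w)) - (LINT w|K n. h w)) \<le> C / R"
        unfolding h_def using K int C1 C2 R by (intro trunc) auto
      have 2: "norm ((LINT w|N. exp (z * of_real w)) - (LINT w|N. h w)) \<le> C / R"
        unfolding h_def using N * C1 C2 R by (intro trunc) auto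
      have "norm ((LINT w|K n. exp (z * of_real w)) - (LINT w|N. exp (z * complex_of_real w)))
        \<le> norm ((LINT w|K n. exp (z * of_real w)) - (LINT w|K n. h w)) + norm ((LINT w|K n. h w) - (LINT w|N. h w))
          + norm ((LINT w|N. exp (z * of_real w)) - (LINT w|N. h w))" by (rule norm_diff_triangle3)
      then show ?thesis using 1 2 n0[OF that] CR by linarith
    qed
    then show "\<exists>no. \<forall>n\<ge>no. norm ((LINT w|K n. exp (z * of_real w)) - (LINT w|N. exp (z * complex_of_real w))) < e" by blast
  qed
qed

lemma real_mgf_of_complex:
  assumes "integrable K (\<lambda>w. exp (of_real s * complex_of_real w))" "(LINT w|K. exp (of_real s * complex_of_real w)) = v"
  shows "integrable K (\<lambda>w. exp (s * w))" "(LINT w|K. exp (s * w)) = Re v"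
proof -
  have eq: "exp (of_real s * complex_of_real w) = of_real (exp (s * w))" for w
    by (simp add: exp_of_real flip: of_real_mult)
  show "integrable K (\<lambda>w. exp (s * w))" using assms(1) unfolding eq by (simp only: complex_of_real_integrable_eq)
  show "(LINT w|K. exp (s * w)) = Re v" using assms(2) unfolding eq by auto
qed

text \<open>The limit law is given by its characteristic function only. It is the weak limit of
  compensated compound Poisson laws with jumps \<open>g p\<close> at rates \<open>u / (p * (B g x)\<^sup>2)\<close>, and these
  have uniformly bounded exponential moments.\<close>

lemma (in limit_law) Z_mgf:
  fixes g :: "nat \<Rightarrow> real"
  assumes M: "\<And>p. prime p \<Longrightarrow> 0 \<le> g p \<and> g p \<le> M"
    and B: "filterlim (B g) at_top at_top"
    and hyp: "\<forall>\<^sub>F x in at_top. \<forall>t. \<bar>1 / (B g x)\<^sup>2 * (\<Sum>p | prime p \<and> real p \<le> x \<and> g p \<le> t. (g p)\<^sup>2 / real p) - \<Psi> t\<bar> \<le> C * (1 / (B g x)\<^sup>2)"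
    and L: "real_distribution L" "\<And>t. char L t = exp (of_real u * Z_exponent \<Psi> t)" and u: "u > 0"
  shows "integrable L (\<lambda>w. exp (s * w :: real))"
    and "(LINT w|L. exp (z * complex_of_real w)) = exp (of_real u * cumulant 2 law_moment z)"
proof -
  define A where "A = max 1 (max \<alpha> M)"
  have A: "A \<ge> 1" "A \<ge> \<alpha>" "A \<ge> M" by (auto simp: A_def)
  have "\<forall>\<^sub>F x in at_top. B g x > 0" using B by (simp add: filterlim_at_top_dense)
  with hyp have "\<forall>\<^sub>F x in at_top. B g x > 0 \<and> (\<forall>t. \<bar>1 / (B g x)\<^sup>2 * (\<Sum>p | prime p \<and> real p \<le> x \<and> g p \<le> t. (g p)\<^sup>2 / real p) - \<Psi> t\<bar> \<le> C * (1 / (B g x)\<^sup>2))"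
    by eventually_elim auto
  then obtain x0 where x0: "\<And>x. x \<ge> x0 \<Longrightarrow> B g x > 0"
    "\<And>x t. x \<ge> x0 \<Longrightarrow> \<bar>1 / (B g x)\<^sup>2 * (\<Sum>p | prime p \<and> real p \<le> x \<and> g p \<le> t. (g p)\<^sup>2 / real p) - \<Psi> t\<bar> \<le> C * (1 / (B g x)\<^sup>2)"
    unfolding eventually_at_top_linorder by blast
  define x where "x = (\<lambda>n. x0 + real n)"
  have x: "x n \<ge> x0" for n by (simp add: x_def)
  have Bx: "B g (x n) > 0" for n using x0 x by blast
  have "filterlim x at_top sequentially" unfolding x_def
    by (rule filterlim_tendsto_add_at_top[OF tendsto_const filterlim_real_sequentially])
  then have Binf: "filterlim (\<lambda>n. B g (x n)) at_top sequentially" by (rule filterlim_compose[OF B])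
  have cum: "(\<lambda>n. cumulant 2 (prime_moment g (x n)) z) \<longlonglongrightarrow> cumulant 2 law_moment z" for z
  proof (rule LIM_zero_cancel, rule Lim_null_comparison)
    define R where "R = max 1 (norm z)"
    show "(\<lambda>n. exp (A * R) * C * norm z ^ 3 / (B g (x n))\<^sup>2) \<longlonglongrightarrow> 0"
      by (intro tendsto_divide_0[OF tendsto_const] filterlim_at_top_imp_at_infinity filterlim_pow_at_top Binf) auto
    show "\<forall>\<^sub>F n in sequentially. norm (cumulant 2 (prime_moment g (x n)) z - cumulant 2 law_moment z) \<le> exp (A * R) * C * norm z ^ 3 / (B g (x n))\<^sup>2"
    proof (rule always_eventually, rule allI)
      fix n
      have "norm (of_real ((B g (x n))\<^sup>2) * (cumulant 2 (prime_moment g (x n)) z - cumulant 2 law_moment z)) \<le> exp (A * R) * C * norm z ^ 3"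
        using prime_cumulant_approx(1)[OF M A Bx x0(2)[OF x], of z R] unfolding prime_cumulant_eq[OF Bx] right_diff_distrib R_def by simp
      then show "norm (cumulant 2 (prime_moment g (x n)) z - cumulant 2 law_moment z) \<le> exp (A * R) * C * norm z ^ 3 / (B g (x n))\<^sup>2"
        using Bx[of n] unfolding norm_mult norm_of_real by (simp add: pos_le_divide_eq mult.commute)
    qed
  qed
  have "\<exists>K. real_distribution K \<and> (\<forall>z::complex. integrable K (\<lambda>w. exp (z * of_real w)) \<and>
     (LINT w|K. exp (z * of_real w)) = exp (of_real u * cumulant 2 (prime_moment g (x n)) z))" for n
  proof -
    define r where "r = (\<lambda>p. u / (real p * (B g (x n))\<^sup>2))"
    have r: "r p > 0" if "p \<in> {p. prime p \<and> real p \<le> x n}" for p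
      using that u Bx[of n] prime_gt_0_nat[of p] by (simp add: r_def)
    have "(\<Sum>p | prime p \<and> real p \<le> x n. of_real (r p) * (exp (z * of_real (g p)) - 1 - z * of_real (g p))) = of_real (u / (B g (x n))\<^sup>2) * prime_cumulant g (x n) z" for z
      unfolding prime_cumulant_def sum_distrib_left by (intro sum.cong) (auto simp: r_def mult_ac)
    also have "of_real (u / (B g (x n))\<^sup>2) * prime_cumulant g (x n) z = of_real u * cumulant 2 (prime_moment g (x n)) z" for z
      unfolding prime_cumulant_eq[OF Bx] using Bx[of n] by simp
    finally have eq: "(\<Sum>p | prime p \<and> real p \<le> x n. of_real (r p) * (exp (z * of_real (g p)) - 1 - z * of_real (g p)))
      = of_real u * cumulant 2 (prime_moment g (x n)) z" for z .
    obtain K where "real_distribution K" "\<And>z. integrable K (\<lambda>w. exp (z * complex_of_real w)) \<and>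
      (LINT w|K. exp (z * of_real w)) = exp (\<Sum>p | prime p \<and> real p \<le> x n. of_real (r p) * (exp (z * of_real (g p)) - 1 - z * of_real (g p)))"
      using compound_poisson_exists[OF finite_primes_le_real[of "x n"], of r g] r by blast
    then show ?thesis unfolding eq by blast
  qed
  then obtain K where K: "\<And>n. real_distribution (K n)" and Ki: "\<And>n z. integrable (K n) (\<lambda>w. exp (z * complex_of_real w))"
    and Kv: "\<And>n z. (LINT w|K n. exp (z * complex_of_real w)) = exp (of_real u * cumulant 2 (prime_moment g (x n)) z)"
    by metis
  have lim: "(\<lambda>n. LINT w|K n. exp (z * complex_of_real w)) \<longlonglongrightarrow> exp (of_real u * cumulant 2 law_moment z)" for z
    unfolding Kv by (intro tendsto_intros cum)
  \<comment> \<open>On the imaginary axis the moments are characteristic functions, and their limit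
    is the one prescribed for L. On the real axis the same convergence gives boundedness, the other
    condition for passing to the limit.\<close>
  have conv: "weak_conv_m K L"
  proof (rule levy_continuity[OF K L(1)])
    fix t
    have "char (K n) t = (LINT w|K n. exp ((\<i> * of_real t) * complex_of_real w))" for n
      unfolding char_def by (simp add: algebra_simps)
    then show "(\<lambda>n. char (K n) t) \<longlonglongrightarrow> char L t" using lim[of "\<i> * of_real t"] by (simp add: L(2) Z_exponent_eq)
  qed
  have Kir: "integrable (K n) (\<lambda>w. exp (s * w :: real))" for n s using real_mgf_of_complex[OF Ki refl] by blast
  have bd: "\<exists>C. \<forall>n. (LINT w|K n. exp (s * w)) \<le> C" for s :: real
  proof -
    have "convergent (\<lambda>n. LINT w|K n. exp (of_real s * complex_of_real w))" using lim by (auto simp: convergent_def)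
    then obtain C where C: "\<And>n. norm (LINT w|K n. exp (of_real s * complex_of_real w)) \<le> C"
      using convergent_imp_Bseq Bseq_def by metis
    have "(LINT w|K n. exp (s * w)) \<le> C" for n
      using real_mgf_of_complex(2)[OF Ki refl, of n s] complex_Re_le_cmod order_trans C by metis
    then show ?thesis by blast
  qed
  show "integrable L (\<lambda>w. exp (s * w :: real))" by (rule weak_conv_exp_moment(1)[OF K L(1) conv Kir bd])
  show "(LINT w|L. exp (z * complex_of_real w)) = exp (of_real u * cumulant 2 law_moment z)"
    by (rule LIMSEQ_unique[OF weak_conv_exp_moment(2)[OF K L(1) conv Kir bd] lim])
qed

section \<open>A local limit theorem\<close>

definition fejer :: "real \<Rightarrow> real" where
  "fejer v = (sinc (v / 2))\<^sup>2"

text \<open>Adding the translate by \<open>pi\<close> removes the zeros of the Fejer kernel, while its Fourier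
  transform keeps its support in the interval from -1 to 1.\<close>

definition smoothing_kernel :: "real \<Rightarrow> real" where
  "smoothing_kernel v = fejer v + fejer (v - pi)"

lemma fejer_times_square: "fejer v * v\<^sup>2 = 4 * (sin (v / 2))\<^sup>2"
  unfolding fejer_def by (auto simp: power2_eq_square)

lemma fejer_bounds: "0 \<le> fejer v" "fejer v \<le> 1" "fejer v \<le> 5 * inverse (1 + v\<^sup>2)"
proof -
  show "0 \<le> fejer v" by (simp add: fejer_def)
  have "\<bar>sin x\<bar> \<le> \<bar>x\<bar>" for x :: real
    using sin_x_le_x[of x] sin_x_le_x[of "- x"] sin_x_ge_neg_x[of x] sin_x_ge_neg_x[of "- x"] by (cases "x \<ge> 0") auto
  from this[of "v / 2"] have "\<bar>sinc (v / 2)\<bar> \<le> 1" by (simp add: abs_divide abs_mult divide_le_eq)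
  then show *: "fejer v \<le> 1" unfolding fejer_def by (simp add: abs_square_le_1)
  have "fejer v * (1 + v\<^sup>2) \<le> 1 + 4 * 1"
    using * fejer_times_square[of v] abs_square_le_1[of "sin (v / 2)"] by (simp add: distrib_left)
  then show "fejer v \<le> 5 * inverse (1 + v\<^sup>2)"
    by (simp add: divide_inverse[symmetric] pos_le_divide_eq add_pos_nonneg)
qed

lemma isCont_fejer: "isCont fejer v"
proof -
  have "continuous_on UNIV (\<lambda>v. (sinc (v / 2))\<^sup>2)"
    by (intro continuous_on_power continuous_on_sinc continuous_intros) auto
  then show ?thesis unfolding fejer_def[abs_def] by (simp add: continuous_on_eq_continuous_at)
qed

lemma isCont_kernel: "isCont smoothing_kernel v"
  unfolding smoothing_kernel_def[abs_def] by (intro continuous_intros isCont_o2[OF _ isCont_fejer] isCont_fejer)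

lemma fejer_measurable [measurable]: "fejer \<in> borel_measurable borel"
  by (intro borel_measurable_continuous_onI continuous_at_imp_continuous_on ballI isCont_fejer)

lemma kernel_measurable [measurable]: "smoothing_kernel \<in> borel_measurable borel"
  unfolding smoothing_kernel_def[abs_def] by measurable

lemma integrable_fejer: "integrable lborel fejer"
proof (rule Bochner_Integration.integrable_bound)
  have "integrable lborel (\<lambda>x::real. inverse (1 + x\<^sup>2))"
    using integrable_inverse_1_plus_square by (simp add: set_integrable_def)
  then show "integrable lborel (\<lambda>x::real. 5 * inverse (1 + x\<^sup>2))" by simp
  show "AE v in lborel. norm (fejer v) \<le> norm (5 * inverse (1 + v\<^sup>2))"
    using fejer_bounds by (intro AE_I2) (simp add: abs_of_nonneg order_trans[OF fejer_bounds(3)])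
qed simp

lemma integrable_kernel: "integrable lborel smoothing_kernel"
  unfolding smoothing_kernel_def[abs_def]
  using integrable_fejer lborel_integrable_real_affine[OF integrable_fejer, of 1 "-pi"] by simp

text \<open>The translate turns sin (v / 2) into - cos (v / 2), so the two Fejer terms, each
  weighted by the square of its argument, add up to 4. The kernel thus has no zeros and decays at
  most quadratically.\<close>

lemma kernel_lower: "4 \<le> smoothing_kernel v * (\<bar>v\<bar> + pi)\<^sup>2"
proof -
  have "4 = 4 * (sin (v / 2))\<^sup>2 + 4 * (sin ((v - pi) / 2))\<^sup>2"
  proof -
    have "sin ((v - pi) / 2) = - cos (v / 2)" by (simp add: diff_divide_distrib sin_diff)
    then show ?thesis by (simp flip: distrib_left)
  qed
  also have "\<dots> = fejer v * v\<^sup>2 + fejer (v - pi) * (v - pi)\<^sup>2" by (simp only: fejer_times_square)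
  also have "\<dots> \<le> fejer v * (\<bar>v\<bar> + pi)\<^sup>2 + fejer (v - pi) * (\<bar>v\<bar> + pi)\<^sup>2"
  proof (intro add_mono mult_left_mono fejer_bounds)
    show "v\<^sup>2 \<le> (\<bar>v\<bar> + pi)\<^sup>2" using pi_gt_zero by (subst abs_le_square_iff[symmetric]) linarith
    show "(v - pi)\<^sup>2 \<le> (\<bar>v\<bar> + pi)\<^sup>2" using pi_gt_zero by (subst abs_le_square_iff[symmetric]) linarith
  qed
  finally show ?thesis by (simp add: smoothing_kernel_def distrib_right)
qed

lemma kernel_pos: "smoothing_kernel v > 0"
proof -
  have "smoothing_kernel v * (\<bar>v\<bar> + pi)\<^sup>2 > 0" using kernel_lower[of v] by linarith
  then show ?thesis by (simp add: zero_less_mult_iff)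
qed

lemma kernel_le: "smoothing_kernel v \<le> 2"
  unfolding smoothing_kernel_def using fejer_bounds(2)[of v] fejer_bounds(2)[of "v - pi"] by linarith

section \<open>Fourier transform of the kernel\<close>

definition triangle :: "real \<Rightarrow> real" where
  "triangle t = indicator {-1..1} t * (1 - \<bar>t\<bar>)"

lemma triangle_measurable [measurable]: "triangle \<in> borel_measurable borel"
  unfolding triangle_def[abs_def] by measurable

lemma triangle_bounds: "0 \<le> triangle t" "triangle t \<le> 1"
  unfolding triangle_def by (auto simp: indicator_def)

text \<open>The triangle is integrated over its two linear halves with explicit antiderivatives; v =
  0 is separate because these divide by (i v)^2.\<close>

lemma fejer_fourier: "(LINT t|lborel. of_real (triangle t) * iexp (t * v)) = complex_of_real (fejer v)"
proof -
  let ?f = "\<lambda>t. (1 - of_real t) * exp (\<i> * of_real v * of_real t) :: complex"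
  let ?g = "\<lambda>t. (1 + of_real t) * exp (\<i> * of_real v * of_real t) :: complex"
  have cont: "continuous_on {0..1} ?f" "continuous_on {-1..0} ?g" by (intro continuous_intros)+
  have int: "integrable lborel (\<lambda>t. indicator {0..1} t *\<^sub>R ?f t)" "integrable lborel (\<lambda>t. indicator {-1..0} t *\<^sub>R ?g t)"
    using borel_integrable_compact[OF compact_Icc cont(1)] borel_integrable_compact[OF compact_Icc cont(2)]
    by (simp_all add: set_integrable_def)
  have split: "(LINT t|lborel. of_real (triangle t) * iexp (t * v)) =
     (LINT t|lborel. indicator {0..1} t *\<^sub>R ?f t) + (LINT t|lborel. indicator {-1..0} t *\<^sub>R ?g t)"
    unfolding Bochner_Integration.integral_add[OF int, symmetric]
  proof (rule integral_cong_AE)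
    show "AE t in lborel. of_real (triangle t) * iexp (t * v) = indicator {0..1} t *\<^sub>R ?f t + indicator {-1..0} t *\<^sub>R ?g t"
      using AE_lborel_singleton[of 0]
      by eventually_elim (auto simp: triangle_def indicator_def mult_ac)
  qed measurable
  show ?thesis
  proof (cases "v = 0")
    case True
    define F G where "F = (\<lambda>t::complex. t - t\<^sup>2 / 2)" and "G = (\<lambda>t::complex. t + t\<^sup>2 / 2)"
    have dF: "(F has_field_derivative 1 - t) (at t)" and dG: "(G has_field_derivative 1 + t) (at t)" for t
      unfolding F_def G_def by (auto intro!: derivative_eq_intros)
    have "(LINT t|lborel. indicator {0..1} t *\<^sub>R ?f t) = F (of_real 1) - F (of_real 0)"
    proof (rule integral_FTC_Icc[where F = "\<lambda>t. F (of_real t)"])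
      show "((\<lambda>t. F (of_real t)) has_vector_derivative ?f t) (at t within {0..1})" for t
        using dF[of "of_real t"] True by (intro has_vector_derivative_real_field) (simp add: has_field_derivative_at_within)
    qed (use cont in auto)
    moreover have "(LINT t|lborel. indicator {-1..0} t *\<^sub>R ?g t) = G (of_real 0) - G (of_real (-1))"
    proof (rule integral_FTC_Icc[where F = "\<lambda>t. G (of_real t)"])
      show "((\<lambda>t. G (of_real t)) has_vector_derivative ?g t) (at t within {-1..0})" for t
        using dG[of "of_real t"] True by (intro has_vector_derivative_real_field) (simp add: has_field_derivative_at_within)
    qed (use cont in auto)
    moreover have "F (of_real 1) - F (of_real 0) = 1 / 2" "G (of_real 0) - G (of_real (-1)) = 1 / 2"
      by (simp_all add: F_def G_def)
    ultimately have "(LINT t|lborel. of_real (triangle t) * iexp (t * v)) = 1 / 2 + 1 / 2" unfolding split by (simp only:)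
    then show ?thesis using True by (simp add: fejer_def)
  next
    case False
    define a where "a = \<i> * complex_of_real v"
    have a: "a \<noteq> 0" using False by (simp add: a_def)
    define F where "F = (\<lambda>t::complex. (1 - t) * exp (a * t) / a + exp (a * t) / a\<^sup>2)"
    define G where "G = (\<lambda>t::complex. (1 + t) * exp (a * t) / a - exp (a * t) / a\<^sup>2)"
    have dexp: "((\<lambda>t. exp (a * t)) has_field_derivative a * exp (a * t)) (at t)" for t
      by (auto intro!: derivative_eq_intros)
    have dF: "(F has_field_derivative (1 - t) * exp (a * t)) (at t)" for t
      unfolding F_def
      by (rule derivative_eq_intros refl dexp
        | (simp add: a power2_eq_square add_divide_distrib diff_divide_distrib; fail))+
    have dG: "(G has_field_derivative (1 + t) * exp (a * t)) (at t)" for t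
      unfolding G_def
      by (rule derivative_eq_intros refl dexp
        | (simp add: a power2_eq_square add_divide_distrib diff_divide_distrib; fail))+
    have "(LINT t|lborel. indicator {0..1} t *\<^sub>R ?f t) = F (of_real 1) - F (of_real 0)"
    proof (rule integral_FTC_Icc[where F = "\<lambda>t. F (of_real t)"])
      show "((\<lambda>t. F (of_real t)) has_vector_derivative ?f t) (at t within {0..1})" for t
        unfolding a_def[symmetric] by (rule has_vector_derivative_real_field[OF has_field_derivative_at_within[OF dF]])
    qed (use cont in auto)
    moreover have "(LINT t|lborel. indicator {-1..0} t *\<^sub>R ?g t) = G (of_real 0) - G (of_real (-1))"
    proof (rule integral_FTC_Icc[where F = "\<lambda>t. G (of_real t)"])
      show "((\<lambda>t. G (of_real t)) has_vector_derivative ?g t) (at t within {-1..0})" for t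
        unfolding a_def[symmetric] by (rule has_vector_derivative_real_field[OF has_field_derivative_at_within[OF dG]])
    qed (use cont in auto)
    ultimately have "(LINT t|lborel. of_real (triangle t) * iexp (t * v)) = (exp a + exp (- a) - 2) / a\<^sup>2"
      unfolding split by (simp add: F_def G_def add_divide_distrib diff_divide_distrib)
    also have "exp a + exp (- a) = of_real (2 * cos v)"
    proof -
      have "exp (- a) = exp (\<i> * complex_of_real (- v))" by (simp add: a_def)
      then show ?thesis unfolding a_def exp_Euler by (simp add: cos_of_real sin_of_real)
    qed
    also have "a\<^sup>2 = of_real (- (v\<^sup>2))" by (simp add: a_def power_mult_distrib)
    also have "(of_real (2 * cos v) - 2) / of_real (- (v\<^sup>2)) = complex_of_real ((2 * cos v - 2) / (- (v\<^sup>2)))" by simp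
    also have "(2 * cos v - 2) / (- (v\<^sup>2)) = fejer v"
    proof -
      have "cos v = 1 - 2 * (sin (v / 2))\<^sup>2" using cos_double_sin[of "v / 2"] by simp
      then have "2 - 2 * cos v = fejer v * v\<^sup>2" unfolding fejer_times_square by simp
      then show ?thesis using False by (simp add: field_simps)
    qed
    finally show ?thesis .
  qed
qed

definition kernel_ft :: "real \<Rightarrow> complex" where
  "kernel_ft t = of_real (triangle t) * (1 + iexp (- (t * pi)))"

lemma kernel_ft_measurable [measurable]: "kernel_ft \<in> borel_measurable borel"
  unfolding kernel_ft_def[abs_def] by measurable

lemma norm_kernel_ft: "norm (kernel_ft t) \<le> 2"
proof -
  have "norm (1 + iexp (- (t * pi))) \<le> 1 + 1"
    by (rule order_trans[OF norm_triangle_ineq]) (simp)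
  moreover have "norm (complex_of_real (triangle t)) \<le> 1" using triangle_bounds[of t] by simp
  ultimately show ?thesis unfolding kernel_ft_def norm_mult
    using mult_mono[of "norm (complex_of_real (triangle t))" 1 "norm (1 + iexp (- (t * pi)))" 2] by simp
qed

lemma kernel_ft_outside: "t \<notin> {-1..1} \<Longrightarrow> kernel_ft t = 0"
  by (simp add: kernel_ft_def triangle_def)

lemma integrable_triangle_iexp: "integrable lborel (\<lambda>t. of_real (triangle t) * iexp (t * v))"
proof (rule integrableI_bounded_set[where A="{-1..1}" and B=1])
  show "AE t in lborel. t \<in> {-1..1} \<longrightarrow> norm (of_real (triangle t) * iexp (t * v)) \<le> 1"
    using triangle_bounds by (auto simp: norm_mult)
  show "AE t in lborel. t \<notin> {-1..1} \<longrightarrow> of_real (triangle t) * iexp (t * v) = 0" by (auto simp: triangle_def)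
qed auto

lemma kernel_fourier: "(LINT t|lborel. kernel_ft t * iexp (t * v)) = complex_of_real (smoothing_kernel v)"
proof -
  have "kernel_ft t * iexp (t * v) = of_real (triangle t) * iexp (t * v) + of_real (triangle t) * iexp (t * (v - pi))" for t
  proof -
    have "iexp (t * (v - pi)) = iexp (- (t * pi)) * iexp (t * v)"
      unfolding mult_exp_exp by (simp add: algebra_simps)
    then show ?thesis unfolding kernel_ft_def by (simp add: algebra_simps)
  qed
  then have "(LINT t|lborel. kernel_ft t * iexp (t * v)) =
    (LINT t|lborel. of_real (triangle t) * iexp (t * v) + of_real (triangle t) * iexp (t * (v - pi)))" by simp
  also have "\<dots> = of_real (fejer v) + of_real (fejer (v - pi))"
    by (simp only: Bochner_Integration.integral_add[OF integrable_triangle_iexp integrable_triangle_iexp] fejer_fourier)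
  finally show ?thesis by (simp add: smoothing_kernel_def)
qed

text \<open>By Fubini the left side depends on the characteristic function of Q only on
  [\<theta> - 1, \<theta> + 1], a compact range, where it can be controlled.\<close>

lemma integral_kernel_char:
  assumes "real_distribution Q"
  shows "(LINT v|Q. of_real (smoothing_kernel v) * iexp (\<theta> * v)) = (LINT t|lborel. kernel_ft t * char Q (t + \<theta>))"
proof -
  interpret Q: real_distribution Q by fact
  interpret F: pair_sigma_finite Q lborel ..
  let ?f = "\<lambda>v t. kernel_ft t * iexp (t * v) * iexp (\<theta> * v)"
  have int: "integrable (Q \<Otimes>\<^sub>M lborel) (case_prod ?f)"
  proof (rule integrableI_bounded_set[where A="space Q \<times> {-1..1::real}" and B=2])
    show "emeasure (Q \<Otimes>\<^sub>M lborel) (space Q \<times> {-1..1::real}) < \<infinity>"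
      using Q.emeasure_space_1 by (subst lborel.emeasure_pair_measure_Times) auto
    show "AE x in Q \<Otimes>\<^sub>M lborel. x \<in> space Q \<times> {-1..1::real} \<longrightarrow> norm (case_prod ?f x) \<le> 2"
      using norm_kernel_ft by (intro AE_I2) (auto simp: norm_mult)
    show "AE x in Q \<Otimes>\<^sub>M lborel. x \<notin> space Q \<times> {-1..1::real} \<longrightarrow> case_prod ?f x = 0"
      using kernel_ft_outside by (intro AE_I2) (auto simp: split_beta mem_Times_iff)
  qed measurable
  have "(LINT v|Q. of_real (smoothing_kernel v) * iexp (\<theta> * v)) = (LINT v|Q. LINT t|lborel. ?f v t)"
    by (simp add: kernel_fourier[symmetric])
  also have "\<dots> = (LINT t|lborel. LINT v|Q. ?f v t)" using F.Fubini_integral[OF int] by simp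
  also have "\<dots> = (LINT t|lborel. kernel_ft t * char Q (t + \<theta>))"
  proof (rule Bochner_Integration.integral_cong[OF refl])
    fix t
    have "(LINT v|Q. ?f v t) = (LINT v|Q. kernel_ft t * iexp ((t + \<theta>) * v))"
      by (intro Bochner_Integration.integral_cong[OF refl]) (simp add: mult_exp_exp algebra_simps)
    then show "(LINT v|Q. ?f v t) = kernel_ft t * char Q (t + \<theta>)" unfolding char_def by simp
  qed
  finally show ?thesis .
qed

section \<open>The exponential weight on the half-line and its Gaussian limit\<close>

definition half_exp :: "real \<Rightarrow> real" where "half_exp v = (if 0 \<le> v then exp (- v) else 0)"

lemma half_exp_measurable [measurable]: "half_exp \<in> borel_measurable borel"
  unfolding half_exp_def[abs_def] by measurable

lemma half_exp_bounds: "0 \<le> half_exp v" "half_exp v \<le> 1" by (auto simp: half_exp_def)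

text \<open>Quadratic decay of the kernel loses against exp (- v), so the quotient is a bounded test
  function. The 4 results from pi < 4 and (v + 4)^2 <= 16 exp v.\<close>

lemma half_exp_div_kernel: "norm (half_exp v / smoothing_kernel v) \<le> 4"
proof (cases "v \<ge> 0")
  case True
  have "(v + 4)\<^sup>2 = v\<^sup>2 + 8 * v + 16" by (simp add: power2_eq_square algebra_simps)
  also have "\<dots> \<le> 16 * (1 + v + v\<^sup>2 / 2)" using True by (simp add: zero_le_power2)
  also have "\<dots> \<le> 16 * exp v" using exp_lower_Taylor_quadratic[OF True] by (intro mult_left_mono) auto
  finally have 1: "(v + 4)\<^sup>2 \<le> 16 * exp v" .
  have "4 \<le> smoothing_kernel v * (v + pi)\<^sup>2" using kernel_lower[of v] True by simp
  also have "\<dots> \<le> smoothing_kernel v * (v + 4)\<^sup>2" using kernel_pos[of v] pi_less_4 True by (intro mult_left_mono power_mono) auto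
  also have "\<dots> \<le> smoothing_kernel v * (16 * exp v)" using kernel_pos[of v] 1 by (intro mult_left_mono) auto
  finally have "exp (- v) \<le> 4 * smoothing_kernel v" by (simp add: exp_minus field_simps)
  then show ?thesis using True kernel_pos[of v] by (simp add: half_exp_def field_simps)
qed (simp add: half_exp_def)

lemma isCont_half_exp_div_kernel: "v \<noteq> 0 \<Longrightarrow> isCont (\<lambda>v. half_exp v / smoothing_kernel v) v"
proof -
  assume "v \<noteq> 0"
  have "isCont half_exp v"
  proof (cases "v > 0")
    case True
    have "\<forall>\<^sub>F x in nhds v. half_exp x = exp (- x)"
      using eventually_nhds_in_open[of "{0<..}" v] True by (auto elim!: eventually_mono simp: half_exp_def)
    moreover have "isCont (\<lambda>x. exp (- x)) v" by (intro continuous_intros)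
    ultimately show ?thesis by (simp add: isCont_cong)
  next
    case False
    have "\<forall>\<^sub>F x in nhds v. half_exp x = 0"
      using eventually_nhds_in_open[of "{..<0}" v] False \<open>v \<noteq> 0\<close> by (auto elim!: eventually_mono simp: half_exp_def)
    then show ?thesis by (simp add: isCont_cong)
  qed
  then show ?thesis using isCont_kernel[of v] kernel_pos[of v] by (intro continuous_intros) auto
qed

text \<open>For \<kappa> = 1 / D this is D times the expectation of \<open>half_exp\<close> under
  the centred normal law of variance D^2. In this form \<kappa> = 0 makes sense: it stands for D
  tending to infinity, with value the standard normal density at 0.\<close>

definition gaussian_limit :: "real \<Rightarrow> real" where
  "gaussian_limit \<kappa> = (LINT v|lborel. half_exp v * std_normal_density (\<kappa> * v))"

lemma std_normal_density_bounds: "0 \<le> std_normal_density x" "std_normal_density x \<le> 1"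
proof -
  have "1 \<le> sqrt (2 * pi)" using pi_gt3 by (intro real_le_rsqrt) auto
  moreover have "exp (- x\<^sup>2 / 2) \<le> 1" by simp
  ultimately have "exp (- x\<^sup>2 / 2) \<le> sqrt (2 * pi)" by linarith
  then show "std_normal_density x \<le> 1"
    unfolding std_normal_density_def by (simp add: divide_le_eq)
qed simp

lemma std_normal_density_continuous: "isCont std_normal_density x"
  unfolding std_normal_density_def[abs_def] by (intro continuous_intros) auto

lemma gaussian_weight_limit:
  fixes h :: "real \<Rightarrow> complex"
  assumes h [measurable]: "h \<in> borel_measurable borel" and w: "integrable lborel w" "\<And>v. norm (h v) \<le> w v"
    and k: "k \<longlonglongrightarrow> \<kappa>"
  shows "(\<lambda>n::nat. LINT v|lborel. h v * of_real (std_normal_density (k n * v))) \<longlonglongrightarrow> (LINT v|lborel. h v * of_real (std_normal_density (\<kappa> * v)))"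
proof (rule integral_dominated_convergence[where w=w])
  show "AE v in lborel. (\<lambda>n. h v * of_real (std_normal_density (k n * v))) \<longlonglongrightarrow> h v * of_real (std_normal_density (\<kappa> * v))"
    by (intro AE_I2 tendsto_intros isCont_tendsto_compose[OF std_normal_density_continuous] k)
  show "AE v in lborel. norm (h v * of_real (std_normal_density (k n * v))) \<le> w v" for n
  proof (rule AE_I2)
    fix v
    have "norm (h v * of_real (std_normal_density (k n * v))) \<le> w v * 1"
      unfolding norm_mult norm_of_real using w(2)[of v] order_trans[OF norm_ge_zero w(2)[of v]] std_normal_density_bounds
      by (intro mult_mono) auto
    then show "norm (h v * of_real (std_normal_density (k n * v))) \<le> w v" by simp
  qed
qed (use w in measurable)

definition normal_law :: "real \<Rightarrow> real measure" where
  "normal_law D = distr std_normal_distribution borel (\<lambda>x. D * x)"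

lemma real_distribution_normal_law: "real_distribution (normal_law D)"
proof -
  interpret real_distribution std_normal_distribution by (rule real_dist_normal_dist)
  show ?thesis unfolding normal_law_def by (rule real_distribution_distr) simp
qed

lemma char_normal_law: "char (normal_law D) t = of_real (exp (- (D\<^sup>2 * t\<^sup>2) / 2))"
proof -
  have "char (normal_law D) t = char std_normal_distribution (D * t)"
    unfolding char_def normal_law_def by (subst integral_distr) (auto simp: mult_ac)
  then show ?thesis by (simp add: char_std_normal_distribution power_mult_distrib)
qed

lemma integral_normal_law:
  fixes h :: "real \<Rightarrow> complex"
  assumes [measurable]: "h \<in> borel_measurable borel" and D: "D > 0"
  shows "of_real D * (LINT v|normal_law D. h v) = (LINT v|lborel. h v * of_real (std_normal_density (1 / D * v)))"
proof -
  have "(LINT v|normal_law D. h v) = (LINT x|std_normal_distribution. h (D * x))"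
    unfolding normal_law_def by (subst integral_distr) auto
  also have "\<dots> = (LINT x|lborel. std_normal_density x *\<^sub>R h (D * x))"
    by (subst integral_density) auto
  finally have 1: "(LINT v|normal_law D. h v) = (LINT x|lborel. std_normal_density x *\<^sub>R h (D * x))" .
  have "(LINT v|lborel. h v * of_real (std_normal_density (1 / D * v))) =
    \<bar>D\<bar> *\<^sub>R (LINT x|lborel. h (0 + D * x) * of_real (std_normal_density (1 / D * (0 + D * x))))"
    using D by (intro lborel_integral_real_affine) auto
  then show ?thesis unfolding 1 using D by (simp add: scaleR_conv_of_real mult.commute)
qed

text \<open>The factor D cancels the width 2 / D of the Gaussian, so that errors relative to it
  integrate to something bounded uniformly in D.\<close>

lemma integral_gaussian_shift:
  assumes "D > 0"
  shows "integrable lborel (\<lambda>t. exp (- (D\<^sup>2 * (t + \<theta>)\<^sup>2) / 8))"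
    and "D * (LINT t|lborel. exp (- (D\<^sup>2 * (t + \<theta>)\<^sup>2) / 8)) = 2 * sqrt (2 * pi)"
proof -
  have eq: "exp (- (D\<^sup>2 * (t + \<theta>)\<^sup>2) / 8) = (2 * sqrt (2 * pi) / D) * normal_density (- \<theta>) (2 / D) t" for t
  proof -
    have "sqrt (2 * pi * (2 / D)\<^sup>2) = sqrt (2 * pi) * (2 / D)" using assms by (simp add: real_sqrt_mult)
    then show ?thesis using assms unfolding normal_density_def by (simp add: field_simps power2_eq_square)
  qed
  show "integrable lborel (\<lambda>t. exp (- (D\<^sup>2 * (t + \<theta>)\<^sup>2) / 8))" unfolding eq using assms by simp
  show "D * (LINT t|lborel. exp (- (D\<^sup>2 * (t + \<theta>)\<^sup>2) / 8)) = 2 * sqrt (2 * pi)" unfolding eq using assms by simp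
qed

section \<open>Comparison with normal laws through the kernel\<close>

lemma integrable_char_gaussian_bound:
  assumes "real_distribution Q"
  shows "integrable lborel (\<lambda>t. kernel_ft t * char Q (t + \<theta>))"
proof -
  interpret real_distribution Q by fact
  show ?thesis
  proof (rule integrableI_bounded_set[where A="{-1..1}" and B=2])
    show "AE t in lborel. t \<in> {-1..1} \<longrightarrow> norm (kernel_ft t * char Q (t + \<theta>)) \<le> 2"
      using mult_mono[OF norm_kernel_ft cmod_char_le_1] by (intro AE_I2) (simp add: norm_mult)
    show "AE t in lborel. t \<notin> {-1..1} \<longrightarrow> kernel_ft t * char Q (t + \<theta>) = 0"
      using kernel_ft_outside by (intro AE_I2) simp
  qed auto
qed

lemma kernel_transform_diff:
  assumes Q: "real_distribution Q" and D: "D > 0" and eta: "\<eta> \<ge> 0"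
    and close: "\<And>t. \<bar>t\<bar> \<le> 1 + \<bar>\<theta>\<bar> \<Longrightarrow> norm (char Q t - of_real (exp (- (D\<^sup>2 * t\<^sup>2) / 2))) \<le> \<eta> * exp (- (D\<^sup>2 * t\<^sup>2) / 8)"
  shows "norm (of_real D * (LINT v|Q. of_real (smoothing_kernel v) * iexp (\<theta> * v)) - of_real D * (LINT v|normal_law D. of_real (smoothing_kernel v) * iexp (\<theta> * v)))
     \<le> \<eta> * (4 * sqrt (2 * pi))"
proof -
  let ?d = "\<lambda>t. kernel_ft t * char Q (t + \<theta>) - kernel_ft t * char (normal_law D) (t + \<theta>)"
  have int: "integrable lborel ?d"
    by (intro Bochner_Integration.integrable_diff integrable_char_gaussian_bound Q real_distribution_normal_law)
  have "(LINT v|Q. of_real (smoothing_kernel v) * iexp (\<theta> * v)) - (LINT v|normal_law D. of_real (smoothing_kernel v) * iexp (\<theta> * v)) = (LINT t|lborel. ?d t)"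
    unfolding integral_kernel_char[OF Q] integral_kernel_char[OF real_distribution_normal_law]
    by (rule Bochner_Integration.integral_diff[symmetric]) (intro integrable_char_gaussian_bound Q real_distribution_normal_law)+
  moreover have "norm (LINT t|lborel. ?d t) \<le> (LINT t|lborel. 2 * \<eta> * exp (- (D\<^sup>2 * (t + \<theta>)\<^sup>2) / 8))"
  proof (rule Bochner_Integration.integral_norm_bound_integral[OF int])
    show "integrable lborel (\<lambda>t. 2 * \<eta> * exp (- (D\<^sup>2 * (t + \<theta>)\<^sup>2) / 8))"
      using integral_gaussian_shift(1)[OF D] by (rule integrable_mult_right)
    fix t
    show "norm (?d t) \<le> 2 * \<eta> * exp (- (D\<^sup>2 * (t + \<theta>)\<^sup>2) / 8)"
    proof (cases "t \<in> {-1..1}")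
      case True
      then have "\<bar>t + \<theta>\<bar> \<le> 1 + \<bar>\<theta>\<bar>" by (auto simp: abs_le_iff)
      then have "norm (kernel_ft t * (char Q (t + \<theta>) - of_real (exp (- (D\<^sup>2 * (t + \<theta>)\<^sup>2) / 2)))) \<le> 2 * (\<eta> * exp (- (D\<^sup>2 * (t + \<theta>)\<^sup>2) / 8))"
        unfolding norm_mult by (intro mult_mono norm_kernel_ft close) auto
      then show ?thesis by (simp add: char_normal_law right_diff_distrib)
    qed (use eta kernel_ft_outside in simp)
  qed
  ultimately have "norm (of_real D * ((LINT v|Q. of_real (smoothing_kernel v) * iexp (\<theta> * v)) - (LINT v|normal_law D. of_real (smoothing_kernel v) * iexp (\<theta> * v))))
     \<le> D * (LINT t|lborel. 2 * \<eta> * exp (- (D\<^sup>2 * (t + \<theta>)\<^sup>2) / 8))"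
    using D by (simp add: norm_mult mult_left_mono)
  also have "\<dots> = 2 * \<eta> * (D * (LINT t|lborel. exp (- (D\<^sup>2 * (t + \<theta>)\<^sup>2) / 8)))" by simp
  also have "\<dots> = \<eta> * (4 * sqrt (2 * pi))" unfolding integral_gaussian_shift(2)[OF D] by simp
  finally show ?thesis by (simp add: right_diff_distrib)
qed

lemma real_distribution_density:
  assumes "real_distribution Q" and [measurable]: "h \<in> borel_measurable borel"
    and h: "\<And>v. h v \<ge> 0" "integrable Q h" "(LINT v|Q. h v) = 1"
  shows "real_distribution (density Q h)"
proof -
  interpret real_distribution Q by fact
  have "emeasure (density Q h) (space (density Q h)) = (\<integral>\<^sup>+v. ennreal (h v) \<partial>Q)"
    by (subst emeasure_density) (auto intro!: nn_integral_cong)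
  also have "\<dots> = 1" using h by (subst nn_integral_eq_integral) auto
  finally have "prob_space (density Q h)" by (rule prob_spaceI)
  then show ?thesis by (simp add: real_distribution_def real_distribution_axioms_def)
qed

text \<open>The free weight r serves both sides of the comparison: r = 1 for the given laws, a
  normal density for their limit.\<close>

lemma char_density_kernel:
  fixes Q :: "real measure"
  assumes [measurable_cong]: "sets Q = sets borel" and c: "c > 0" and [measurable]: "r \<in> borel_measurable borel" and r: "\<And>v. r v \<ge> 0"
  shows "char (density Q (\<lambda>v. smoothing_kernel v * r v / c)) t = (LINT v|Q. of_real (smoothing_kernel v) * iexp (t * v) * of_real (r v)) / of_real c"
proof -
  have "char (density Q (\<lambda>v. smoothing_kernel v * r v / c)) t = (LINT v|Q. (smoothing_kernel v * r v / c) *\<^sub>R iexp (t * v))"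
    unfolding char_def using c less_imp_le[OF kernel_pos] r
    by (subst integral_density) (auto intro!: AE_I2 divide_nonneg_pos mult_nonneg_nonneg)
  also have "\<dots> = (LINT v|Q. of_real (smoothing_kernel v) * iexp (t * v) * of_real (r v) / of_real c)"
    by (intro Bochner_Integration.integral_cong) (auto simp: scaleR_conv_of_real)
  finally show ?thesis by simp
qed

text \<open>If D n tends to infinity, the measures D n times \<open>Q n\<close> resemble a multiple
  of Lebesgue measure, of infinite mass, and have no weak limit among finite measures. Multiplied by
  the integrable kernel and normalised they are probability laws with characteristic functions
  \<open>Tn n t / Tn n 0\<close>; after Levy's theorem the kernel is divided out again inside the
  test function.\<close>

lemma half_exp_limit:
  fixes Q :: "nat \<Rightarrow> real measure" and D :: "nat \<Rightarrow> real"
  assumes Q: "\<And>n. real_distribution (Q n)" and D: "\<And>n. D n > 0" and kappa: "(\<lambda>n. 1 / D n) \<longlonglongrightarrow> \<kappa>"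
    and close: "\<And>K e. e > 0 \<Longrightarrow> \<forall>\<^sub>F n in sequentially. \<forall>t. \<bar>t\<bar> \<le> K \<longrightarrow>
       norm (char (Q n) t - of_real (exp (- ((D n)\<^sup>2 * t\<^sup>2) / 2))) \<le> e * exp (- ((D n)\<^sup>2 * t\<^sup>2) / 8)"
  shows "(\<lambda>n. D n * (LINT v|Q n. half_exp v)) \<longlonglongrightarrow> gaussian_limit \<kappa>"
proof -
  define T where "T = (\<lambda>\<theta>. LINT v|lborel. of_real (smoothing_kernel v) * iexp (\<theta> * v) * of_real (std_normal_density (\<kappa> * v)))"
  define Tn where "Tn = (\<lambda>n \<theta>. of_real (D n) * (LINT v|Q n. of_real (smoothing_kernel v) * iexp (\<theta> * v)))"
  have Tn: "(\<lambda>n. Tn n \<theta>) \<longlonglongrightarrow> T \<theta>" for \<theta>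
  proof -
    let ?h = "\<lambda>v. of_real (smoothing_kernel v) * iexp (\<theta> * v)"
    have "(\<lambda>n. LINT v|lborel. ?h v * of_real (std_normal_density (1 / D n * v))) \<longlonglongrightarrow> T \<theta>"
      unfolding T_def using kernel_pos less_imp_le[OF kernel_pos] integrable_kernel
      by (intro gaussian_weight_limit[where w = smoothing_kernel] kappa) (auto simp: norm_mult)
    then have 1: "(\<lambda>n. of_real (D n) * (LINT v|normal_law (D n). ?h v)) \<longlonglongrightarrow> T \<theta>"
      using D by (subst integral_normal_law) auto
    have 2: "(\<lambda>n. Tn n \<theta> - of_real (D n) * (LINT v|normal_law (D n). ?h v)) \<longlonglongrightarrow> 0"
    proof (rule tendstoI)
      fix e :: real assume "e > 0"
      define d where "d = e / (8 * sqrt (2 * pi))"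
      have d: "d > 0" using \<open>e > 0\<close> by (simp add: d_def)
      have "d * (4 * sqrt (2 * pi)) = e / 2" by (simp add: d_def)
      then have de: "d * (4 * sqrt (2 * pi)) < e" using \<open>e > 0\<close> by simp
      show "\<forall>\<^sub>F n in sequentially. dist (Tn n \<theta> - of_real (D n) * (LINT v|normal_law (D n). ?h v)) 0 < e"
        using close[OF d, of "1 + \<bar>\<theta>\<bar>"]
      proof eventually_elim
        case (elim n)
        have "norm (Tn n \<theta> - of_real (D n) * (LINT v|normal_law (D n). ?h v)) \<le> d * (4 * sqrt (2 * pi))"
          unfolding Tn_def using elim d by (intro kernel_transform_diff[OF Q D]) auto
        then show ?case using de unfolding dist_norm by simp
      qed
    qed
    show ?thesis using tendsto_add[OF 2 1] by simp
  qed
  define c where "c = (LINT v|lborel. smoothing_kernel v * std_normal_density (\<kappa> * v))"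
  have kn_int: "integrable lborel (\<lambda>v. smoothing_kernel v * std_normal_density (\<kappa> * v))"
    by (rule Bochner_Integration.integrable_bound[OF integrable_kernel])
      (use kernel_pos std_normal_density_bounds in \<open>auto simp: abs_mult intro!: mult_left_le\<close>)
  have kn_pos: "smoothing_kernel v * std_normal_density (\<kappa> * v) > 0" for v
    using kernel_pos[of v] normal_density_pos[of 1 0 "\<kappa> * v"] by simp
  have T0: "T 0 = of_real c" unfolding T_def c_def by (simp flip: of_real_mult add: integral_complex_of_real)
  have c: "c > 0"
  proof -
    have "c \<ge> 0" unfolding c_def by (intro Bochner_Integration.integral_nonneg less_imp_le kn_pos)
    moreover have "c \<noteq> 0"
    proof
      assume "c = 0"
      then have "AE v in lborel. smoothing_kernel v * std_normal_density (\<kappa> * v) = 0"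
        using integral_nonneg_eq_0_iff_AE[OF kn_int] kn_pos less_imp_le by (auto simp: c_def)
      then have "AE v::real in lborel. False" using kn_pos by (auto elim!: eventually_mono simp: less_le)
      then show False by (simp add: eventually_False ae_filter_eq_bot_iff)
    qed
    ultimately show ?thesis by simp
  qed
  define a where "a = (\<lambda>n. LINT v|Q n. smoothing_kernel v)"
  have k_int: "integrable (Q n) smoothing_kernel" for n
  proof -
    interpret real_distribution "Q n" by (rule Q)
    show ?thesis by (rule integrable_const_bound[where B=2]) (use kernel_le in \<open>auto intro!: AE_I2 simp: abs_of_pos[OF kernel_pos]\<close>)
  qed
  have a: "a n > 0" for n
  proof -
    interpret real_distribution "Q n" by (rule Q)
    show ?thesis unfolding a_def by (rule expectation_greater[OF k_int]) (simp add: kernel_pos)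
  qed
  have Tn0: "Tn n 0 = of_real (D n * a n)" for n unfolding Tn_def a_def by (simp add: integral_complex_of_real)
  have Da: "(\<lambda>n. D n * a n) \<longlonglongrightarrow> c"
    using Tn[of 0] unfolding Tn0 T0 by (simp only: tendsto_of_real_iff)
  define N where "N = (\<lambda>n. density (Q n) (\<lambda>v. smoothing_kernel v * 1 / a n))"
  define L where "L = density lborel (\<lambda>v. smoothing_kernel v * std_normal_density (\<kappa> * v) / c)"
  have N: "real_distribution (N n)" for n
    unfolding N_def by (rule real_distribution_density[OF Q]) (use a[of n] k_int in \<open>auto simp: a_def intro!: divide_nonneg_pos less_imp_le[OF kernel_pos]\<close>)
  have L: "real_distribution L"
  proof -
    have "emeasure L (space L) = (\<integral>\<^sup>+v. ennreal (smoothing_kernel v * std_normal_density (\<kappa> * v) / c) \<partial>lborel)"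
      unfolding L_def by (subst emeasure_density) (auto intro!: nn_integral_cong)
    also have "\<dots> = ennreal (LINT v|lborel. smoothing_kernel v * std_normal_density (\<kappa> * v) / c)"
      using kn_int c kn_pos less_imp_le[OF kn_pos] by (intro nn_integral_eq_integral) (auto intro!: AE_I2)
    also have "\<dots> = 1" using c by (simp add: c_def)
    finally have "prob_space L" by (rule prob_spaceI)
    then show ?thesis by (simp add: real_distribution_def real_distribution_axioms_def L_def)
  qed
  have conv: "weak_conv_m N L"
  proof (rule levy_continuity[OF N L])
    fix t
    have setsQ: "sets (Q n) = sets borel" for n
      using Q[of n] by (simp add: real_distribution_def real_distribution_axioms_def)
    have "char (N n) t = Tn n t / Tn n 0" for n
      unfolding N_def by (subst char_density_kernel[OF setsQ a]) (use D[of n] a[of n] in \<open>auto simp: Tn_def a_def integral_complex_of_real\<close>)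
    moreover have "char L t = T t / T 0"
      unfolding L_def T0 by (subst char_density_kernel[OF _ c]) (auto simp: T_def)
    moreover have "(\<lambda>n. Tn n t / Tn n 0) \<longlonglongrightarrow> T t / T 0" by (rule tendsto_divide[OF Tn Tn]) (use c in \<open>simp add: T0\<close>)
    ultimately show "(\<lambda>n. char (N n) t) \<longlonglongrightarrow> char L t" by simp
  qed
  have "(\<lambda>n. LINT v|N n. half_exp v / smoothing_kernel v) \<longlonglongrightarrow> (LINT v|L. half_exp v / smoothing_kernel v)"
  proof (rule weak_conv_imp_bdd_ae_continuous_conv[OF N L conv])
    \<comment> \<open>The jump of \<open>half_exp\<close> at 0 is harmless: the limit law has a
      density, so the point 0 is null.\<close>
    have "{v. \<not> isCont (\<lambda>v. half_exp v / smoothing_kernel v) v} \<subseteq> {0}" using isCont_half_exp_div_kernel by auto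
    moreover have "emeasure L {0} = 0"
    proof -
      have "emeasure L {0} = (\<integral>\<^sup>+v. ennreal (smoothing_kernel v * std_normal_density (\<kappa> * v) / c) * indicator {0} v \<partial>lborel)"
        unfolding L_def by (subst emeasure_density) auto
      also have "\<dots> = 0"
        by (subst nn_integral_0_iff_AE) (use AE_lborel_singleton[of "0::real"] in \<open>auto elim!: eventually_mono\<close>)
      finally show ?thesis .
    qed
    moreover have "{0} \<in> sets L" by (simp add: L_def)
    ultimately show "emeasure L {v. \<not> isCont (\<lambda>v. half_exp v / smoothing_kernel v) v} = 0"
      by (metis emeasure_mono le_zero_eq)
  qed (use half_exp_div_kernel in auto)
  moreover have "(LINT v|N n. half_exp v / smoothing_kernel v) = (LINT v|Q n. half_exp v) / a n" for n
  proof -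
    have [measurable_cong]: "sets (Q n) = sets borel"
      using Q[of n] by (simp add: real_distribution_def real_distribution_axioms_def)
    have "(LINT v|N n. half_exp v / smoothing_kernel v) = (LINT v|Q n. (smoothing_kernel v * 1 / a n) *\<^sub>R (half_exp v / smoothing_kernel v))"
      unfolding N_def using a[of n] less_imp_le[OF kernel_pos] by (subst integral_density) (auto intro!: AE_I2)
    also have "\<dots> = (LINT v|Q n. half_exp v / a n)"
      using kernel_pos by (intro Bochner_Integration.integral_cong) (auto simp: less_le)
    finally show ?thesis by simp
  qed
  moreover have "(LINT v|L. half_exp v / smoothing_kernel v) = gaussian_limit \<kappa> / c"
  proof -
    have "(LINT v|L. half_exp v / smoothing_kernel v) = (LINT v|lborel. (smoothing_kernel v * std_normal_density (\<kappa> * v) / c) *\<^sub>R (half_exp v / smoothing_kernel v))"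
      unfolding L_def using c less_imp_le[OF kn_pos] by (subst integral_density) (auto intro!: AE_I2)
    also have "\<dots> = (LINT v|lborel. half_exp v * std_normal_density (\<kappa> * v) / c)"
      using kernel_pos by (intro Bochner_Integration.integral_cong) (auto simp: less_le)
    finally show ?thesis by (simp add: gaussian_limit_def)
  qed
  ultimately have "(\<lambda>n. (LINT v|Q n. half_exp v) / a n) \<longlonglongrightarrow> gaussian_limit \<kappa> / c" by simp
  from tendsto_mult[OF Da this] show ?thesis using c a by (simp add: less_le)
qed

text \<open>Permits division by the common limit of the two rescaled tails, and makes the tail in
  the denominator eventually positive.\<close>

lemma gaussian_limit_pos: "gaussian_limit \<kappa> > 0"
proof -
  have i: "integrable lborel (\<lambda>v. half_exp v * std_normal_density (\<kappa> * v))"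
  proof (rule Bochner_Integration.integrable_bound[where f = "\<lambda>v. 8 * smoothing_kernel v"])
    show "AE v in lborel. norm (half_exp v * std_normal_density (\<kappa> * v)) \<le> norm (8 * smoothing_kernel v)"
    proof (rule AE_I2)
      fix v
      have "half_exp v \<le> 4 * smoothing_kernel v"
        using half_exp_div_kernel[of v] kernel_pos[of v] half_exp_bounds[of v] by (simp add: field_simps)
      then have "half_exp v * std_normal_density (\<kappa> * v) \<le> (4 * smoothing_kernel v) * 1"
        using kernel_pos[of v] half_exp_bounds[of v] std_normal_density_bounds[of "\<kappa> * v"] by (intro mult_mono) auto
      then show "norm (half_exp v * std_normal_density (\<kappa> * v)) \<le> norm (8 * smoothing_kernel v)"
        using kernel_pos[of v] half_exp_bounds[of v] by (simp add: abs_mult)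
    qed
  qed (use integrable_kernel in auto)
  have "gaussian_limit \<kappa> \<ge> 0" unfolding gaussian_limit_def
    by (intro Bochner_Integration.integral_nonneg mult_nonneg_nonneg half_exp_bounds) auto
  moreover have "gaussian_limit \<kappa> \<noteq> 0"
  proof
    assume "gaussian_limit \<kappa> = 0"
    then have "AE v in lborel. half_exp v * std_normal_density (\<kappa> * v) = 0"
      using integral_nonneg_eq_0_iff_AE[OF i] half_exp_bounds unfolding gaussian_limit_def by auto
    then have "AE v::real in lborel. v < 0"
      by eventually_elim (use normal_density_pos[of 1 0] in \<open>auto simp: half_exp_def less_le split: if_splits\<close>)
    then have "emeasure lborel {0..(1::real)} = 0"
      by (subst AE_iff_measurable[symmetric, where P = "\<lambda>v. v \<notin> {0..1}"]) (auto elim!: eventually_mono)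
    then show False by simp
  qed
  ultimately show ?thesis by simp
qed

section \<open>Exponential tilting\<close>

text \<open>To be used with q = D^2 t^2 / 2 and R a small fraction of q. Half of the decay exp (- q)
  is spent on exp R, and half of what remains on the factor q; the rest, exp (- q / 4), is the
  factor exp (- D^2 t^2 / 8) that the limit theorem asks for.\<close>

lemma exp_perturbation:
  fixes R \<nu> :: complex
  assumes "q \<ge> 0" "norm R \<le> \<beta> * q" "0 \<le> \<beta>" "\<beta> \<le> 1/2"
  shows "norm (exp (of_real (- q) + R) * (1 + \<nu>) - of_real (exp (- q))) \<le> (4 * \<beta> + norm \<nu>) * exp (- q / 4)"
proof -
  have R2: "norm R \<le> q / 2" using assms mult_right_mono[of \<beta> "1/2" q] by simp
  have eR: "norm (exp R) \<le> exp (q / 2)" using norm_exp[of R] R2 by (meson exp_le_cancel_iff order_trans)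
  have "exp (of_real (- q) + R) * (1 + \<nu>) - of_real (exp (- q)) = of_real (exp (- q)) * ((exp R - 1) + exp R * \<nu>)"
  proof -
    have "exp (of_real (- q) + R) = of_real (exp (- q)) * exp R" by (simp only: exp_add exp_of_real)
    then show ?thesis by (simp add: algebra_simps)
  qed
  also have "norm \<dots> = exp (- q) * norm ((exp R - 1) + exp R * \<nu>)" by (simp add: norm_mult)
  also have "\<dots> \<le> exp (- q) * (exp (q / 2) * (\<beta> * q) + exp (q / 2) * norm \<nu>)"
  proof (intro mult_left_mono order_trans[OF norm_triangle_ineq] add_mono)
    have "norm (exp R - 1) \<le> exp (norm R) * norm R" by (rule norm_exp_minus_1_le)
    also have "\<dots> \<le> exp (q / 2) * (\<beta> * q)" using R2 assms by (intro mult_mono) auto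
    finally show "norm (exp R - 1) \<le> exp (q / 2) * (\<beta> * q)" .
    show "norm (exp R * \<nu>) \<le> exp (q / 2) * norm \<nu>" unfolding norm_mult using eR by (intro mult_right_mono) auto
  qed simp
  also have "\<dots> = exp (- q / 2) * (\<beta> * q + norm \<nu>)"
  proof -
    have "exp (- q) * exp (q / 2) = exp (- q / 2)" by (simp add: mult_exp_exp)
    then show ?thesis by (simp add: distrib_left flip: mult.assoc)
  qed
  also have "\<dots> \<le> exp (- q / 2) * (exp (q / 4) * (4 * \<beta> + norm \<nu>))"
  proof (rule mult_left_mono)
    have 1: "q / 4 \<le> exp (q / 4)" using exp_ge_add_one_self[of "q / 4"] by linarith
    have "\<beta> * q = 4 * \<beta> * (q / 4)" by simp
    also have "\<dots> \<le> 4 * \<beta> * exp (q / 4)" using 1 assms by (intro mult_left_mono) auto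
    finally have "\<beta> * q \<le> exp (q / 4) * (4 * \<beta>)" by (simp add: mult.commute)
    moreover have "1 * norm \<nu> \<le> exp (q / 4) * norm \<nu>" using assms by (intro mult_right_mono) auto
    ultimately show "\<beta> * q + norm \<nu> \<le> exp (q / 4) * (4 * \<beta> + norm \<nu>)" by (simp add: distrib_left)
  qed simp
  also have "exp (- q / 2) * (exp (q / 4) * (4 * \<beta> + norm \<nu>)) = (exp (- q / 2) * exp (q / 4)) * (4 * \<beta> + norm \<nu>)"
    by (simp only: mult.assoc)
  also have "exp (- q / 2) * exp (q / 4) = exp (- q / 4)" by (simp add: mult_exp_exp)
  finally show ?thesis by (simp add: mult.commute)
qed

definition tilt :: "real measure \<Rightarrow> real \<Rightarrow> real \<Rightarrow> real measure" where
  "tilt L \<sigma> T = distr (density L (\<lambda>w. exp (\<sigma> * w) / (LINT w|L. exp (\<sigma> * w)))) borel (\<lambda>w. \<sigma> * (w - T))"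

text \<open>The last identity is the purpose of the tilt: the density exp (\<sigma> w) cancels
  against exp (- v) with v = \<sigma> (w - T), and what remains is the indicator of w >= T.\<close>

lemma tilt_properties:
  assumes L: "real_distribution L" and int: "integrable L (\<lambda>w. exp (\<sigma> * w))" and sigma: "\<sigma> > 0"
  defines "m \<equiv> (LINT w|L. exp (\<sigma> * w))"
  shows "m > 0" and "real_distribution (tilt L \<sigma> T)"
    and "char (tilt L \<sigma> T) t = (LINT w|L. exp ((of_real \<sigma> + \<i> * of_real (\<sigma> * t)) * of_real w)) * exp (- (\<i> * of_real (\<sigma> * t) * of_real T)) / of_real m"
    and "measure L {w. T \<le> w} = m * exp (- (\<sigma> * T)) * (LINT v|tilt L \<sigma> T. half_exp v)"
proof -
  interpret L: real_distribution L by fact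
  have sets [measurable_cong]: "sets L = sets borel" by simp
  show m: "m > 0" unfolding m_def by (rule L.expectation_greater[OF int]) simp
  let ?h = "\<lambda>w. exp (\<sigma> * w) / m"
  have D: "real_distribution (density L ?h)"
    by (rule real_distribution_density[OF L]) (use m int in \<open>auto simp: m_def\<close>)
  interpret D: real_distribution "density L ?h" by (rule D)
  show "real_distribution (tilt L \<sigma> T)"
    unfolding tilt_def m_def[symmetric] by (rule D.real_distribution_distr) simp
  have "char (tilt L \<sigma> T) t = (LINT w|density L ?h. iexp (t * (\<sigma> * (w - T))))"
    unfolding char_def tilt_def m_def[symmetric] by (subst integral_distr) auto
  also have "\<dots> = (LINT w|L. ?h w *\<^sub>R iexp (t * (\<sigma> * (w - T))))"
    using m by (subst integral_density) auto
  also have "\<dots> = (LINT w|L. exp ((of_real \<sigma> + \<i> * of_real (\<sigma> * t)) * of_real w) * (exp (- (\<i> * of_real (\<sigma> * t) * of_real T)) / of_real m))"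
  proof (rule Bochner_Integration.integral_cong[OF refl])
    fix w
    have "of_real (exp (\<sigma> * w)) * iexp (t * (\<sigma> * (w - T))) = exp ((of_real \<sigma> + \<i> * of_real (\<sigma> * t)) * of_real w) * exp (- (\<i> * of_real (\<sigma> * t) * of_real T))"
      unfolding exp_of_real[symmetric] mult_exp_exp by (simp add: algebra_simps)
    then show "?h w *\<^sub>R iexp (t * (\<sigma> * (w - T))) = exp ((of_real \<sigma> + \<i> * of_real (\<sigma> * t)) * of_real w) * (exp (- (\<i> * of_real (\<sigma> * t) * of_real T)) / of_real m)"
      by (simp add: scaleR_conv_of_real)
  qed
  finally show "char (tilt L \<sigma> T) t = (LINT w|L. exp ((of_real \<sigma> + \<i> * of_real (\<sigma> * t)) * of_real w)) * exp (- (\<i> * of_real (\<sigma> * t) * of_real T)) / of_real m"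
    by simp
  have "(LINT v|tilt L \<sigma> T. half_exp v) = (LINT w|density L ?h. half_exp (\<sigma> * (w - T)))"
    unfolding tilt_def m_def[symmetric] by (subst integral_distr) auto
  also have "\<dots> = (LINT w|L. ?h w *\<^sub>R half_exp (\<sigma> * (w - T)))"
    using m by (subst integral_density) auto
  also have "\<dots> = (LINT w|L. exp (\<sigma> * T) / m * indicator {w. T \<le> w} w)"
  proof (rule Bochner_Integration.integral_cong[OF refl])
    fix w
    show "?h w *\<^sub>R half_exp (\<sigma> * (w - T)) = exp (\<sigma> * T) / m * indicator {w. T \<le> w} w"
    proof (cases "T \<le> w")
      case True
      then have "exp (\<sigma> * w) * half_exp (\<sigma> * (w - T)) = exp (\<sigma> * T)"
        using sigma by (simp add: half_exp_def mult_exp_exp algebra_simps)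
      then show ?thesis using True by simp
    next
      case False
      then have "\<sigma> * (w - T) < 0" using sigma by (simp add: mult_pos_neg)
      then show ?thesis using False by (simp add: half_exp_def)
    qed
  qed
  also have "\<dots> = exp (\<sigma> * T) / m * measure L {w. T \<le> w}" by simp
  finally show "measure L {w. T \<le> w} = m * exp (- (\<sigma> * T)) * (LINT v|tilt L \<sigma> T. half_exp v)"
    using m by (simp add: exp_minus)
qed

section \<open>Tilted laws at the saddle point\<close>

context limit_law
begin

definition law_bound :: real where "law_bound = max 1 \<alpha>"

definition law_const :: real where "law_const = law_bound * exp law_bound"

sublocale moment_seq law_moment law_bound
  by (rule moment_seq_law) (auto simp: law_bound_def)

lemma law_const_pos: "law_const > 0"
  using A by (simp add: law_const_def)

abbreviation "\<Lambda> \<equiv> cumulant 2 law_moment"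

text \<open>Frequency t corresponds to z = \<sigma> (1 + i t). The threshold b^2 s is b^2 times the
  derivative of the cumulant at \<sigma>, so the translation cancels the linear term of the
  exponent; what is left is - (\<sigma> b)^2 t^2 / 2 up to a Taylor remainder of relative size O(s
  (1 + K)). The error e of the moments enters through a quotient whose denominator is at least 1/2,
  hence 4 e.\<close>

lemma tilted_char_close:
  assumes L: "real_distribution L" and int: "integrable L (\<lambda>w. exp (\<sigma> * w))"
    and b: "b > 0" and sigma: "0 < \<sigma>" "\<sigma> \<le> 2 * s" and saddle: "cumulant 1 law_moment (of_real \<sigma>) = of_real s"
    and K: "\<bar>t\<bar> \<le> K" and small: "8 * law_const * (s * (1 + K)) \<le> 1" "2 * s * (1 + K) \<le> 1"
    and mgf: "\<And>z. norm z \<le> 2 * (1 + K) * s \<Longrightarrow> norm ((LINT w|L. exp (z * complex_of_real w)) / exp (of_real (b\<^sup>2) * \<Lambda> z) - 1) \<le> e" and e: "e \<le> 1/2"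
  shows "norm (char (tilt L \<sigma> (b\<^sup>2 * s)) t - of_real (exp (- ((\<sigma> * b)\<^sup>2 * t\<^sup>2) / 2)))
      \<le> (16 * law_const * (s * (1 + K)) + 4 * e) * exp (- ((\<sigma> * b)\<^sup>2 * t\<^sup>2) / 8)"
proof -
  define z where "z = of_real \<sigma> + \<i> * complex_of_real (\<sigma> * t)"
  define z0 where "z0 = complex_of_real \<sigma>"
  define r where "r = 2 * s * (1 + K)"
  define \<phi> where "\<phi> = (\<lambda>z. LINT w|L. exp (z * complex_of_real w))"
  define \<omega> where "\<omega> = (\<lambda>z. \<phi> z / exp (of_real (b\<^sup>2) * \<Lambda> z) - 1)"
  have s: "s > 0" using sigma by linarith
  have K0: "K \<ge> 0" using K by linarith
  have nz: "norm z \<le> r"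
  proof -
    have "norm z \<le> \<sigma> + \<sigma> * \<bar>t\<bar>"
      unfolding z_def using sigma by (intro order_trans[OF norm_triangle_ineq]) (simp add: norm_mult abs_mult)
    also have "\<dots> = \<sigma> * (1 + \<bar>t\<bar>)" by (simp add: distrib_left)
    also have "\<dots> \<le> (2 * s) * (1 + K)" using sigma K by (intro mult_mono) auto
    finally show ?thesis by (simp add: r_def)
  qed
  have nz0: "norm z0 \<le> r"
  proof -
    have "2 * s * 1 \<le> 2 * s * (1 + K)" using s K0 by (intro mult_left_mono) auto
    moreover have "norm z0 \<le> 2 * s * 1" unfolding z0_def using sigma by simp
    ultimately show ?thesis unfolding r_def by linarith
  qed
  have om: "norm (\<omega> z) \<le> e" "norm (\<omega> z0) \<le> e"
    using mgf[of z] mgf[of z0] nz nz0 by (simp_all add: \<omega>_def \<phi>_def r_def mult_ac)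
  have phi: "\<phi> z' = exp (of_real (b\<^sup>2) * \<Lambda> z') * (1 + \<omega> z')" for z' by (simp add: \<omega>_def)
  have phi0: "\<phi> z0 = of_real (LINT w|L. exp (\<sigma> * w))"
    unfolding \<phi>_def z0_def integral_complex_of_real[symmetric]
    by (intro Bochner_Integration.integral_cong refl) (simp add: exp_of_real flip: of_real_mult)
  define E where "E = of_real (b\<^sup>2) * (\<Lambda> z - \<Lambda> z0 - cumulant 1 law_moment z0 * (z - z0))"
  define q where "q = (\<sigma> * b)\<^sup>2 * t\<^sup>2 / 2"
  define R where "R = E + of_real q"
  define \<nu> where "\<nu> = (1 + \<omega> z) / (1 + \<omega> z0) - 1"
  have zz: "z - z0 = \<i> * complex_of_real (\<sigma> * t)" by (simp add: z_def z0_def)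
  have half: "norm (1 + \<omega> z0) \<ge> 1/2" using norm_diff_ineq[of 1 "\<omega> z0"] om(2) e by simp
  then have "1 + \<omega> z0 \<noteq> 0" by auto
  then have ch: "char (tilt L \<sigma> (b\<^sup>2 * s)) t = exp E * (1 + \<nu>)"
  proof -
    have "char (tilt L \<sigma> (b\<^sup>2 * s)) t = \<phi> z * exp (- (\<i> * of_real (\<sigma> * t) * of_real (b\<^sup>2 * s))) / \<phi> z0"
      using tilt_properties(3)[OF L int sigma(1), of "b\<^sup>2 * s" t] unfolding phi0 by (simp add: \<phi>_def z_def)
    also have "\<dots> = exp (of_real (b\<^sup>2) * \<Lambda> z) * exp (- (\<i> * of_real (\<sigma> * t) * of_real (b\<^sup>2 * s))) / exp (of_real (b\<^sup>2) * \<Lambda> z0) * ((1 + \<omega> z) / (1 + \<omega> z0))"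
      unfolding phi by simp
    also have "exp (of_real (b\<^sup>2) * \<Lambda> z) * exp (- (\<i> * of_real (\<sigma> * t) * of_real (b\<^sup>2 * s))) / exp (of_real (b\<^sup>2) * \<Lambda> z0) = exp E"
      unfolding E_def zz unfolding exp_diff[symmetric] mult_exp_exp z0_def saddle by (simp add: algebra_simps)
    finally show ?thesis by (simp add: \<nu>_def)
  qed
  have nR: "norm R \<le> 2 * law_const * r * q"
  proof -
    have "R = of_real (b\<^sup>2) * (\<Lambda> z - \<Lambda> z0 - cumulant 1 law_moment z0 * (z - z0) - (z - z0)\<^sup>2 / 2)"
      unfolding R_def E_def q_def zz by (simp add: algebra_simps power_mult_distrib)
    then have "norm R = b\<^sup>2 * norm (\<Lambda> z - \<Lambda> z0 - cumulant 1 law_moment z0 * (z - z0) - (z - z0)\<^sup>2 / 2)"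
      by (simp add: norm_mult norm_power)
    also have "\<dots> \<le> b\<^sup>2 * (law_const * r * norm (z - z0) ^ 2)"
      unfolding law_const_def using nz nz0 small by (intro mult_left_mono cumulant2_Taylor) (auto simp: r_def)
    also have "\<dots> = 2 * law_const * r * q" unfolding zz q_def by (simp add: norm_mult power_mult_distrib)
    finally show ?thesis .
  qed
  have beta: "0 \<le> 2 * law_const * r" "2 * law_const * r \<le> 1/2"
    using small law_const_pos s K0 by (auto simp: r_def mult_ac)
  have nu: "norm \<nu> \<le> 4 * e"
  proof -
    have nu_eq: "\<nu> = (\<omega> z - \<omega> z0) / (1 + \<omega> z0)" using \<open>1 + \<omega> z0 \<noteq> 0\<close> by (simp add: \<nu>_def field_simps)
    have "norm (\<omega> z - \<omega> z0) \<le> 2 * e" using om norm_triangle_ineq4[of "\<omega> z" "\<omega> z0"] by linarith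
    then have "norm \<nu> \<le> (2 * e) / (1/2)" using half unfolding nu_eq norm_divide by (intro frac_le) (use order_trans[OF norm_ge_zero om(1)] in auto)
    then show ?thesis by simp
  qed
  have "norm (exp (of_real (- q) + R) * (1 + \<nu>) - of_real (exp (- q))) \<le> (4 * (2 * law_const * r) + norm \<nu>) * exp (- q / 4)"
    using nR beta by (intro exp_perturbation) (auto simp: q_def)
  also have "\<dots> \<le> (4 * (2 * law_const * r) + 4 * e) * exp (- q / 4)" using nu by (intro mult_right_mono) auto
  also have "of_real (- q) + R = E" by (simp add: R_def)
  finally show ?thesis unfolding ch by (simp add: q_def r_def mult_ac)
qed

text \<open>Stated for any laws whose exponential moments behave like exp (b^2 \<Lambda>) near 0.
  The factor in front of the tail depends on b, s and \<sigma> alone, so it cancels when the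
  statement is used for the arithmetic law and for the limit law.\<close>

lemma tail_asymp:
  fixes L :: "nat \<Rightarrow> real measure" and b s \<sigma> :: "nat \<Rightarrow> real"
  assumes L: "\<And>n. real_distribution (L n)" and int: "\<And>n. integrable (L n) (\<lambda>w. exp (\<sigma> n * w))"
    and b: "\<And>n. b n > 0" and sigma: "\<And>n. 0 < \<sigma> n" "\<And>n. \<sigma> n \<le> 2 * s n"
    and saddle: "\<And>n. cumulant 1 law_moment (of_real (\<sigma> n)) = of_real (s n)"
    and s: "s \<longlonglongrightarrow> 0" and kappa: "(\<lambda>n. 1 / (\<sigma> n * b n)) \<longlonglongrightarrow> \<kappa>"
    and mgf: "\<And>K e. e > 0 \<Longrightarrow> \<forall>\<^sub>F n in sequentially. \<forall>z. norm z \<le> K * s n \<longrightarrow>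
       norm ((LINT w|L n. exp (z * complex_of_real w)) / exp (of_real ((b n)\<^sup>2) * \<Lambda> z) - 1) \<le> e"
  shows "(\<lambda>n. \<sigma> n * b n * (measure (L n) {w. (b n)\<^sup>2 * s n \<le> w} * exp (\<sigma> n * ((b n)\<^sup>2 * s n)) / Re (exp (of_real ((b n)\<^sup>2) * \<Lambda> (of_real (\<sigma> n)))))) \<longlonglongrightarrow> gaussian_limit \<kappa>"
proof -
  define Q where "Q = (\<lambda>n. tilt (L n) (\<sigma> n) ((b n)\<^sup>2 * s n))"
  define m where "m = (\<lambda>n. LINT w|L n. exp (\<sigma> n * w))"
  define E where "E = (\<lambda>n. exp (of_real ((b n)\<^sup>2) * \<Lambda> (of_real (\<sigma> n))))"
  have lim: "(\<lambda>n. \<sigma> n * b n * (LINT v|Q n. half_exp v)) \<longlonglongrightarrow> gaussian_limit \<kappa>"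
  proof (rule half_exp_limit[OF _ _ kappa])
    show "real_distribution (Q n)" for n unfolding Q_def by (intro tilt_properties(2) L int sigma)
    show "\<sigma> n * b n > 0" for n using sigma(1) b by simp
    fix K e :: real assume "e > 0"
    define K' where "K' = max 0 K"
    define e' where "e' = min (1/2) (e / 8)"
    have e': "e' > 0" "e' \<le> 1/2" "4 * e' \<le> e / 2" using \<open>e > 0\<close> by (auto simp: e'_def)
    have "(\<lambda>n. 16 * law_const * (s n * (1 + K'))) \<longlonglongrightarrow> 16 * law_const * (0 * (1 + K'))" by (intro tendsto_intros s)
    \<comment> \<open>The 2 encodes the condition 8 * law_const * (s n * (1 + K')) <= 1; the other
      half of e is left to the moments.\<close>
    then have 1: "\<forall>\<^sub>F n in sequentially. 16 * law_const * (s n * (1 + K')) < min (e / 2) 2"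
      using \<open>e > 0\<close> by (intro order_tendstoD(2)) auto
    have "(\<lambda>n. 2 * s n * (1 + K')) \<longlonglongrightarrow> 2 * 0 * (1 + K')" by (intro tendsto_intros s)
    then have 2: "\<forall>\<^sub>F n in sequentially. 2 * s n * (1 + K') < 1"
      by (intro order_tendstoD(2)) auto
    show "\<forall>\<^sub>F n in sequentially. \<forall>t. \<bar>t\<bar> \<le> K \<longrightarrow>
       norm (char (Q n) t - of_real (exp (- ((\<sigma> n * b n)\<^sup>2 * t\<^sup>2) / 2))) \<le> e * exp (- ((\<sigma> n * b n)\<^sup>2 * t\<^sup>2) / 8)"
      using mgf[OF e'(1), of "2 * (1 + K')"] 1 2
    proof eventually_elim
      case (elim n)
      show ?case
      proof (intro allI impI)
        fix t assume "\<bar>t\<bar> \<le> K"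
        then have t: "\<bar>t\<bar> \<le> K'" by (simp add: K'_def)
        have "norm (char (Q n) t - of_real (exp (- ((\<sigma> n * b n)\<^sup>2 * t\<^sup>2) / 2))) \<le> (16 * law_const * (s n * (1 + K')) + 4 * e') * exp (- ((\<sigma> n * b n)\<^sup>2 * t\<^sup>2) / 8)"
          unfolding Q_def using elim by (intro tilted_char_close[OF L int b sigma saddle t _ _ _ e'(2)]) auto
        also have "\<dots> \<le> e * exp (- ((\<sigma> n * b n)\<^sup>2 * t\<^sup>2) / 8)" using elim e' by (intro mult_right_mono) auto
        finally show "norm (char (Q n) t - of_real (exp (- ((\<sigma> n * b n)\<^sup>2 * t\<^sup>2) / 2))) \<le> e * exp (- ((\<sigma> n * b n)\<^sup>2 * t\<^sup>2) / 8)" .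
      qed
    qed
  qed
  have mE: "(\<lambda>n. of_real (m n) / E n) \<longlonglongrightarrow> 1"
  proof (rule LIM_zero_cancel, rule tendstoI)
    fix e :: real assume "e > 0"
    have "\<forall>\<^sub>F n in sequentially. \<forall>z. norm z \<le> 2 * s n \<longrightarrow>
       norm ((LINT w|L n. exp (z * complex_of_real w)) / exp (of_real ((b n)\<^sup>2) * \<Lambda> z) - 1) \<le> e / 2"
      using mgf[of "e / 2" 2] \<open>e > 0\<close> by simp
    then show "\<forall>\<^sub>F n in sequentially. dist (of_real (m n) / E n - 1) 0 < e"
    proof eventually_elim
      case (elim n)
      have "of_real (m n) = (LINT w|L n. exp (complex_of_real (\<sigma> n) * complex_of_real w))"
        unfolding m_def integral_complex_of_real[symmetric]
        by (intro Bochner_Integration.integral_cong refl) (simp add: exp_of_real flip: of_real_mult)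
      moreover have "norm (complex_of_real (\<sigma> n)) \<le> 2 * s n" using sigma[of n] by simp
      ultimately have "norm (of_real (m n) / E n - 1) \<le> e / 2" using elim unfolding E_def by metis
      then show ?case using \<open>e > 0\<close> by (simp add: dist_norm)
    qed
  qed
  have E0: "E n \<noteq> 0" for n by (simp add: E_def)
  have m0: "m n > 0" for n unfolding m_def by (rule tilt_properties(1)[OF L int sigma(1)])
  \<comment> \<open>Taking the real part of the reciprocal avoids a separate proof that
    \<open>E n\<close> is real.\<close>
  have mR: "(\<lambda>n. m n / Re (E n)) \<longlonglongrightarrow> 1"
  proof -
    have "(\<lambda>n. Re (1 / (of_real (m n) / E n))) \<longlonglongrightarrow> Re (1 / 1)"
      by (intro tendsto_Re tendsto_divide tendsto_const mE) auto
    then have "(\<lambda>n. 1 / Re (1 / (of_real (m n) / E n))) \<longlonglongrightarrow> 1 / Re (1 / 1)"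
      by (intro tendsto_divide tendsto_const) auto
    moreover have "1 / Re (1 / (of_real (m n) / E n)) = m n / Re (E n)" for n by simp
    ultimately show ?thesis by simp
  qed
  have eq: "measure (L n) {w. (b n)\<^sup>2 * s n \<le> w} * exp (\<sigma> n * ((b n)\<^sup>2 * s n)) = m n * (LINT v|Q n. half_exp v)" for n
    using tilt_properties(4)[OF L int sigma(1), of n "(b n)\<^sup>2 * s n"]
    unfolding Q_def m_def by (simp add: exp_minus field_simps)
  have "(\<lambda>n. (\<sigma> n * b n * (LINT v|Q n. half_exp v)) * (m n / Re (E n))) \<longlonglongrightarrow> gaussian_limit \<kappa> * 1"
    by (intro tendsto_mult lim mR)
  then show ?thesis unfolding eq by (simp add: E_def mult_ac)
qed

end

section \<open>Tail asymptotics\<close>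

definition additive_law :: "(nat \<Rightarrow> real) \<Rightarrow> real \<Rightarrow> real measure" where
  "additive_law g x = distr (measure_pmf (pmf_of_set {n. 1 \<le> n \<and> real n \<le> x})) borel (\<lambda>n. g n - mu g x)"

lemma additive_law_properties:
  assumes x: "x \<ge> 1"
  shows "real_distribution (additive_law g x)"
    and "integrable (additive_law g x) (\<lambda>w. exp (s * w :: real))"
    and "(LINT w|additive_law g x. exp (z * complex_of_real w)) = of_real (x / real (nat \<lfloor>x\<rfloor>)) * tilted_mean g x z"
    and "real (card {n. 1 \<le> n \<and> real n \<le> x \<and> T \<le> g n - mu g x}) = real (nat \<lfloor>x\<rfloor>) * measure (additive_law g x) {w. T \<le> w}"
proof -
  let ?S = "{n::nat. 1 \<le> n \<and> real n \<le> x}"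
  let ?p = "measure_pmf (pmf_of_set ?S)"
  have "1 \<in> ?S" using x by simp
  then have S: "finite ?S" "?S \<noteq> {}" by blast+
  have card: "card ?S = nat \<lfloor>x\<rfloor>" using x by (intro card_nat_le_real) simp
  have N: "real (nat \<lfloor>x\<rfloor>) > 0" using x by simp
  show "real_distribution (additive_law g x)"
    unfolding additive_law_def by (rule prob_space.real_distribution_distr[OF measure_pmf.prob_space_axioms]) simp
  have "integrable ?p (\<lambda>n. exp (s * (g n - mu g x)))"
    by (rule integrable_measure_pmf_finite) (use S in simp)
  then show "integrable (additive_law g x) (\<lambda>w. exp (s * w :: real))"
    unfolding additive_law_def by (subst integrable_distr_eq) auto
  have "(LINT w|additive_law g x. exp (z * complex_of_real w)) = (LINT n|?p. exp (z * complex_of_real (g n - mu g x)))"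
    unfolding additive_law_def by (subst integral_distr) auto
  also have "\<dots> = (\<Sum>n\<in>?S. pmf (pmf_of_set ?S) n *\<^sub>R exp (z * complex_of_real (g n - mu g x)))"
    by (rule integral_measure_pmf) (use S in auto)
  also have "\<dots> = (\<Sum>n\<in>?S. exp (z * complex_of_real (g n - mu g x)) / of_nat (nat \<lfloor>x\<rfloor>))"
    using S card by (intro sum.cong) (auto simp: scaleR_conv_of_real)
  also have "\<dots> = of_real (x / real (nat \<lfloor>x\<rfloor>)) * tilted_mean g x z"
    unfolding tilted_mean_def sum_divide_distrib[symmetric] using x by simp
  finally show "(LINT w|additive_law g x. exp (z * complex_of_real w)) = of_real (x / real (nat \<lfloor>x\<rfloor>)) * tilted_mean g x z" .
  have "measure (additive_law g x) {w. T \<le> w} = measure ?p {n. T \<le> g n - mu g x}"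
    unfolding additive_law_def by (subst measure_distr) (auto simp: vimage_def)
  also have "\<dots> = real (card (?S \<inter> {n. T \<le> g n - mu g x})) / real (card ?S)"
    by (rule measure_pmf_of_set[OF S(2) S(1)])
  also have "?S \<inter> {n. T \<le> g n - mu g x} = {n. 1 \<le> n \<and> real n \<le> x \<and> T \<le> g n - mu g x}" by auto
  finally show "real (card {n. 1 \<le> n \<and> real n \<le> x \<and> T \<le> g n - mu g x}) = real (nat \<lfloor>x\<rfloor>) * measure (additive_law g x) {w. T \<le> w}"
    using N unfolding card by (simp only: nonzero_mult_div_cancel_left times_divide_eq_right less_irrefl simp_thms)
qed

lemma norm_mult3_minus_1_le:
  fixes a b c :: complex
  assumes "norm (a - 1) \<le> e" "norm (b - 1) \<le> e" "norm (c - 1) \<le> e" "e \<le> 1"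
  shows "norm (a * b * c - 1) \<le> 7 * e"
proof -
  have e: "e \<ge> 0" using assms(1) norm_ge_zero order_trans by blast
  have "norm b \<le> 2" "norm c \<le> 2"
    using norm_triangle_sub[of b 1] norm_triangle_sub[of c 1] assms by simp_all
  have "a * b * c - 1 = (a - 1) * b * c + (b - 1) * c + (c - 1)" by (simp add: algebra_simps)
  also have "norm \<dots> \<le> norm (a - 1) * norm b * norm c + norm (b - 1) * norm c + norm (c - 1)"
    by (intro order_trans[OF norm_triangle_ineq] add_mono order_refl) (simp_all add: norm_mult)
  also have "\<dots> \<le> e * 2 * 2 + e * 2 + e"
    using assms \<open>norm b \<le> 2\<close> \<open>norm c \<le> 2\<close> e by (intro add_mono mult_mono) auto
  finally show ?thesis by simp
qed

lemma floor_ratio_tendsto: "((\<lambda>x. x / real (nat \<lfloor>x\<rfloor>)) \<longlongrightarrow> 1) at_top"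
proof -
  have "((\<lambda>x::real. real_of_int \<lfloor>x\<rfloor> / x) \<longlongrightarrow> 1) at_top" by real_asymp
  then have "((\<lambda>x::real. 1 / (real_of_int \<lfloor>x\<rfloor> / x)) \<longlongrightarrow> 1 / 1) at_top" by (intro tendsto_divide tendsto_const) auto
  moreover have "\<forall>\<^sub>F x::real in at_top. 1 / (real_of_int \<lfloor>x\<rfloor> / x) = x / real (nat \<lfloor>x\<rfloor>)"
    using eventually_ge_at_top[of 1] by eventually_elim simp
  ultimately have "((\<lambda>x. x / real (nat \<lfloor>x\<rfloor>)) \<longlongrightarrow> 1 / 1) at_top" by (rule Lim_transform_eventually)
  then show ?thesis by simp
qed

text \<open>Product of three factors tending to 1: x / floor x, the mean value estimate on a fixed
  disc, and the exponential of a difference of cumulants of order z^3. Since s tends to 0, the disc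
  of radius K s eventually lies inside the fixed one.\<close>

lemma (in limit_law) additive_law_mgf:
  fixes x s :: "nat \<Rightarrow> real"
  assumes g: "strongly_additive g" and M: "\<And>p. prime p \<Longrightarrow> 0 \<le> g p \<and> g p \<le> M"
    and x: "filterlim x at_top sequentially" "\<And>n. x n \<ge> 1" and B: "\<And>n. B g (x n) > 0"
    and hyp: "\<And>n t. \<bar>1 / (B g (x n))\<^sup>2 * (\<Sum>p | prime p \<and> real p \<le> x n \<and> g p \<le> t. (g p)\<^sup>2 / real p) - \<Psi> t\<bar> \<le> C * (1 / (B g (x n))\<^sup>2)"
    and s: "s \<longlonglongrightarrow> 0" and e: "e > 0"
  shows "\<forall>\<^sub>F n in sequentially. \<forall>z. norm z \<le> K * s n \<longrightarrow>
       norm ((LINT w|additive_law g (x n). exp (z * complex_of_real w)) / exp (of_real ((B g (x n))\<^sup>2) * \<Lambda> z) - 1) \<le> e"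
proof -
  \<comment> \<open>The 7 = 4 + 2 + 1 is the cost of multiplying three factors that are within e' <=
    1 of 1.\<close>
  define e' where "e' = min 1 (e / 7)"
  have e': "e' > 0" "e' \<le> 1" "7 * e' \<le> e" using e by (auto simp: e'_def)
  define A' where "A' = max 1 (max \<alpha> M)"
  have A': "A' \<ge> 1" "A' \<ge> \<alpha>" "A' \<ge> M" by (auto simp: A'_def)
  obtain d where d: "d > 0" and tm: "\<forall>\<^sub>F x in at_top. \<forall>z. norm z \<le> d \<longrightarrow> norm (tilted_mean g x z / exp (prime_cumulant g x z) - 1) \<le> e'"
    using tilted_mean_asymp[OF g M e'(1)] by blast
  have ev1: "\<forall>\<^sub>F n in sequentially. \<forall>z. norm z \<le> d \<longrightarrow> norm (tilted_mean g (x n) z / exp (prime_cumulant g (x n) z) - 1) \<le> e'"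
    using tm x(1) by (rule eventually_compose_filterlim)
  have "(\<lambda>n. x n / real (nat \<lfloor>x n\<rfloor>)) \<longlonglongrightarrow> 1" using floor_ratio_tendsto x(1) by (rule filterlim_compose)
  then have ev2: "\<forall>\<^sub>F n in sequentially. dist (x n / real (nat \<lfloor>x n\<rfloor>)) 1 < e'" using e'(1) by (rule tendstoD)
  have Ks: "(\<lambda>n. K * s n) \<longlonglongrightarrow> K * 0" by (intro tendsto_intros s)
  then have ev3: "\<forall>\<^sub>F n in sequentially. K * s n < min 1 d" using d by (intro order_tendstoD(2)) auto
  have "(\<lambda>n. exp 1 * (exp (A' * 1) * \<bar>C\<bar> * (K * s n) ^ 3)) \<longlonglongrightarrow> exp 1 * (exp (A' * 1) * \<bar>C\<bar> * (K * 0) ^ 3)"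
    by (intro tendsto_intros s)
  then have ev4: "\<forall>\<^sub>F n in sequentially. exp 1 * (exp (A' * 1) * \<bar>C\<bar> * (K * s n) ^ 3) < e'"
    using e'(1) by (intro order_tendstoD(2)) auto
  show ?thesis using ev1 ev2 ev3 ev4
  proof eventually_elim
    case (elim n)
    show ?case
    proof (intro allI impI)
      fix z :: complex assume z: "norm z \<le> K * s n"
      let ?a = "complex_of_real (x n / real (nat \<lfloor>x n\<rfloor>))"
      let ?b = "tilted_mean g (x n) z / exp (prime_cumulant g (x n) z)"
      let ?u = "prime_cumulant g (x n) z - of_real ((B g (x n))\<^sup>2) * \<Lambda> z"
      have z1: "norm z \<le> 1" "norm z \<le> d" using z elim by auto
      have a: "norm (?a - 1) \<le> e'"
      proof -
        have "?a - 1 = of_real (x n / real (nat \<lfloor>x n\<rfloor>) - 1)" by simp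
        then have "norm (?a - 1) = dist (x n / real (nat \<lfloor>x n\<rfloor>)) 1" by (simp only: norm_of_real dist_real_def)
        then show ?thesis using elim(2) by linarith
      qed
      have b: "norm (?b - 1) \<le> e'" using elim(1) z1 by blast
      have "norm ?u \<le> exp (A' * 1) * C * norm z ^ 3"
        using prime_cumulant_approx(1)[where g = g and x = "x n" and M = M and A = A' and C = C and R = 1 and z = z, OF M A' B hyp z1(1)]
        by simp
      also have "\<dots> \<le> exp (A' * 1) * \<bar>C\<bar> * (K * s n) ^ 3"
      proof (rule mult_mono)
        show "exp (A' * 1) * C \<le> exp (A' * 1) * \<bar>C\<bar>" by (intro mult_left_mono) auto
        show "norm z ^ 3 \<le> (K * s n) ^ 3" using z by (intro power_mono) auto
      qed auto
      finally have u: "norm ?u \<le> exp (A' * 1) * \<bar>C\<bar> * (K * s n) ^ 3" .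
      have le1: "norm ?u \<le> 1"
      proof -
        have "1 * norm ?u \<le> exp 1 * norm ?u" by (intro mult_right_mono) auto
        also have "\<dots> \<le> exp 1 * (exp (A' * 1) * \<bar>C\<bar> * (K * s n) ^ 3)" using u by (intro mult_left_mono) auto
        finally show ?thesis using elim(4) e' by linarith
      qed
      have "norm (exp ?u - 1) \<le> exp (norm ?u) * norm ?u" by (rule norm_exp_minus_1_le)
      also have "\<dots> \<le> exp 1 * (exp (A' * 1) * \<bar>C\<bar> * (K * s n) ^ 3)" using u le1 by (intro mult_mono) auto
      finally have c: "norm (exp ?u - 1) \<le> e'" using elim(4) by linarith
      have "(LINT w|additive_law g (x n). exp (z * complex_of_real w)) / exp (of_real ((B g (x n))\<^sup>2) * \<Lambda> z) = ?a * ?b * exp ?u"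
        unfolding additive_law_properties(3)[OF x(2)] exp_diff by simp
      then show "norm ((LINT w|additive_law g (x n). exp (z * complex_of_real w)) / exp (of_real ((B g (x n))\<^sup>2) * \<Lambda> z) - 1) \<le> e"
        using norm_mult3_minus_1_le[OF a b c e'(2)] e'(3) by simp
    qed
  qed
qed

text \<open>Sequence form of the theorem. The saddle point satisfies \<sigma> / s -> 1, so \<sigma>
  b behaves like \<Delta> and 1 / (\<sigma> b) has the same limit \<kappa> as 1 / \<Delta>.
  Smallness is assumed for every n, which gives a saddle point along the whole sequence.\<close>

lemma (in limit_law) tail_ratio:
  fixes x \<Delta> :: "nat \<Rightarrow> real" and L :: "nat \<Rightarrow> real measure"
  assumes g: "strongly_additive g" and M: "\<And>p. prime p \<Longrightarrow> 0 \<le> g p \<and> g p \<le> M"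
    and x: "filterlim x at_top sequentially" "\<And>n. x n \<ge> 1" and B: "\<And>n. B g (x n) > 0"
    and hyp: "\<And>n t. \<bar>1 / (B g (x n))\<^sup>2 * (\<Sum>p | prime p \<and> real p \<le> x n \<and> g p \<le> t. (g p)\<^sup>2 / real p) - \<Psi> t\<bar> \<le> C * (1 / (B g (x n))\<^sup>2)"
    and L: "\<And>n. real_distribution (L n)" "\<And>n s. integrable (L n) (\<lambda>w. exp (s * w :: real))"
      "\<And>n z. (LINT w|L n. exp (z * complex_of_real w)) = exp (of_real ((B g (x n))\<^sup>2) * \<Lambda> z)"
    and Delta: "\<And>n. \<Delta> n \<ge> 1" and s: "(\<lambda>n. \<Delta> n / B g (x n)) \<longlonglongrightarrow> 0"
    and small: "\<And>n. 8 * law_const * (\<Delta> n / B g (x n)) \<le> 1" "\<And>n. 2 * (\<Delta> n / B g (x n)) \<le> 1"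
    and kappa: "(\<lambda>n. 1 / \<Delta> n) \<longlonglongrightarrow> \<kappa>"
  shows "(\<lambda>n. measure (additive_law g (x n)) {w. \<Delta> n * B g (x n) \<le> w} / measure (L n) {w. \<Delta> n * B g (x n) \<le> w}) \<longlonglongrightarrow> 1"
proof -
  define b where "b = (\<lambda>n. B g (x n))"
  define s where "s = (\<lambda>n. \<Delta> n / b n)"
  have b: "b n > 0" for n using B by (simp add: b_def)
  have s_pos: "s n > 0" for n using Delta[of n] b[of n] by (simp add: s_def)
  have s0: "s \<longlonglongrightarrow> 0" using s by (simp add: s_def b_def)
  have sm: "8 * law_const * s n \<le> 1" "2 * s n \<le> 1" for n using small by (simp_all add: s_def b_def)
  have "\<exists>\<sigma>. 0 \<le> \<sigma> \<and> \<sigma> \<le> 2 * s n \<and> cumulant 1 law_moment (of_real \<sigma>) = of_real (s n)" for n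
  proof (rule saddle_point_exists)
    have "law_const * s n \<ge> 0" using law_const_pos s_pos[of n] by simp
    then show "4 * (law_bound * exp law_bound) * s n \<le> 1" using sm(1)[of n] unfolding law_const_def by linarith
  qed (use s_pos sm in auto)
  then obtain \<sigma> where sigma: "\<And>n. 0 \<le> \<sigma> n" "\<And>n. \<sigma> n \<le> 2 * s n"
    and saddle: "\<And>n. cumulant 1 law_moment (of_real (\<sigma> n)) = of_real (s n)" by metis
  have close: "\<bar>s n - \<sigma> n\<bar> \<le> 4 * law_const * s n * s n" for n
  proof -
    have "norm (cumulant 1 law_moment (of_real (\<sigma> n)) - cumulant 1 law_moment 0 - (of_real (\<sigma> n) - 0)) \<le> law_const * (2 * s n) * norm (complex_of_real (\<sigma> n) - 0)"
      unfolding law_const_def using sm[of n] sigma[of n] s_pos[of n] by (intro cumulant1_Taylor) auto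
    then have "norm (complex_of_real (s n) - of_real (\<sigma> n)) \<le> law_const * (2 * s n) * \<sigma> n"
      unfolding saddle using sigma[of n] cumulant_zero[of 1] by simp
    then have "\<bar>s n - \<sigma> n\<bar> \<le> law_const * (2 * s n) * \<sigma> n"
      by (simp only: norm_of_real of_real_diff[symmetric])
    also have "\<dots> \<le> law_const * (2 * s n) * (2 * s n)" using law_const_pos s_pos[of n] sigma[of n] by (intro mult_left_mono) auto
    finally show ?thesis by simp
  qed
  have ratio_close: "\<bar>\<sigma> n / s n - 1\<bar> \<le> 4 * law_const * s n" for n
  proof -
    have "\<sigma> n / s n - 1 = (\<sigma> n - s n) / s n" using s_pos[of n] by (simp add: diff_divide_distrib)
    then have "\<bar>\<sigma> n / s n - 1\<bar> = \<bar>s n - \<sigma> n\<bar> / s n" using s_pos[of n] by (simp add: abs_minus_commute)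
    also have "\<dots> \<le> (4 * law_const * s n * s n) / s n" using close s_pos[of n] by (intro divide_right_mono) auto
    finally show ?thesis using s_pos[of n] by simp
  qed
  \<comment> \<open>The existence statement admits \<sigma> = 0; being within s / 2 of s excludes
    it.\<close>
  have sig_pos: "\<sigma> n > 0" for n
  proof -
    have "\<bar>\<sigma> n / s n - 1\<bar> \<le> 1/2" using ratio_close[of n] sm(1)[of n] by linarith
    then have "\<sigma> n / s n > 0" by linarith
    then show ?thesis using s_pos[of n] by (simp add: zero_less_divide_iff)
  qed
  have "(\<lambda>n. 4 * law_const * s n) \<longlonglongrightarrow> 4 * law_const * 0" by (intro tendsto_intros s0)
  then have c0: "(\<lambda>n. 4 * law_const * s n) \<longlonglongrightarrow> 0" by simp
  have "(\<lambda>n. \<sigma> n / s n - 1) \<longlonglongrightarrow> 0"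
    by (rule Lim_null_comparison[OF always_eventually c0]) (use ratio_close in simp)
  then have "(\<lambda>n. \<sigma> n / s n) \<longlonglongrightarrow> 1" by (rule LIM_zero_cancel)
  then have "(\<lambda>n. (1 / \<Delta> n) / (\<sigma> n / s n)) \<longlonglongrightarrow> \<kappa> / 1" by (intro tendsto_divide kappa) auto
  moreover have "(1 / \<Delta> n) / (\<sigma> n / s n) = 1 / (\<sigma> n * b n)" for n
    using Delta[of n] b[of n] sig_pos[of n] by (simp add: s_def field_simps)
  ultimately have kap: "(\<lambda>n. 1 / (\<sigma> n * b n)) \<longlonglongrightarrow> \<kappa>" by simp
  have T: "(b n)\<^sup>2 * s n = \<Delta> n * b n" for n using b[of n] by (simp add: s_def power2_eq_square)
  let ?w = "\<lambda>n. \<sigma> n * b n * exp (\<sigma> n * (\<Delta> n * b n)) / Re (exp (of_real ((b n)\<^sup>2) * \<Lambda> (of_real (\<sigma> n))))"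
  have "(\<lambda>n. \<sigma> n * b n * (measure (additive_law g (x n)) {w. (b n)\<^sup>2 * s n \<le> w} * exp (\<sigma> n * ((b n)\<^sup>2 * s n)) / Re (exp (of_real ((b n)\<^sup>2) * \<Lambda> (of_real (\<sigma> n)))))) \<longlonglongrightarrow> gaussian_limit \<kappa>"
  proof (rule tail_asymp[where L = "\<lambda>n. additive_law g (x n)" and b = b and s = s and \<sigma> = \<sigma> and \<kappa> = \<kappa>])
    show "real_distribution (additive_law g (x n))" for n by (rule additive_law_properties(1)[OF x(2)])
    show "integrable (additive_law g (x n)) (\<lambda>w. exp (\<sigma> n * w))" for n by (rule additive_law_properties(2)[OF x(2)])
    show "\<forall>\<^sub>F n in sequentially. \<forall>z. norm z \<le> K * s n \<longrightarrow>
       norm ((LINT w|additive_law g (x n). exp (z * complex_of_real w)) / exp (of_real ((b n)\<^sup>2) * \<Lambda> z) - 1) \<le> e" if "e > 0" for K e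
      unfolding b_def by (rule additive_law_mgf[OF g M x B hyp s0 that])
  qed (fact b sig_pos sigma(2) saddle s0 kap)+
  then have 1: "(\<lambda>n. measure (additive_law g (x n)) {w. \<Delta> n * b n \<le> w} * ?w n) \<longlonglongrightarrow> gaussian_limit \<kappa>"
    unfolding T by (simp add: mult_ac)
  have "(\<lambda>n. \<sigma> n * b n * (measure (L n) {w. (b n)\<^sup>2 * s n \<le> w} * exp (\<sigma> n * ((b n)\<^sup>2 * s n)) / Re (exp (of_real ((b n)\<^sup>2) * \<Lambda> (of_real (\<sigma> n)))))) \<longlonglongrightarrow> gaussian_limit \<kappa>"
  proof (rule tail_asymp[where L = L and b = b and s = s and \<sigma> = \<sigma> and \<kappa> = \<kappa>])
    show "real_distribution (L n)" for n by (rule L(1))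
    show "integrable (L n) (\<lambda>w. exp (\<sigma> n * w))" for n by (rule L(2))
    fix K e :: real assume "e > 0"
    have "(LINT w|L n. exp (z * complex_of_real w)) / exp (of_real ((b n)\<^sup>2) * \<Lambda> z) = 1" for n z
      unfolding L(3) b_def by simp
    then show "\<forall>\<^sub>F n in sequentially. \<forall>z. norm z \<le> K * s n \<longrightarrow>
       norm ((LINT w|L n. exp (z * complex_of_real w)) / exp (of_real ((b n)\<^sup>2) * \<Lambda> z) - 1) \<le> e"
      using \<open>e > 0\<close> by (intro always_eventually) simp
  qed (fact b sig_pos sigma(2) saddle s0 kap)+
  then have 2: "(\<lambda>n. measure (L n) {w. \<Delta> n * b n \<le> w} * ?w n) \<longlonglongrightarrow> gaussian_limit \<kappa>"
    unfolding T by (simp add: mult_ac)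
  have lim: "(\<lambda>n. (measure (additive_law g (x n)) {w. \<Delta> n * b n \<le> w} * ?w n) / (measure (L n) {w. \<Delta> n * b n \<le> w} * ?w n)) \<longlonglongrightarrow> gaussian_limit \<kappa> / gaussian_limit \<kappa>"
    using gaussian_limit_pos[of \<kappa>] by (intro tendsto_divide 1 2) auto
  have "\<forall>\<^sub>F n in sequentially. measure (L n) {w. \<Delta> n * b n \<le> w} * ?w n > 0"
    using order_tendstoD(1)[OF 2 gaussian_limit_pos] .
  then have "\<forall>\<^sub>F n in sequentially. (measure (additive_law g (x n)) {w. \<Delta> n * b n \<le> w} * ?w n) / (measure (L n) {w. \<Delta> n * b n \<le> w} * ?w n)
     = measure (additive_law g (x n)) {w. \<Delta> n * b n \<le> w} / measure (L n) {w. \<Delta> n * b n \<le> w}"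
    by eventually_elim (metis less_irrefl mult_divide_mult_cancel_right mult_zero_right)
  then show ?thesis using lim gaussian_limit_pos[of \<kappa>] unfolding b_def[symmetric] by (simp add: tendsto_cong b_def)
qed

theorem theorem3:
  fixes g :: "nat \<Rightarrow> real" and M \<alpha> :: real and \<Psi> :: "real \<Rightarrow> real"
    and P :: "'a measure" and Z :: "real \<Rightarrow> 'a \<Rightarrow> real" and \<epsilon> :: "real \<Rightarrow> real"
  assumes "strongly_additive g"
    and "\<And>p. prime p \<Longrightarrow> 0 \<le> g p \<and> g p \<le> M"
    and "filterlim (B g) at_top at_top"
    and "distribution_function \<Psi>"
    and "\<Psi> \<noteq> cdf (return borel 0)"
    and "\<alpha> > 0" and "\<Psi> \<alpha> - \<Psi> 0 = 1"
    and "\<exists>C. \<forall>\<^sub>F x in at_top. \<forall>t.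
           \<bar>1 / (B g x)\<^sup>2 * (\<Sum>p | prime p \<and> real p \<le> x \<and> g p \<le> t. (g p)\<^sup>2 / real p) - \<Psi> t\<bar>
             \<le> C * (1 / (B g x)\<^sup>2)"
    and "is_Z_family \<Psi> P Z"
    and "(\<epsilon> \<longlongrightarrow> 0) at_top"
  shows "\<forall>\<eta>>0. \<forall>\<^sub>F x in at_top. \<forall>\<Delta>. 1 \<le> \<Delta> \<and> \<Delta> \<le> \<epsilon> x * B g x \<longrightarrow>
           \<bar>(1 / x * real (card {n. 1 \<le> n \<and> real n \<le> x \<and> (g n - mu g x) / B g x \<ge> \<Delta>}))
              / measure P {\<omega> \<in> space P. Z ((B g x)\<^sup>2) \<omega> \<ge> \<Delta> * B g x} - 1\<bar> < \<eta>"
proof (intro allI impI)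
  fix \<eta> :: real assume eta: "\<eta> > 0"
  interpret limit_law \<Psi> \<alpha> using assms(4,6,7) by unfold_locales
  let ?H = "\<lambda>x C. \<forall>t. \<bar>1 / (B g x)\<^sup>2 * (\<Sum>p | prime p \<and> real p \<le> x \<and> g p \<le> t. (g p)\<^sup>2 / real p) - \<Psi> t\<bar> \<le> C * (1 / (B g x)\<^sup>2)"
  let ?R = "\<lambda>x \<Delta>. (1 / x * real (card {n. 1 \<le> n \<and> real n \<le> x \<and> (g n - mu g x) / B g x \<ge> \<Delta>}))
              / measure P {\<omega> \<in> space P. Z ((B g x)\<^sup>2) \<omega> \<ge> \<Delta> * B g x}"
  obtain C where C: "\<forall>\<^sub>F x in at_top. ?H x C" using assms(8) by blast
  interpret P: prob_space P using assms(9) by (simp add: is_Z_family_def)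
  have Zm [measurable]: "Z u \<in> borel_measurable P" and Zc: "char (distr P borel (Z u)) t = exp (of_real u * Z_exponent \<Psi> t)" if "u \<ge> 0" for u t
    using assms(9) that by (auto simp: is_Z_family_def)
  \<comment> \<open>Below c both smallness conditions for the saddle point hold. They apply because
    \<Delta> / B <= \<epsilon> x, which is eventually less than c.\<close>
  define c where "c = min (1 / (8 * law_const)) (1 / 2)"
  have c: "c > 0" using law_const_pos by (simp add: c_def)
  show "\<forall>\<^sub>F x in at_top. \<forall>\<Delta>. 1 \<le> \<Delta> \<and> \<Delta> \<le> \<epsilon> x * B g x \<longrightarrow> \<bar>?R x \<Delta> - 1\<bar> < \<eta>"
  proof (rule ccontr)
    assume neg: "\<not> (\<forall>\<^sub>F x in at_top. \<forall>\<Delta>. 1 \<le> \<Delta> \<and> \<Delta> \<le> \<epsilon> x * B g x \<longrightarrow> \<bar>?R x \<Delta> - 1\<bar> < \<eta>)"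
    have "\<forall>\<^sub>F x in at_top. B g x > 0" using assms(3) by (simp add: filterlim_at_top_dense)
    moreover have "\<forall>\<^sub>F x in at_top. \<epsilon> x < c" using assms(10) c by (intro order_tendstoD(2)) auto
    ultimately have good: "\<forall>\<^sub>F x in at_top. ?H x C \<and> B g x > 0 \<and> \<epsilon> x < c \<and> x \<ge> real n" for n
      using C eventually_ge_at_top[of "real n"] by eventually_elim auto
    \<comment> \<open>A counterexample at stage n that also meets every condition valid for large x.
      Using Suc n gives x >= 1 from the start, and growth of x survives the passage to a
      subsequence.\<close>
    define W where "W = (\<lambda>n x \<Delta>. (?H x C \<and> B g x > 0 \<and> \<epsilon> x < c \<and> x \<ge> real (Suc n)) \<and> 1 \<le> \<Delta> \<and> \<Delta> \<le> \<epsilon> x * B g x \<and> \<not> \<bar>?R x \<Delta> - 1\<bar> < \<eta>)"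
    have "\<exists>x \<Delta>. (?H x C \<and> B g x > 0 \<and> \<epsilon> x < c \<and> x \<ge> real (Suc n)) \<and> 1 \<le> \<Delta> \<and> \<Delta> \<le> \<epsilon> x * B g x \<and> \<not> \<bar>?R x \<Delta> - 1\<bar> < \<eta>" for n
    proof (rule ccontr)
      assume "\<not> (\<exists>x \<Delta>. (?H x C \<and> B g x > 0 \<and> \<epsilon> x < c \<and> x \<ge> real (Suc n)) \<and> 1 \<le> \<Delta> \<and> \<Delta> \<le> \<epsilon> x * B g x \<and> \<not> \<bar>?R x \<Delta> - 1\<bar> < \<eta>)"
      then have *: "\<forall>\<Delta>. 1 \<le> \<Delta> \<and> \<Delta> \<le> \<epsilon> x * B g x \<longrightarrow> \<bar>?R x \<Delta> - 1\<bar> < \<eta>" if "?H x C \<and> B g x > 0 \<and> \<epsilon> x < c \<and> x \<ge> real (Suc n)" for x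
        using that by blast
      have "\<forall>\<^sub>F x in at_top. \<forall>\<Delta>. 1 \<le> \<Delta> \<and> \<Delta> \<le> \<epsilon> x * B g x \<longrightarrow> \<bar>?R x \<Delta> - 1\<bar> < \<eta>"
        using good[of "Suc n"]
      proof eventually_elim
        case (elim x)
        then show ?case by (rule *)
      qed
      with neg show False by blast
    qed
    then have "\<forall>n. \<exists>x \<Delta>. W n x \<Delta>" unfolding W_def ..
    then obtain x0 \<Delta>0 where W: "\<And>n. W n (x0 n) (\<Delta>0 n)" by metis
    have x0: "?H (x0 n) C" "B g (x0 n) > 0" "\<epsilon> (x0 n) < c" "x0 n \<ge> real (Suc n)"
      "1 \<le> \<Delta>0 n" "\<Delta>0 n \<le> \<epsilon> (x0 n) * B g (x0 n)" "\<not> \<bar>?R (x0 n) (\<Delta>0 n) - 1\<bar> < \<eta>" for n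
      using W[of n] unfolding W_def by blast+
    have "\<forall>n. 1 / \<Delta>0 n \<in> {0..1}"
    proof
      fix n show "1 / \<Delta>0 n \<in> {0..1}" using x0(5)[of n] by simp
    qed
    \<comment> \<open>From \<Delta> >= 1 the numbers 1 / \<Delta> lie in a compact interval; their
      limit may be 0.\<close>
    then obtain \<kappa> r where r: "strict_mono (r :: nat \<Rightarrow> nat)" and kappa: "((\<lambda>n. 1 / \<Delta>0 n) \<circ> r) \<longlonglongrightarrow> \<kappa>"
      using compact_imp_seq_compact[OF compact_Icc[of "0::real" 1]] unfolding seq_compact_def by metis
    define x where "x = x0 \<circ> r"
    define \<Delta> where "\<Delta> = \<Delta>0 \<circ> r"
    define u where "u = (\<lambda>n. (B g (x n))\<^sup>2)"
    define L where "L = (\<lambda>n. distr P borel (Z (u n)))"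
    have x_ge: "x n \<ge> real (Suc n)" for n
      using x0(4)[of "r n"] seq_suble[OF r, of n] by (simp add: x_def)
    have x1: "x n \<ge> 1" for n using x_ge[of n] by simp
    have x_lim: "filterlim x at_top sequentially"
    proof (rule filterlim_at_top_mono[OF filterlim_real_sequentially])
      have "real n \<le> x n" for n using x_ge[of n] by simp
      then show "\<forall>\<^sub>F n in sequentially. real n \<le> x n" by simp
    qed
    have Bx: "B g (x n) > 0" for n using x0(2) by (simp add: x_def)
    have hyp: "\<bar>1 / (B g (x n))\<^sup>2 * (\<Sum>p | prime p \<and> real p \<le> x n \<and> g p \<le> t. (g p)\<^sup>2 / real p) - \<Psi> t\<bar> \<le> C * (1 / (B g (x n))\<^sup>2)" for n t
      using x0(1)[of "r n"] by (simp add: x_def)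
    have D1: "\<Delta> n \<ge> 1" and D2: "\<Delta> n \<le> \<epsilon> (x n) * B g (x n)" for n using x0(5,6) by (simp_all add: x_def \<Delta>_def)
    have u: "u n > 0" for n using Bx[of n] by (simp add: u_def)
    have L_dist: "real_distribution (L n)" for n
      unfolding L_def using u[of n] by (intro P.real_distribution_distr) (simp add: Zm)
    have L_char: "char (L n) t = exp (of_real (u n) * Z_exponent \<Psi> t)" for n t
      unfolding L_def using u[of n] by (intro Zc) simp
    have s_le: "\<Delta> n / B g (x n) \<le> \<epsilon> (x n)" for n using D2[of n] Bx[of n] by (simp add: pos_divide_le_eq)
    have s_lt: "\<Delta> n / B g (x n) < c" for n using s_le[of n] x0(3)[of "r n"] by (simp add: x_def)
    have s_lim: "(\<lambda>n. \<Delta> n / B g (x n)) \<longlonglongrightarrow> 0"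
    proof (rule tendsto_sandwich[OF _ _ tendsto_const])
      show "(\<lambda>n. \<epsilon> (x n)) \<longlonglongrightarrow> 0" by (rule filterlim_compose[OF assms(10) x_lim])
      have "0 \<le> \<Delta> n / B g (x n)" for n using D1[of n] Bx[of n] by simp
      then show "\<forall>\<^sub>F n in sequentially. 0 \<le> \<Delta> n / B g (x n)" by simp
    qed (use s_le in simp)
    have small1: "8 * law_const * (\<Delta> n / B g (x n)) \<le> 1" for n
    proof -
      have "\<Delta> n / B g (x n) \<le> 1 / (8 * law_const)" using s_lt[of n] by (simp add: c_def)
      then show ?thesis using law_const_pos by (simp add: field_simps)
    qed
    have small2: "2 * (\<Delta> n / B g (x n)) \<le> 1" for n
    proof -
      have "c \<le> 1 / 2" by (simp add: c_def)
      then show ?thesis using s_lt[of n] by linarith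
    qed
    have kappa': "(\<lambda>n. 1 / \<Delta> n) \<longlonglongrightarrow> \<kappa>" using kappa by (simp add: \<Delta>_def comp_def)
    have ratio: "(\<lambda>n. measure (additive_law g (x n)) {w. \<Delta> n * B g (x n) \<le> w} / measure (L n) {w. \<Delta> n * B g (x n) \<le> w}) \<longlonglongrightarrow> 1"
    proof (rule tail_ratio[where x = x and \<Delta> = \<Delta> and L = L and C = C and M = M and \<kappa> = \<kappa>])
      \<comment> \<open>For each n the parameter u = B^2 is held fixed, while the approximating
        Poisson laws range over their own sequence tending to infinity.\<close>
      show "integrable (L n) (\<lambda>w. exp (s * w))" for n and s :: real
        by (rule Z_mgf(1)[OF assms(2,3) C L_dist L_char u])
      show "(LINT w|L n. exp (z * complex_of_real w)) = exp (of_real ((B g (x n))\<^sup>2) * \<Lambda> z)" for n z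
        using Z_mgf(2)[OF assms(2,3) C L_dist L_char u] by (simp add: u_def)
    qed (fact assms(1,2) x_lim x1 Bx hyp L_dist D1 s_lim small1 small2 kappa')+
    have "(\<lambda>n. x n / real (nat \<lfloor>x n\<rfloor>)) \<longlonglongrightarrow> 1" using floor_ratio_tendsto x_lim by (rule filterlim_compose)
    from tendsto_divide[OF ratio this] have lim: "(\<lambda>n. measure (additive_law g (x n)) {w. \<Delta> n * B g (x n) \<le> w} / measure (L n) {w. \<Delta> n * B g (x n) \<le> w}
        / (x n / real (nat \<lfloor>x n\<rfloor>))) \<longlonglongrightarrow> 1" by simp
    have eq: "?R (x n) (\<Delta> n) = measure (additive_law g (x n)) {w. \<Delta> n * B g (x n) \<le> w} / measure (L n) {w. \<Delta> n * B g (x n) \<le> w}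
        / (x n / real (nat \<lfloor>x n\<rfloor>))" for n
    proof -
      have "{m. 1 \<le> m \<and> real m \<le> x n \<and> (g m - mu g (x n)) / B g (x n) \<ge> \<Delta> n} = {m. 1 \<le> m \<and> real m \<le> x n \<and> \<Delta> n * B g (x n) \<le> g m - mu g (x n)}"
        using Bx[of n] by (simp add: pos_le_divide_eq)
      then have "real (card {m. 1 \<le> m \<and> real m \<le> x n \<and> (g m - mu g (x n)) / B g (x n) \<ge> \<Delta> n}) = real (nat \<lfloor>x n\<rfloor>) * measure (additive_law g (x n)) {w. \<Delta> n * B g (x n) \<le> w}"
        using additive_law_properties(4)[OF x1] by simp
      moreover have "measure (L n) {w. \<Delta> n * B g (x n) \<le> w} = measure P {\<omega> \<in> space P. Z ((B g (x n))\<^sup>2) \<omega> \<ge> \<Delta> n * B g (x n)}"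
        unfolding L_def u_def by (subst measure_distr) (auto simp: Zm vimage_def intro!: arg_cong[where f = "measure P"])
      ultimately show ?thesis by (simp add: mult.commute)
    qed
    have "\<forall>\<^sub>F n in sequentially. dist (?R (x n) (\<Delta> n)) 1 < \<eta>" unfolding eq by (rule tendstoD[OF lim eta])
    then obtain n where "\<bar>?R (x n) (\<Delta> n) - 1\<bar> < \<eta>"
      unfolding dist_real_def using eventually_happens' sequentially_bot by blast
    then show False using x0(7)[of "r n"] by (simp add: x_def \<Delta>_def)
  qed
qed

end
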